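(* Let $\Lambda$ and $\Gamma$ be artin algebras and let ${}_{\Lambda}U_{\Gamma}$ be a faithfully balanced selforthogonal bimodule. Then ${}_{\Lambda}U$ is QF-3 if and only if $U_{\Gamma}$ is QF-3.
   Context: $\mathrm{mod}\,\Lambda$ (resp. $\mathrm{mod}\,\Gamma^{op}$) denotes the category of finitely generated left $\Lambda$-modules (resp. right $\Gamma$-modules). A bimodule ${}_{\Lambda}U_{\Gamma}$ is faithfully balanced selforthogonal if: (1) ${}_{\Lambda}U\in\mathrm{mod}\,\Lambda$ and $U_{\Gamma}\in\mathrm{mod}\,\Gamma^{op}$; (2) the natural maps $\Lambda\to\mathrm{End}(U_{\Gamma})$ and $\Gamma\to\mathrm{End}({}_{\Lambda}U)^{op}$ are isomorphisms; (3) $\mathrm{Ext}^{i}_{\Lambda}({}_{\Lambda}U,{}_{\Lambda}U)=0$ and $\mathrm{Ext}^{i}_{\Gamma}(U_{\Gamma},U_{\Gamma})=0$ for all $i\geq 1$. A finitely cogenerated module $M$ (in particular any finitely generated module over an artin algebra) is called QF-3 if $M$ cogenerates its injective envelope $E(M)$, i.e. $E(M)$ can be embedded into a direct product of copies of $M$. *)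

theory Defs
  imports "HOL-Algebra.Module" "HOL-Algebra.QuotRing" "HOL-Algebra.Elementary_Groups"
begin

section \<open>Modules over noncommutative rings\<close>

text \<open>
  The library's locale \<open>module\<close> requires a commutative ring of scalars; the following is the same
  locale over an arbitrary unital ring. As there, the multiplicative fields of the record of a
  module are meaningless.
\<close>

locale left_module = R?: ring R + M?: abelian_group M
  for R :: "('r, 'a) ring_scheme" (structure) and M :: "('r, 'm, 'b) module_scheme" (structure) +
  assumes smult_closed [simp, intro]:
      "\<lbrakk>a \<in> carrier R; x \<in> carrier M\<rbrakk> \<Longrightarrow> a \<odot>\<^bsub>M\<^esub> x \<in> carrier M"
    and smult_l_distr:
      "\<lbrakk>a \<in> carrier R; b \<in> carrier R; x \<in> carrier M\<rbrakk> \<Longrightarrow>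
        (a \<oplus> b) \<odot>\<^bsub>M\<^esub> x = a \<odot>\<^bsub>M\<^esub> x \<oplus>\<^bsub>M\<^esub> b \<odot>\<^bsub>M\<^esub> x"
    and smult_r_distr:
      "\<lbrakk>a \<in> carrier R; x \<in> carrier M; y \<in> carrier M\<rbrakk> \<Longrightarrow>
        a \<odot>\<^bsub>M\<^esub> (x \<oplus>\<^bsub>M\<^esub> y) = a \<odot>\<^bsub>M\<^esub> x \<oplus>\<^bsub>M\<^esub> a \<odot>\<^bsub>M\<^esub> y"
    and smult_assoc1:
      "\<lbrakk>a \<in> carrier R; b \<in> carrier R; x \<in> carrier M\<rbrakk> \<Longrightarrow>
        (a \<otimes> b) \<odot>\<^bsub>M\<^esub> x = a \<odot>\<^bsub>M\<^esub> (b \<odot>\<^bsub>M\<^esub> x)"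
    and smult_one [simp]:
      "x \<in> carrier M \<Longrightarrow> \<one> \<odot>\<^bsub>M\<^esub> x = x"

text \<open>Right \<open>R\<close>-modules are rendered as left modules over the opposite ring.\<close>

definition op_ring :: "('r, 'a) ring_scheme \<Rightarrow> 'r ring"
  where "op_ring R = \<lparr>carrier = carrier R, mult = (\<lambda>x y. y \<otimes>\<^bsub>R\<^esub> x), one = \<one>\<^bsub>R\<^esub>,
                      zero = \<zero>\<^bsub>R\<^esub>, add = add R\<rparr>"

definition regular_module :: "('r, 'a) ring_scheme \<Rightarrow> ('r, 'r) module"
  where "regular_module R = \<lparr>carrier = carrier R, mult = (\<otimes>\<^bsub>R\<^esub>), one = \<one>\<^bsub>R\<^esub>,
                             zero = \<zero>\<^bsub>R\<^esub>, add = add R, smult = (\<otimes>\<^bsub>R\<^esub>)\<rparr>"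

text \<open>The direct product of copies of \<open>M\<close> indexed by the set \<open>I\<close>.\<close>

definition power_module :: "('r, 'm, 'a) module_scheme \<Rightarrow> 'i set \<Rightarrow> ('r, 'i \<Rightarrow> 'm) module"
  where "power_module M I =
    \<lparr>carrier = (I \<rightarrow>\<^sub>E carrier M), mult = undefined, one = undefined,
     zero = (\<lambda>i\<in>I. \<zero>\<^bsub>M\<^esub>), add = (\<lambda>x y. \<lambda>i\<in>I. x i \<oplus>\<^bsub>M\<^esub> y i),
     smult = (\<lambda>a x. \<lambda>i\<in>I. a \<odot>\<^bsub>M\<^esub> x i)\<rparr>"

text \<open>Homomorphisms are extensional, so that equality of functions is equality of homomorphisms.\<close>

definition mod_hom ::
    "('r, 'a) ring_scheme \<Rightarrow> ('r, 'm, 'b) module_scheme \<Rightarrow> ('r, 'n, 'c) module_scheme \<Rightarrow> ('m \<Rightarrow> 'n) set"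
  where "mod_hom R M N = {f \<in> carrier M \<rightarrow>\<^sub>E carrier N.
    (\<forall>x\<in>carrier M. \<forall>y\<in>carrier M. f (x \<oplus>\<^bsub>M\<^esub> y) = f x \<oplus>\<^bsub>N\<^esub> f y) \<and>
    (\<forall>a\<in>carrier R. \<forall>x\<in>carrier M. f (a \<odot>\<^bsub>M\<^esub> x) = a \<odot>\<^bsub>N\<^esub> f x)}"

definition hom_group ::
    "('r, 'a) ring_scheme \<Rightarrow> ('r, 'm, 'b) module_scheme \<Rightarrow> ('r, 'n, 'c) module_scheme \<Rightarrow> ('m \<Rightarrow> 'n) monoid"
  where "hom_group R M N =
    \<lparr>carrier = mod_hom R M N, mult = (\<lambda>f g. \<lambda>x\<in>carrier M. f x \<oplus>\<^bsub>N\<^esub> g x),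
     one = (\<lambda>x\<in>carrier M. \<zero>\<^bsub>N\<^esub>)\<rparr>"

definition End_ring :: "('r, 'a) ring_scheme \<Rightarrow> ('r, 'm, 'b) module_scheme \<Rightarrow> ('m \<Rightarrow> 'm) ring"
  where "End_ring R M =
    \<lparr>carrier = mod_hom R M M, mult = (\<lambda>f g. compose (carrier M) f g),
     one = (\<lambda>x\<in>carrier M. x), zero = (\<lambda>x\<in>carrier M. \<zero>\<^bsub>M\<^esub>),
     add = (\<lambda>f g. \<lambda>x\<in>carrier M. f x \<oplus>\<^bsub>M\<^esub> g x)\<rparr>"

definition fin_gen_module :: "('r, 'a) ring_scheme \<Rightarrow> ('r, 'm, 'b) module_scheme \<Rightarrow> bool"
  where "fin_gen_module R M \<longleftrightarrow>
    (\<exists>S. finite S \<and> S \<subseteq> carrier M \<and>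
      (\<forall>x\<in>carrier M. \<exists>c\<in>S \<rightarrow> carrier R. x = (\<Oplus>\<^bsub>M\<^esub>s\<in>S. c s \<odot>\<^bsub>M\<^esub> s)))"


section \<open>Artin algebras\<close>

definition artinian_cring :: "('k, 'a) ring_scheme \<Rightarrow> bool"
  where "artinian_cring K \<longleftrightarrow> cring K \<and>
    (\<forall>I :: nat \<Rightarrow> 'k set. (\<forall>n. ideal (I n) K \<and> I (Suc n) \<subseteq> I n) \<longrightarrow> (\<exists>N. \<forall>n\<ge>N. I n = I N))"

text \<open>
  The algebra \<open>A\<close> carries the scalar multiplication of \<open>K\<close> in its record. The library's locale
  \<open>algebra\<close> is not used because it demands that \<open>A\<close> be commutative.
\<close>

definition artin_algebra :: "('k, 'a) ring_scheme \<Rightarrow> ('k, 'r, 'b) module_scheme \<Rightarrow> bool"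
  where "artin_algebra K A \<longleftrightarrow>
    artinian_cring K \<and> ring A \<and> module K A \<and>
    (\<forall>a\<in>carrier K. \<forall>x\<in>carrier A. \<forall>y\<in>carrier A.
      (a \<odot>\<^bsub>A\<^esub> x) \<otimes>\<^bsub>A\<^esub> y = a \<odot>\<^bsub>A\<^esub> (x \<otimes>\<^bsub>A\<^esub> y) \<and> x \<otimes>\<^bsub>A\<^esub> (a \<odot>\<^bsub>A\<^esub> y) = a \<odot>\<^bsub>A\<^esub> (x \<otimes>\<^bsub>A\<^esub> y)) \<and>
    fin_gen_module K A"


section \<open>Ext groups\<close>

text \<open>
  A resolution \<open>\<dots> \<rightarrow> R^(n 2) \<rightarrow> R^(n 1) \<rightarrow> R^(n 0) \<rightarrow> M \<rightarrow> 0\<close> by finitely generated free modules; the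
  map \<open>d i\<close> goes from \<open>R^(n (i + 1))\<close> to \<open>R^(n i)\<close> and \<open>e\<close> is the augmentation.
\<close>

definition fin_free :: "('r, 'a) ring_scheme \<Rightarrow> nat \<Rightarrow> ('r, nat \<Rightarrow> 'r) module"
  where "fin_free R k = power_module (regular_module R) {..<k}"

definition free_resolution ::
    "('r, 'a) ring_scheme \<Rightarrow> ('r, 'm, 'b) module_scheme \<Rightarrow>
      (nat \<Rightarrow> nat) \<times> (nat \<Rightarrow> (nat \<Rightarrow> 'r) \<Rightarrow> (nat \<Rightarrow> 'r)) \<times> ((nat \<Rightarrow> 'r) \<Rightarrow> 'm) \<Rightarrow> bool"
  where "free_resolution R M = (\<lambda>(n, d, e).
    e \<in> mod_hom R (fin_free R (n 0)) M \<and>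
    (\<forall>i. d i \<in> mod_hom R (fin_free R (n (Suc i))) (fin_free R (n i))) \<and>
    e ` carrier (fin_free R (n 0)) = carrier M \<and>
    d 0 ` carrier (fin_free R (n 1)) = {x \<in> carrier (fin_free R (n 0)). e x = \<zero>\<^bsub>M\<^esub>} \<and>
    (\<forall>i. d (Suc i) ` carrier (fin_free R (n (Suc (Suc i)))) =
      {x \<in> carrier (fin_free R (n (Suc i))). d i x = \<zero>\<^bsub>fin_free R (n i)\<^esub>}))"

definition cocycles ::
    "('r, 'a) ring_scheme \<Rightarrow> (nat \<Rightarrow> nat) \<Rightarrow> (nat \<Rightarrow> (nat \<Rightarrow> 'r) \<Rightarrow> (nat \<Rightarrow> 'r)) \<Rightarrow>
      ('r, 'n, 'b) module_scheme \<Rightarrow> nat \<Rightarrow> ((nat \<Rightarrow> 'r) \<Rightarrow> 'n) set"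
  where "cocycles R n d N i =
    {f \<in> mod_hom R (fin_free R (n i)) N. \<forall>x\<in>carrier (fin_free R (n (Suc i))). f (d i x) = \<zero>\<^bsub>N\<^esub>}"

definition coboundaries ::
    "('r, 'a) ring_scheme \<Rightarrow> (nat \<Rightarrow> nat) \<Rightarrow> (nat \<Rightarrow> (nat \<Rightarrow> 'r) \<Rightarrow> (nat \<Rightarrow> 'r)) \<Rightarrow>
      ('r, 'n, 'b) module_scheme \<Rightarrow> nat \<Rightarrow> ((nat \<Rightarrow> 'r) \<Rightarrow> 'n) set"
  where "coboundaries R n d N i =
    (case i of
       0 \<Rightarrow> {\<lambda>x\<in>carrier (fin_free R (n 0)). \<zero>\<^bsub>N\<^esub>}
     | Suc j \<Rightarrow> (\<lambda>f. compose (carrier (fin_free R (n (Suc j)))) f (d j)) ` mod_hom R (fin_free R (n j)) N)"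

text \<open>
  \<open>Ext\<close> is the cohomology of \<open>Hom(F, N)\<close> for a chosen resolution \<open>F\<close> of \<open>M\<close> as above. Such a
  resolution exists for every finitely generated \<open>M\<close> when \<open>R\<close> is left noetherian, in particular
  over an artin algebra, and the group does not depend on it up to isomorphism. See \<open>Ext_comm_group\<close> below for the group axioms.
\<close>

definition Ext_group ::
    "('r, 'a) ring_scheme \<Rightarrow> nat \<Rightarrow> ('r, 'm, 'b) module_scheme \<Rightarrow> ('r, 'n, 'c) module_scheme \<Rightarrow>
      ((nat \<Rightarrow> 'r) \<Rightarrow> 'n) set monoid"
  where "Ext_group R i M N =
    (case (SOME P. free_resolution R M P) of (n, d, e) \<Rightarrow>
      (hom_group R (fin_free R (n i)) N)\<lparr>carrier := cocycles R n d N i\<rparr> Mod coboundaries R n d N i)"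


section \<open>Faithfully balanced selforthogonal bimodules\<close>

record ('l, 'g, 'u) bimodule = "('l, 'u) module" +
  rsmult :: "'u \<Rightarrow> 'g \<Rightarrow> 'u" (infixl \<open>\<bullet>\<index>\<close> 70)

definition right_module :: "('l, 'g, 'u, 'a) bimodule_scheme \<Rightarrow> ('g, 'u) module"
  where "right_module U =
    \<lparr>carrier = carrier U, mult = undefined, one = undefined,
     zero = \<zero>\<^bsub>U\<^esub>, add = add U,
     smult = (\<lambda>g u. u \<bullet>\<^bsub>U\<^esub> g)\<rparr>"

definition is_bimodule ::
    "('l, 'a) ring_scheme \<Rightarrow> ('g, 'b) ring_scheme \<Rightarrow> ('l, 'g, 'u, 'c) bimodule_scheme \<Rightarrow> bool"
  where "is_bimodule L G U \<longleftrightarrow>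
    ring L \<and> ring G \<and> left_module L U \<and> left_module (op_ring G) (right_module U) \<and>
    (\<forall>a\<in>carrier L. \<forall>g\<in>carrier G. \<forall>u\<in>carrier U. (a \<odot>\<^bsub>U\<^esub> u) \<bullet>\<^bsub>U\<^esub> g = a \<odot>\<^bsub>U\<^esub> (u \<bullet>\<^bsub>U\<^esub> g))"

definition faithfully_balanced_selforthogonal ::
    "('l, 'a) ring_scheme \<Rightarrow> ('g, 'b) ring_scheme \<Rightarrow> ('l, 'g, 'u, 'c) bimodule_scheme \<Rightarrow> bool"
  where "faithfully_balanced_selforthogonal L G U \<longleftrightarrow>
    is_bimodule L G U \<and>
    fin_gen_module L U \<and> fin_gen_module (op_ring G) (right_module U) \<and>
    (\<lambda>a\<in>carrier L. \<lambda>u\<in>carrier U. a \<odot>\<^bsub>U\<^esub> u) \<in> ring_iso L (End_ring (op_ring G) (right_module U)) \<and>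
    (\<lambda>g\<in>carrier G. \<lambda>u\<in>carrier U. u \<bullet>\<^bsub>U\<^esub> g) \<in> ring_iso G (op_ring (End_ring L U)) \<and>
    (\<forall>i\<ge>1. trivial_group (Ext_group L i U U)) \<and>
    (\<forall>i\<ge>1. trivial_group (Ext_group (op_ring G) i (right_module U) (right_module U)))"


section \<open>Injective envelopes and QF-3 modules\<close>

text \<open>
  A definition cannot quantify over types, so the test modules \<open>A\<close> and \<open>B\<close> are those whose carrier
  consists of elements of the type of the ring. They include \<open>R\<close> and its left ideals, so by Baer's
  criterion the lifting property follows for test modules over arbitrary types; see
  \<open>injective_module_lift\<close> below.
\<close>

definition injective_module :: "('r, 'a) ring_scheme \<Rightarrow> ('r, 'e, 'b) module_scheme \<Rightarrow> bool"
  where "injective_module R E \<longleftrightarrow> left_module R E \<and>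
    (\<forall>(A :: ('r, 'r) module) (B :: ('r, 'r) module) f g.
      left_module R A \<and> left_module R B \<and>
      f \<in> mod_hom R A B \<and> inj_on f (carrier A) \<and> g \<in> mod_hom R A E \<longrightarrow>
      (\<exists>h\<in>mod_hom R B E. \<forall>x\<in>carrier A. h (f x) = g x))"

definition injective_envelope ::
    "('r, 'a) ring_scheme \<Rightarrow> ('r, 'm, 'b) module_scheme \<Rightarrow> ('m \<Rightarrow> 'e) \<Rightarrow> ('r, 'e, 'c) module_scheme \<Rightarrow> bool"
  where "injective_envelope R M j E \<longleftrightarrow>
    injective_module R E \<and> j \<in> mod_hom R M E \<and> inj_on j (carrier M) \<and>
    (\<forall>N. submodule N R E \<and> N \<inter> j ` carrier M = {\<zero>\<^bsub>E\<^esub>} \<longrightarrow> N = {\<zero>\<^bsub>E\<^esub>})"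

text \<open>
  If \<open>X\<close> embeds in any direct product of copies of \<open>M\<close>, then it embeds in the one indexed by the
  homomorphisms from \<open>X\<close> to \<open>M\<close>. The index type below is therefore no restriction.
\<close>

definition cogenerates ::
    "('r, 'a) ring_scheme \<Rightarrow> ('r, 'm, 'b) module_scheme \<Rightarrow> ('r, 'x, 'c) module_scheme \<Rightarrow> bool"
  where "cogenerates R M X \<longleftrightarrow>
    (\<exists>(I :: ('x \<Rightarrow> 'm) set) f. f \<in> mod_hom R X (power_module M I) \<and> inj_on f (carrier X))"

text \<open>
  The envelope is unique up to isomorphism, and the type \<open>'r \<Rightarrow> nat \<Rightarrow> 'm\<close> has room for it: \<open>E(M)\<close>
  embeds in the group of additive maps from \<open>R\<close> to a divisible hull of \<open>M\<close>. For \<open>M \<noteq> 0\<close> that hull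
  has at most as many elements as \<open>nat \<Rightarrow> 'm\<close>.
\<close>

definition QF3 :: "('r, 'a) ring_scheme \<Rightarrow> ('r, 'm, 'b) module_scheme \<Rightarrow> bool"
  where "QF3 R M \<longleftrightarrow>
    (\<exists>(E :: ('r, 'r \<Rightarrow> nat \<Rightarrow> 'm) module) j. injective_envelope R M j E \<and> cogenerates R M E)"


section \<open>Adequacy of the definitions\<close>

lemma (in comm_group) sub_comm: "subgroup N G \<Longrightarrow> comm_group (G\<lparr>carrier := N\<rparr>)"
  by (rule group.group_comm_groupI[OF subgroup_imp_group]) (simp_all add: m_comm subgroup.mem_carrier)

context left_module begin

lemma smult_l_null [simp]: "x \<in> carrier M \<Longrightarrow> \<zero> \<odot>\<^bsub>M\<^esub> x = \<zero>\<^bsub>M\<^esub>"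
  using smult_l_distr[of \<zero> \<zero> x] smult_closed[of \<zero> x] M.add.r_cancel_one' by simp

lemma smult_r_null [simp]: "a \<in> carrier R \<Longrightarrow> a \<odot>\<^bsub>M\<^esub> \<zero>\<^bsub>M\<^esub> = \<zero>\<^bsub>M\<^esub>"
  by (metis M.add.r_cancel_one' M.r_zero M.zero_closed smult_closed smult_r_distr)

lemma smult_l_minus:
  assumes "a \<in> carrier R" "x \<in> carrier M"
  shows "(\<ominus> a) \<odot>\<^bsub>M\<^esub> x = \<ominus>\<^bsub>M\<^esub> (a \<odot>\<^bsub>M\<^esub> x)"
  using smult_l_distr[of "\<ominus> a" a x] assms
  by (metis M.minus_equality R.a_inv_closed R.l_neg smult_closed smult_l_null)

lemma submodule_left_module:
  assumes "submodule N R M"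
  shows "left_module R (M\<lparr>carrier := N\<rparr>)"
proof -
  interpret N: submodule N R M by fact
  have sub: "N \<subseteq> carrier M" using N.subset by simp
  have "comm_group (add_monoid M\<lparr>carrier := N\<rparr>)"
    using comm_group.sub_comm[OF M.a_comm_group N.subgroup_axioms] by simp
  then have "abelian_group (M\<lparr>carrier := N\<rparr>)"
    by (simp add: abelian_group_def abelian_group_axioms_def abelian_monoid_def comm_group_def)
  then show ?thesis
    by (intro left_module.intro left_module_axioms.intro R.ring_axioms)
      (use sub in \<open>auto simp: smult_l_distr smult_r_distr smult_assoc1 N.smult_closed subset_iff\<close>)
qed

lemma subset_submodule:
  assumes "N \<subseteq> carrier M" "\<zero>\<^bsub>M\<^esub> \<in> N"
    "\<And>x y. x \<in> N \<Longrightarrow> y \<in> N \<Longrightarrow> x \<oplus>\<^bsub>M\<^esub> y \<in> N"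
    "\<And>a x. a \<in> carrier R \<Longrightarrow> x \<in> N \<Longrightarrow> a \<odot>\<^bsub>M\<^esub> x \<in> N"
  shows "submodule N R M"
proof -
  have "\<ominus>\<^bsub>M\<^esub> x \<in> N" if "x \<in> N" for x
    using assms(4)[of "\<ominus> \<one>" x] that assms(1) smult_l_minus[of \<one> x] by auto
  then show ?thesis
    by (intro submodule.intro submodule_axioms.intro subgroup.intro)
      (use assms in \<open>auto simp: a_inv_def[symmetric]\<close>)
qed

end

lemma (in ring) left_module_regular_module: "left_module R (regular_module R)"
proof -
  have "abelian_group (regular_module R)"
    by (rule abelian_groupI)
      (auto simp: regular_module_def a_ac intro: bexI[of _ "\<ominus> _"] l_neg)
  then show ?thesis
    by (intro left_module.intro left_module_axioms.intro ring_axioms)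
      (auto simp: regular_module_def l_distr r_distr m_assoc)
qed

lemma (in left_module) left_module_power: "left_module R (power_module M I)"
proof -
  have "abelian_group (power_module M I)"
  proof (rule abelian_groupI)
    fix x assume "x \<in> carrier (power_module M I)"
    then show "\<exists>y\<in>carrier (power_module M I). y \<oplus>\<^bsub>power_module M I\<^esub> x = \<zero>\<^bsub>power_module M I\<^esub>"
      by (intro bexI[of _ "\<lambda>i\<in>I. \<ominus>\<^bsub>M\<^esub> x i"])
        (auto simp: power_module_def M.l_neg fun_eq_iff restrict_def PiE_def Pi_def extensional_def)
  qed (auto simp: power_module_def fun_eq_iff restrict_def PiE_def Pi_def extensional_def M.a_ac)
  then show ?thesis
    by (intro left_module.intro left_module_axioms.intro R.ring_axioms)
      (auto simp: power_module_def fun_eq_iff restrict_def PiE_def Pi_def extensional_def smult_l_distr smult_r_distr smult_assoc1)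
qed

lemma (in ring) ring_op: "ring (op_ring R)"
proof (rule ringI)
  show "abelian_group (op_ring R)" 
    by (rule abelian_groupI)
      (auto simp: op_ring_def a_ac intro: bexI[of _ "\<ominus> _"] l_neg)
  show "Group.monoid (op_ring R)"
   by (rule monoidI) (auto simp: op_ring_def m_assoc)
qed (auto simp: op_ring_def l_distr r_distr)

lemma comm_group_hom_group:
  assumes "left_module R M" "left_module R N"
  shows "comm_group (hom_group R M N)"
proof -
  interpret M: left_module R M by fact
  interpret N: left_module R N by fact
  show ?thesis
  proof (rule comm_groupI)
    fix x assume "x \<in> carrier (hom_group R M N)"
    then show "\<exists>y\<in>carrier (hom_group R M N). y \<otimes>\<^bsub>hom_group R M N\<^esub> x = \<one>\<^bsub>hom_group R M N\<^esub>"
      apply (intro bexI[of _ "\<lambda>u\<in>carrier M. (\<ominus>\<^bsub>R\<^esub> \<one>\<^bsub>R\<^esub>) \<odot>\<^bsub>N\<^esub> x u"])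
       apply (auto simp: hom_group_def mod_hom_def fun_eq_iff restrict_def PiE_def Pi_def extensional_def N.smult_l_minus N.l_neg N.minus_add N.smult_r_distr)
       apply (metis M.smult_closed N.smult_assoc1 N.smult_l_minus N.smult_one
          M.R.a_inv_closed M.R.l_minus M.R.l_one M.R.one_closed M.R.r_minus M.R.r_one)
      done
  qed (auto simp: hom_group_def mod_hom_def fun_eq_iff restrict_def PiE_def Pi_def extensional_def M.smult_r_distr N.smult_r_distr N.M.a_ac)
qed

lemma Ext_comm_group:
  assumes "left_module R M" "left_module R N" "\<exists>P. free_resolution R M P"
  shows "comm_group (Ext_group R i M N)"
proof -
  interpret M: left_module R M by fact
  interpret N: left_module R N by fact
  obtain n d e where P: "(SOME P. free_resolution R M P) = (n,d,e)" by (cases "SOME P. free_resolution R M P") auto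
  have res: "free_resolution R M (n,d,e)" unfolding P[symmetric] using assms(3) by (rule someI_ex)
  define F where "F i = fin_free R (n i)" for i
  have Fm: "left_module R (F i)" for i unfolding F_def fin_free_def
    by (intro left_module.left_module_power M.left_module_regular_module)
  let ?H = "hom_group R (F i) N"
  interpret H: comm_group ?H using Fm assms(2) by (rule comm_group_hom_group)
  have d: "d i \<in> mod_hom R (F (Suc i)) (F i)" for i using res by (auto simp: free_resolution_def F_def)
  then have dc: "d i x \<in> carrier (F i)" if "x \<in> carrier (F (Suc i))" for i x using that d[of i] unfolding mod_hom_def by (blast intro: PiE_mem)
  define Z where "Z = cocycles R n d N i"
  have Z_eq: "Z = {f \<in> mod_hom R (F i) N. \<forall>x\<in>carrier (F (Suc i)). f (d i x) = \<zero>\<^bsub>N\<^esub>}"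
    by (auto simp: Z_def cocycles_def F_def)
  have Hmem: "f y \<in> carrier N" if "f \<in> carrier ?H" "y \<in> carrier (F i)" for f y
    using that unfolding hom_group_def mod_hom_def by (auto intro: PiE_mem)
  have inv: "(inv\<^bsub>?H\<^esub> f) y = \<zero>\<^bsub>N\<^esub>" if "f \<in> carrier ?H" "y \<in> carrier (F i)" "f y = \<zero>\<^bsub>N\<^esub>" for f y
  proof -
    have "(f \<otimes>\<^bsub>?H\<^esub> inv\<^bsub>?H\<^esub> f) y = \<one>\<^bsub>?H\<^esub> y" using that by simp
    then have "f y \<oplus>\<^bsub>N\<^esub> (inv\<^bsub>?H\<^esub> f) y = \<zero>\<^bsub>N\<^esub>" using that(2) by (simp add: hom_group_def)
    then show ?thesis using that(3) Hmem[OF H.inv_closed[OF that(1)] that(2)] by simp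
  qed
  have subZ: "subgroup Z ?H"
  proof (rule H.subgroupI)
    show "Z \<subseteq> carrier ?H" by (auto simp: Z_eq hom_group_def)
    have "\<one>\<^bsub>?H\<^esub> \<in> Z" using dc H.one_closed by (simp add: Z_eq hom_group_def)
    then show "Z \<noteq> {}" by blast
  next
    fix a assume a: "a \<in> Z"
    then have ac: "a \<in> carrier ?H" by (auto simp: Z_eq hom_group_def)
    show "inv\<^bsub>?H\<^esub> a \<in> Z" using a inv[OF ac dc] H.inv_closed[OF ac] by (simp add: Z_eq hom_group_def)
  next
    fix a b assume a: "a \<in> Z" "b \<in> Z"
    then have "a \<in> carrier ?H" "b \<in> carrier ?H" by (auto simp: Z_eq hom_group_def)
    then have "a \<otimes>\<^bsub>?H\<^esub> b \<in> carrier ?H" by simp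
    then show "a \<otimes>\<^bsub>?H\<^esub> b \<in> Z" using a dc by (auto simp: Z_eq hom_group_def)
  qed
  let ?Z = "?H\<lparr>carrier := Z\<rparr>"
  interpret Z: comm_group ?Z by (rule H.sub_comm[OF subZ])
  define B where "B = coboundaries R n d N i"
  have "subgroup B ?Z"
  proof (cases i)
    case 0
    have "B = {\<one>\<^bsub>?Z\<^esub>}" by (auto simp: B_def coboundaries_def 0 F_def hom_group_def)
    then show ?thesis using Z.triv_subgroup by simp
  next
    case (Suc j)
    let ?c = "\<lambda>f. compose (carrier (F i)) f (d j)"
    have B: "B = ?c ` carrier (hom_group R (F j) N)"
      by (auto simp: B_def coboundaries_def Suc F_def hom_group_def)
    interpret Hj: comm_group "hom_group R (F j) N" using Fm assms(2) by (rule comm_group_hom_group)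
    have dd: "d j (d (Suc j) x) = \<zero>\<^bsub>F j\<^esub>" if "x \<in> carrier (F (Suc (Suc j)))" for x
      using res that unfolding free_resolution_def F_def by blast
    have z: "f \<zero>\<^bsub>F j\<^esub> = \<zero>\<^bsub>N\<^esub>" if "f \<in> mod_hom R (F j) N" for f
    proof -
      interpret Fj: left_module R "F j" by (rule Fm)
      have "f (\<zero>\<^bsub>R\<^esub> \<odot>\<^bsub>F j\<^esub> \<zero>\<^bsub>F j\<^esub>) = \<zero>\<^bsub>R\<^esub> \<odot>\<^bsub>N\<^esub> f \<zero>\<^bsub>F j\<^esub>"
        using that M.R.zero_closed Fj.M.zero_closed unfolding mod_hom_def by blast
      moreover have "f \<zero>\<^bsub>F j\<^esub> \<in> carrier N" using that by (auto simp: mod_hom_def)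
      ultimately show ?thesis by simp
    qed
    interpret Fi: left_module R "F i" by (rule Fm)
    have dS: "d j x \<in> carrier (F j)" if "x \<in> carrier (F i)" for x using dc[of x j] that Suc by simp
    have fN: "f y \<in> carrier N" if "f \<in> mod_hom R (F j) N" "y \<in> carrier (F j)" for f y
      using that unfolding mod_hom_def by (auto intro: PiE_mem)
    have cm: "?c f \<in> Z" if f: "f \<in> mod_hom R (F j) N" for f
      unfolding Z_eq mod_hom_def
    proof (intro CollectI conjI ballI)
      show "?c f \<in> carrier (F i) \<rightarrow>\<^sub>E carrier N" using fN[OF f dS] by (auto simp: compose_def)
    next
      fix x y assume xy: "x \<in> carrier (F i)" "y \<in> carrier (F i)"
      then have "d j (x \<oplus>\<^bsub>F i\<^esub> y) = d j x \<oplus>\<^bsub>F j\<^esub> d j y" using d[of j] unfolding mod_hom_def Suc by blast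
      moreover have "f (d j x \<oplus>\<^bsub>F j\<^esub> d j y) = f (d j x) \<oplus>\<^bsub>N\<^esub> f (d j y)"
        using f dS[OF xy(1)] dS[OF xy(2)] unfolding mod_hom_def by blast
      ultimately show "?c f (x \<oplus>\<^bsub>F i\<^esub> y) = ?c f x \<oplus>\<^bsub>N\<^esub> ?c f y" using xy by (simp add: compose_def)
    next
      fix a x assume xy: "a \<in> carrier R" "x \<in> carrier (F i)"
      then have "d j (a \<odot>\<^bsub>F i\<^esub> x) = a \<odot>\<^bsub>F j\<^esub> d j x" using d[of j] unfolding mod_hom_def Suc by blast
      moreover have "f (a \<odot>\<^bsub>F j\<^esub> d j x) = a \<odot>\<^bsub>N\<^esub> f (d j x)"
        using f xy(1) dS[OF xy(2)] unfolding mod_hom_def by blast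
      ultimately show "?c f (a \<odot>\<^bsub>F i\<^esub> x) = a \<odot>\<^bsub>N\<^esub> ?c f x" using xy by (simp add: compose_def)
    next
      fix x assume x: "x \<in> carrier (F (Suc i))"
      then show "?c f (d i x) = \<zero>\<^bsub>N\<^esub>" using dd[of x] z[OF f] dc[OF x] by (simp add: compose_def Suc)
    qed
    have "?c \<in> hom (hom_group R (F j) N) ?Z"
      using cm dS by (auto simp: hom_def hom_group_def compose_def fun_eq_iff)
    then interpret c: group_hom "hom_group R (F j) N" ?Z ?c by unfold_locales
    show ?thesis using c.img_is_subgroup B by simp
  qed
  then have "comm_group (?Z Mod B)" by (rule Z.abelian_FactGroup)
  then show ?thesis by (simp add: Ext_group_def P F_def Z_def B_def)
qed

text \<open>Baer's criterion: the restriction on the carriers of the test modules is immaterial.\<close>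

lemma baer_ideal:
  fixes R (structure)
  assumes inj: "injective_module R E" and I: "submodule I R (regular_module R)"
    and \<phi>: "\<phi> \<in> mod_hom R (regular_module R\<lparr>carrier := I\<rparr>) E"
  shows "\<exists>e\<in>carrier E. \<forall>r\<in>I. \<phi> r = r \<odot>\<^bsub>E\<^esub> e"
proof -
  interpret E: left_module R E using inj by (simp add: injective_module_def)
  let ?R = "regular_module R" and ?I = "regular_module R\<lparr>carrier := I\<rparr>"
  interpret RR: left_module R ?R by (rule E.R.left_module_regular_module)
  interpret I: submodule I R ?R by fact
  have sub: "I \<subseteq> carrier R" using I.subset by (simp add: regular_module_def)
  have lm: "left_module R ?I" by (rule RR.submodule_left_module[OF I])
  have "(\<lambda>x\<in>I. x) \<in> mod_hom R ?I ?R"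
    using sub I.m_closed I.smult_closed by (auto simp: mod_hom_def regular_module_def)
  moreover have "inj_on (\<lambda>x\<in>I. x) (carrier ?I)" by (auto simp: inj_on_def)
  ultimately obtain h where h: "h \<in> mod_hom R ?R E" "\<forall>x\<in>I. h x = \<phi> x"
    using inj lm RR.left_module_axioms \<phi> unfolding injective_module_def
    by (fastforce dest: spec[of _ ?I] spec[of _ ?R])
  have "\<phi> r = r \<odot>\<^bsub>E\<^esub> h \<one>" if "r \<in> I" for r
  proof -
    have "h (r \<otimes> \<one>) = r \<odot>\<^bsub>E\<^esub> h \<one>" using h(1) subsetD[OF sub that] by (simp add: mod_hom_def regular_module_def del: E.R.r_one)
    then show ?thesis using h(2) that sub by auto
  qed
  moreover have "h \<one> \<in> carrier E" using h(1) by (auto simp: mod_hom_def regular_module_def)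
  ultimately show ?thesis by blast
qed

lemma injective_module_lift:
  fixes R (structure) and E :: "('r, 'e, 'b) module_scheme"
    and A :: "('r, 'x, 'c) module_scheme" and B :: "('r, 'y, 'd) module_scheme"
  assumes inj: "injective_module R E" and A: "left_module R A" and B: "left_module R B"
    and f: "f \<in> mod_hom R A B" "inj_on f (carrier A)" and g: "g \<in> mod_hom R A E"
  shows "\<exists>h\<in>mod_hom R B E. \<forall>x\<in>carrier A. h (f x) = g x"
proof -
  interpret A: left_module R A by fact
  interpret B: left_module R B by fact
  interpret E: left_module R E using inj by (simp add: injective_module_def)
  have fc: "f x \<in> carrier B" and gc: "g x \<in> carrier E" if "x \<in> carrier A" for x
    using f(1) g that unfolding mod_hom_def by (blast intro: PiE_mem)+
  have fadd: "f (x \<oplus>\<^bsub>A\<^esub> y) = f x \<oplus>\<^bsub>B\<^esub> f y" and gadd: "g (x \<oplus>\<^bsub>A\<^esub> y) = g x \<oplus>\<^bsub>E\<^esub> g y"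
    if "x \<in> carrier A" "y \<in> carrier A" for x y
    using f(1) g that unfolding mod_hom_def by blast+
  have fsm: "f (a \<odot>\<^bsub>A\<^esub> x) = a \<odot>\<^bsub>B\<^esub> f x" and gsm: "g (a \<odot>\<^bsub>A\<^esub> x) = a \<odot>\<^bsub>E\<^esub> g x"
    if "a \<in> carrier R" "x \<in> carrier A" for a x
    using f(1) g that unfolding mod_hom_def by blast+
  define base where "base = (\<lambda>x. (f x, g x)) ` carrier A"
  define good where "good G \<longleftrightarrow> G \<subseteq> carrier B \<times> carrier E \<and> base \<subseteq> G \<and>
    (\<forall>x y x' y'. (x, y) \<in> G \<and> (x', y') \<in> G \<longrightarrow> (x \<oplus>\<^bsub>B\<^esub> x', y \<oplus>\<^bsub>E\<^esub> y') \<in> G) \<and>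
    (\<forall>a\<in>carrier R. \<forall>x y. (x, y) \<in> G \<longrightarrow> (a \<odot>\<^bsub>B\<^esub> x, a \<odot>\<^bsub>E\<^esub> y) \<in> G) \<and>
    (\<forall>x y y'. (x, y) \<in> G \<and> (x, y') \<in> G \<longrightarrow> y = y')" for G
  have goodD: "G \<subseteq> carrier B \<times> carrier E" "base \<subseteq> G"
    "\<And>x y x' y'. (x, y) \<in> G \<Longrightarrow> (x', y') \<in> G \<Longrightarrow> (x \<oplus>\<^bsub>B\<^esub> x', y \<oplus>\<^bsub>E\<^esub> y') \<in> G"
    "\<And>a x y. a \<in> carrier R \<Longrightarrow> (x, y) \<in> G \<Longrightarrow> (a \<odot>\<^bsub>B\<^esub> x, a \<odot>\<^bsub>E\<^esub> y) \<in> G"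
    "\<And>x y y'. (x, y) \<in> G \<Longrightarrow> (x, y') \<in> G \<Longrightarrow> y = y'"
    if "good G" for G
    using that unfolding good_def by simp_all
  have good_base: "good base"
    unfolding good_def base_def
    by (auto simp: fc gc fadd[symmetric] gadd[symmetric] fsm[symmetric] gsm[symmetric] dest: inj_onD[OF f(2)])
  have chain: "good (\<Union>C)" if C: "C \<in> chains {G. good G}" "C \<noteq> {}" for C
  proof -
    have G: "\<And>G. G \<in> C \<Longrightarrow> good G" using C(1) by (auto simp: chains_def)
    have two: "\<exists>G\<in>C. p \<in> G \<and> q \<in> G" if "p \<in> \<Union>C" "q \<in> \<Union>C" for p q
    proof -
      from that obtain G1 G2 where "G1 \<in> C" "p \<in> G1" "G2 \<in> C" "q \<in> G2" by blast
      moreover from this have "G1 \<subseteq> G2 \<or> G2 \<subseteq> G1" using chainsD[OF C(1)] by blast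
      ultimately show ?thesis by blast
    qed
    show ?thesis
      unfolding good_def
    proof (intro conjI allI impI ballI)
      show "\<Union>C \<subseteq> carrier B \<times> carrier E" by (rule Union_least) (rule goodD(1)[OF G])
      obtain G0 where "G0 \<in> C" using C(2) by blast
      then show "base \<subseteq> \<Union>C" using goodD(2)[OF G, of G0] by blast
      fix x y x' y' assume "(x, y) \<in> \<Union>C \<and> (x', y') \<in> \<Union>C"
      then obtain G1 where "G1 \<in> C" "(x,y) \<in> G1" "(x',y') \<in> G1" using two by blast
      then show "(x \<oplus>\<^bsub>B\<^esub> x', y \<oplus>\<^bsub>E\<^esub> y') \<in> \<Union>C" by (intro UnionI goodD(3)[OF G])
    next
      fix a x y assume "a \<in> carrier R" "(x, y) \<in> \<Union>C"
      then show "(a \<odot>\<^bsub>B\<^esub> x, a \<odot>\<^bsub>E\<^esub> y) \<in> \<Union>C" by (elim UnionE) (intro UnionI goodD(4)[OF G])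
    next
      fix x y y' assume "(x, y) \<in> \<Union>C \<and> (x, y') \<in> \<Union>C"
      then obtain G1 where "G1 \<in> C" "(x,y) \<in> G1" "(x,y') \<in> G1" using two by blast
      then show "y = y'" by (intro goodD(5)[OF G])
    qed
  qed
  have "\<forall>C\<in>chains {G. good G}. \<exists>U\<in>{G. good G}. \<forall>X\<in>C. X \<subseteq> U"
  proof
    fix C assume "C \<in> chains {G. good G}"
    then show "\<exists>U\<in>{G. good G}. \<forall>X\<in>C. X \<subseteq> U"
      using chain[of C] good_base by (cases "C = {}") blast+
  qed
  from Zorn_Lemma2[OF this] obtain G where G: "good G" and max: "\<And>G'. good G' \<Longrightarrow> G \<subseteq> G' \<Longrightarrow> G' = G"
    by blast
  have Gc: "x \<in> carrier B" "y \<in> carrier E" if "(x,y) \<in> G" for x y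
    using goodD(1)[OF G] that by auto
  have Gadd: "(x \<oplus>\<^bsub>B\<^esub> x', y \<oplus>\<^bsub>E\<^esub> y') \<in> G" if "(x,y) \<in> G" "(x',y') \<in> G" for x y x' y'
    using goodD(3)[OF G that] .
  have Gsm: "(a \<odot>\<^bsub>B\<^esub> x, a \<odot>\<^bsub>E\<^esub> y) \<in> G" if "a \<in> carrier R" "(x,y) \<in> G" for a x y
    using goodD(4)[OF G that] .
  have Gsv: "y = y'" if "(x,y) \<in> G" "(x,y') \<in> G" for x y y'
    using goodD(5)[OF G that] .
  have Gbase: "(f x, g x) \<in> G" if "x \<in> carrier A" for x
    using goodD(2)[OF G] that by (auto simp: base_def)
  have G0: "(\<zero>\<^bsub>B\<^esub>, \<zero>\<^bsub>E\<^esub>) \<in> G"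
    using Gsm[OF A.R.zero_closed Gbase[OF A.M.zero_closed]] fc gc by simp
  have Gmin: "(x' \<ominus>\<^bsub>B\<^esub> x, y' \<ominus>\<^bsub>E\<^esub> y) \<in> G" if "(x,y) \<in> G" "(x',y') \<in> G" for x y x' y'
    using Gadd[OF that(2) Gsm[OF A.R.a_inv_closed[OF A.R.one_closed] that(1)]] Gc[OF that(1)] Gc[OF that(2)]
    by (simp add: B.smult_l_minus E.smult_l_minus a_minus_def)
  have total: "\<exists>y. (b, y) \<in> G" if b: "b \<in> carrier B" for b
  proof -
    define I where "I = {r \<in> carrier R. \<exists>y. (r \<odot>\<^bsub>B\<^esub> b, y) \<in> G}"
    define \<phi> where "\<phi> = (\<lambda>r\<in>I. THE y. (r \<odot>\<^bsub>B\<^esub> b, y) \<in> G)"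
    have \<phi>: "(r \<odot>\<^bsub>B\<^esub> b, \<phi> r) \<in> G" if "r \<in> I" for r
      using that Gsv theI'[of "\<lambda>y. (r \<odot>\<^bsub>B\<^esub> b, y) \<in> G"] unfolding I_def \<phi>_def by auto
    have \<phi>_eq: "\<phi> r = y" if "r \<in> carrier R" "(r \<odot>\<^bsub>B\<^esub> b, y) \<in> G" for r y
      using that \<phi>[of r] Gsv by (auto simp: I_def)
    interpret RR: left_module R "regular_module R" by (rule A.R.left_module_regular_module)
    have Iadd: "(( r \<oplus> s) \<odot>\<^bsub>B\<^esub> b, \<phi> r \<oplus>\<^bsub>E\<^esub> \<phi> s) \<in> G" if "r \<in> I" "s \<in> I" for r s
      using Gadd[OF \<phi>[OF that(1)] \<phi>[OF that(2)]] that b by (simp add: I_def B.smult_l_distr)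
    have Ism: "(( a \<otimes> r) \<odot>\<^bsub>B\<^esub> b, a \<odot>\<^bsub>E\<^esub> \<phi> r) \<in> G" if "a \<in> carrier R" "r \<in> I" for a r
      using Gsm[OF that(1) \<phi>[OF that(2)]] that b by (simp add: I_def B.smult_assoc1)
    have I: "submodule I R (regular_module R)"
    proof (rule RR.subset_submodule)
      show "I \<subseteq> carrier (regular_module R)" by (auto simp: I_def regular_module_def)
      show "\<zero>\<^bsub>regular_module R\<^esub> \<in> I" using G0 b by (auto simp: I_def regular_module_def)
    next
      fix x y assume "x \<in> I" "y \<in> I"
      then show "x \<oplus>\<^bsub>regular_module R\<^esub> y \<in> I" using Iadd by (auto simp: I_def regular_module_def)
    next
      fix a x assume "a \<in> carrier R" "x \<in> I"
      then show "a \<odot>\<^bsub>regular_module R\<^esub> x \<in> I" using Ism by (auto simp: I_def regular_module_def)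
    qed
    have "\<phi> \<in> mod_hom R (regular_module R\<lparr>carrier := I\<rparr>) E"
      unfolding mod_hom_def
    proof (intro CollectI conjI ballI)
      show "\<phi> \<in> carrier (regular_module R\<lparr>carrier := I\<rparr>) \<rightarrow>\<^sub>E carrier E"
        using Gc(2)[OF \<phi>] by (auto simp: \<phi>_def)
    qed (use \<phi>_eq[OF _ Iadd] \<phi>_eq[OF _ Ism] in \<open>auto simp: regular_module_def I_def\<close>)
    from baer_ideal[OF inj I this] obtain e where e: "e \<in> carrier E" "\<And>r. r \<in> I \<Longrightarrow> \<phi> r = r \<odot>\<^bsub>E\<^esub> e"
      by blast
    have key: "y = r \<odot>\<^bsub>E\<^esub> e" if "r \<in> carrier R" "(r \<odot>\<^bsub>B\<^esub> b, y) \<in> G" for r y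
      using e(2)[of r] \<phi>_eq[OF that] that by (auto simp: I_def)
    define G' where "G' = {(x \<oplus>\<^bsub>B\<^esub> r \<odot>\<^bsub>B\<^esub> b, y \<oplus>\<^bsub>E\<^esub> r \<odot>\<^bsub>E\<^esub> e) | x y r. (x,y) \<in> G \<and> r \<in> carrier R}"
    have G'I: "(u, v) \<in> G'" if "(x,y) \<in> G" "r \<in> carrier R" "u = x \<oplus>\<^bsub>B\<^esub> r \<odot>\<^bsub>B\<^esub> b" "v = y \<oplus>\<^bsub>E\<^esub> r \<odot>\<^bsub>E\<^esub> e" for x y r u v
      using that unfolding G'_def by blast
    have GG': "G \<subseteq> G'"
    proof clarify
      fix x y assume "(x,y) \<in> G"
      then show "(x,y) \<in> G'" by (rule G'I[OF _ A.R.zero_closed]) (use \<open>(x,y) \<in> G\<close> Gc b e(1) in auto)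
    qed
    have "good G'"
      unfolding good_def
    proof (intro conjI allI impI ballI)
      show "G' \<subseteq> carrier B \<times> carrier E" using Gc b e(1) by (auto simp: G'_def)
      show "base \<subseteq> G'" using GG' Gbase by (auto simp: base_def)
      fix x y x' y' assume "(x, y) \<in> G' \<and> (x', y') \<in> G'"
      then obtain u v r u' v' r' where *: "(u,v) \<in> G" "(u',v') \<in> G" "r \<in> carrier R" "r' \<in> carrier R"
        "x = u \<oplus>\<^bsub>B\<^esub> r \<odot>\<^bsub>B\<^esub> b" "y = v \<oplus>\<^bsub>E\<^esub> r \<odot>\<^bsub>E\<^esub> e" "x' = u' \<oplus>\<^bsub>B\<^esub> r' \<odot>\<^bsub>B\<^esub> b" "y' = v' \<oplus>\<^bsub>E\<^esub> r' \<odot>\<^bsub>E\<^esub> e"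
        by (auto simp: G'_def)
      show "(x \<oplus>\<^bsub>B\<^esub> x', y \<oplus>\<^bsub>E\<^esub> y') \<in> G'"
        by (rule G'I[OF Gadd[OF *(1,2)] A.R.a_closed[OF *(3,4)]])
          (use * Gc[OF *(1)] Gc[OF *(2)] b e(1) in \<open>simp_all add: B.smult_l_distr E.smult_l_distr B.M.a_ac E.M.a_ac\<close>)
    next
      fix a x y assume a: "a \<in> carrier R" and "(x, y) \<in> G'"
      then obtain u v r where *: "(u,v) \<in> G" "r \<in> carrier R"
        "x = u \<oplus>\<^bsub>B\<^esub> r \<odot>\<^bsub>B\<^esub> b" "y = v \<oplus>\<^bsub>E\<^esub> r \<odot>\<^bsub>E\<^esub> e"
        by (auto simp: G'_def)
      show "(a \<odot>\<^bsub>B\<^esub> x, a \<odot>\<^bsub>E\<^esub> y) \<in> G'"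
        by (rule G'I[OF Gsm[OF a *(1)] A.R.m_closed[OF a *(2)]])
          (use * a Gc[OF *(1)] b e(1) in \<open>simp_all add: B.smult_r_distr E.smult_r_distr B.smult_assoc1 E.smult_assoc1\<close>)
    next
      fix x y y' assume "(x, y) \<in> G' \<and> (x, y') \<in> G'"
      then obtain u v r u' v' r' where *: "(u,v) \<in> G" "(u',v') \<in> G" "r \<in> carrier R" "r' \<in> carrier R"
        "x = u \<oplus>\<^bsub>B\<^esub> r \<odot>\<^bsub>B\<^esub> b" "y = v \<oplus>\<^bsub>E\<^esub> r \<odot>\<^bsub>E\<^esub> e" "x = u' \<oplus>\<^bsub>B\<^esub> r' \<odot>\<^bsub>B\<^esub> b" "y' = v' \<oplus>\<^bsub>E\<^esub> r' \<odot>\<^bsub>E\<^esub> e"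
        by (auto simp: G'_def)
      note c = Gc[OF *(1)] Gc[OF *(2)] B.smult_closed[OF *(3) b] B.smult_closed[OF *(4) b]
        E.smult_closed[OF *(3) e(1)] E.smult_closed[OF *(4) e(1)]
      have "u' \<ominus>\<^bsub>B\<^esub> u = r \<odot>\<^bsub>B\<^esub> b \<ominus>\<^bsub>B\<^esub> r' \<odot>\<^bsub>B\<^esub> b"
      proof -
        have "u \<oplus>\<^bsub>B\<^esub> r \<odot>\<^bsub>B\<^esub> b = u' \<oplus>\<^bsub>B\<^esub> r' \<odot>\<^bsub>B\<^esub> b" using * by simp
        then have "(u \<oplus>\<^bsub>B\<^esub> r \<odot>\<^bsub>B\<^esub> b) \<oplus>\<^bsub>B\<^esub> (\<ominus>\<^bsub>B\<^esub> u \<oplus>\<^bsub>B\<^esub> \<ominus>\<^bsub>B\<^esub> (r' \<odot>\<^bsub>B\<^esub> b)) =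
            (u' \<oplus>\<^bsub>B\<^esub> r' \<odot>\<^bsub>B\<^esub> b) \<oplus>\<^bsub>B\<^esub> (\<ominus>\<^bsub>B\<^esub> u \<oplus>\<^bsub>B\<^esub> \<ominus>\<^bsub>B\<^esub> (r' \<odot>\<^bsub>B\<^esub> b))" by simp
        then show ?thesis using c by (simp add: a_minus_def B.M.a_ac B.M.r_neg1 B.M.r_neg2 B.M.r_neg)
      qed
      also have "\<dots> = (r \<ominus> r') \<odot>\<^bsub>B\<^esub> b"
        using *(3,4) b by (simp add: a_minus_def B.smult_l_distr B.smult_l_minus)
      finally have "((r \<ominus> r') \<odot>\<^bsub>B\<^esub> b, v' \<ominus>\<^bsub>E\<^esub> v) \<in> G" using Gmin[OF *(1,2)] by simp
      then have "v' \<ominus>\<^bsub>E\<^esub> v = (r \<ominus> r') \<odot>\<^bsub>E\<^esub> e" using key *(3,4) by simp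
      also have "\<dots> = r \<odot>\<^bsub>E\<^esub> e \<ominus>\<^bsub>E\<^esub> r' \<odot>\<^bsub>E\<^esub> e"
        using *(3,4) e(1) by (simp add: a_minus_def E.smult_l_distr E.smult_l_minus)
      finally have "(v' \<ominus>\<^bsub>E\<^esub> v) \<oplus>\<^bsub>E\<^esub> (v \<oplus>\<^bsub>E\<^esub> r' \<odot>\<^bsub>E\<^esub> e) = (r \<odot>\<^bsub>E\<^esub> e \<ominus>\<^bsub>E\<^esub> r' \<odot>\<^bsub>E\<^esub> e) \<oplus>\<^bsub>E\<^esub> (v \<oplus>\<^bsub>E\<^esub> r' \<odot>\<^bsub>E\<^esub> e)"
        by simp
      then have "v' \<oplus>\<^bsub>E\<^esub> r' \<odot>\<^bsub>E\<^esub> e = v \<oplus>\<^bsub>E\<^esub> r \<odot>\<^bsub>E\<^esub> e"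
        using c by (simp add: a_minus_def E.M.a_ac E.M.r_neg1 E.M.r_neg2 E.M.r_neg)
      then show "y = y'" using * by simp
    qed
    then have "G' = G" using max GG' by blast
    moreover have "(b, e) \<in> G'" by (rule G'I[OF G0 A.R.one_closed]) (use b e(1) in auto)
    ultimately show ?thesis by blast
  qed
  define h where "h = (\<lambda>b\<in>carrier B. THE y. (b, y) \<in> G)"
  have h: "(b, h b) \<in> G" if "b \<in> carrier B" for b
    using total[OF that] Gsv theI'[of "\<lambda>y. (b, y) \<in> G"] that unfolding h_def by auto
  have h_eq: "h b = y" if "(b, y) \<in> G" for b y
    using h[OF Gc(1)[OF that]] Gsv that by blast
  have "h \<in> mod_hom R B E"
    unfolding mod_hom_def
  proof (intro CollectI conjI ballI)
    show "h \<in> carrier B \<rightarrow>\<^sub>E carrier E" using Gc(2)[OF h] by (auto simp: h_def)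
  qed (auto intro!: h_eq Gadd Gsm h)
  moreover have "\<forall>x\<in>carrier A. h (f x) = g x" using Gbase h_eq by blast
  ultimately show ?thesis by blast
qed

end

theory Submission
  imports Defs
begin

text \<open>
  Let \<open>U\<^sub>\<Gamma>\<close> be QF-3, with injective envelope \<open>E\<close>. Call \<open>\<gamma> \<in> \<Gamma>\<close> extending if for every left ideal \<open>L\<close> of
  \<open>\<Lambda>\<close> and every homomorphism \<open>\<phi> : L \<rightarrow> U\<close> the map \<open>l \<mapsto> \<phi>(l) \<gamma>\<close> extends to \<open>\<Lambda>\<close>. The extending elements
  form a two-sided ideal \<open>I\<close>. From the injectivity of \<open>E\<close>, the embedding of \<open>E\<close> in a product of copies of
  \<open>U\<close>, the balance condition and the descending chain condition, \<open>u I \<noteq> 0\<close> for every nonzero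
  \<open>u \<in> U\<close>. Hence there are idempotents \<open>e \<in> I\<close> with \<open>u \<Gamma> e \<noteq> 0\<close>. For such \<open>e\<close> the \<open>\<Lambda>\<close>-module \<open>U e\<close> is
  injective by Baer's criterion, and \<open>U\<close> embeds in a finite product of such modules. That product
  contains an injective envelope of \<open>U\<close> and is itself contained in a power of \<open>U\<close>. The other
  implication follows by exchanging the two sides.
\<close>

section \<open>Homomorphisms and submodules\<close>

text \<open>The hypothesis gives injectivity over one ring and the conclusion asks for it over the
  other. The balance condition is what passes between them: a homomorphism from \<open>U\<close> to
  \<open>E\<close> followed by one from \<open>E\<close> back to \<open>U\<close> is an endomorphism
  over the first ring, hence multiplication by a scalar of the second. Extensions provided by
  injectivity of \<open>E\<close> thus turn into ring elements. An extending element \<gamma> only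
  says that \<gamma> times \<phi> extends, not that \<phi> does. This is why idempotents are sought:
  if \<open>e\<close> is an idempotent of the ideal and \<phi> takes values in the summand cut out
  by \<open>e\<close>, then \<open>e\<close> times \<phi> is \<phi> itself. The ideal is defined by
  infinitely many conditions, and each of them by infinitely many equations. The chain condition is
  used each time to keep only finitely many, which can then be handled by induction.\<close>

lemma mod_hom_closed: "f \<in> mod_hom R M N \<Longrightarrow> x \<in> carrier M \<Longrightarrow> f x \<in> carrier N"
  unfolding mod_hom_def by (blast intro: PiE_mem)

lemma mod_hom_add:
  "f \<in> mod_hom R M N \<Longrightarrow> x \<in> carrier M \<Longrightarrow> y \<in> carrier M \<Longrightarrow> f (x \<oplus>\<^bsub>M\<^esub> y) = f x \<oplus>\<^bsub>N\<^esub> f y"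
  unfolding mod_hom_def by blast

lemma mod_hom_smult:
  "f \<in> mod_hom R M N \<Longrightarrow> a \<in> carrier R \<Longrightarrow> x \<in> carrier M \<Longrightarrow> f (a \<odot>\<^bsub>M\<^esub> x) = a \<odot>\<^bsub>N\<^esub> f x"
  unfolding mod_hom_def by blast

lemma (in left_module) mod_hom_restrictI:
  assumes "\<And>x. x \<in> carrier M \<Longrightarrow> f x \<in> carrier N"
    and "\<And>x y. x \<in> carrier M \<Longrightarrow> y \<in> carrier M \<Longrightarrow> f (x \<oplus>\<^bsub>M\<^esub> y) = f x \<oplus>\<^bsub>N\<^esub> f y"
    and "\<And>a x. a \<in> carrier R \<Longrightarrow> x \<in> carrier M \<Longrightarrow> f (a \<odot>\<^bsub>M\<^esub> x) = a \<odot>\<^bsub>N\<^esub> f x"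
  shows "restrict f (carrier M) \<in> mod_hom R M N"
  using assms by (auto simp: mod_hom_def)

lemma mod_hom_zero:
  assumes "left_module R M" "left_module R N" "f \<in> mod_hom R M N"
  shows "f \<zero>\<^bsub>M\<^esub> = \<zero>\<^bsub>N\<^esub>"
proof -
  interpret M: left_module R M by fact
  interpret N: left_module R N by fact
  show ?thesis
    using mod_hom_smult[OF assms(3), of "\<zero>\<^bsub>R\<^esub>" "\<zero>\<^bsub>M\<^esub>"] mod_hom_closed[OF assms(3), of "\<zero>\<^bsub>M\<^esub>"] by simp
qed

lemma mod_hom_minus:
  assumes "left_module R M" "left_module R N" "f \<in> mod_hom R M N" "x \<in> carrier M" "y \<in> carrier M"
  shows "f (x \<ominus>\<^bsub>M\<^esub> y) = f x \<ominus>\<^bsub>N\<^esub> f y"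
proof -
  interpret M: left_module R M by fact
  interpret N: left_module R N by fact
  have "f ((\<ominus>\<^bsub>R\<^esub> \<one>\<^bsub>R\<^esub>) \<odot>\<^bsub>M\<^esub> y) = (\<ominus>\<^bsub>R\<^esub> \<one>\<^bsub>R\<^esub>) \<odot>\<^bsub>N\<^esub> f y" using assms by (intro mod_hom_smult) auto
  then have "f (\<ominus>\<^bsub>M\<^esub> y) = \<ominus>\<^bsub>N\<^esub> f y"
    using assms(5) mod_hom_closed[OF assms(3,5)] by (simp add: M.smult_l_minus N.smult_l_minus)
  then show ?thesis using assms by (simp add: a_minus_def mod_hom_add)
qed

lemma mod_hom_compose:
  assumes "f \<in> mod_hom R M N" "g \<in> mod_hom R N P" "left_module R M"
  shows "compose (carrier M) g f \<in> mod_hom R M P"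
proof -
  interpret left_module R M by fact
  show ?thesis unfolding compose_def
    by (rule mod_hom_restrictI) (use assms in \<open>auto simp: mod_hom_closed mod_hom_add mod_hom_smult\<close>)
qed

context left_module begin

lemma submodule_closed:
  assumes "submodule N R M"
  shows "N \<subseteq> carrier M" "\<zero>\<^bsub>M\<^esub> \<in> N" "\<And>x y. x \<in> N \<Longrightarrow> y \<in> N \<Longrightarrow> x \<oplus>\<^bsub>M\<^esub> y \<in> N"
    "\<And>a x. a \<in> carrier R \<Longrightarrow> x \<in> N \<Longrightarrow> a \<odot>\<^bsub>M\<^esub> x \<in> N"
    "\<And>x y. x \<in> N \<Longrightarrow> y \<in> N \<Longrightarrow> x \<ominus>\<^bsub>M\<^esub> y \<in> N"
proof -
  interpret N: submodule N R M by fact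
  show 1: "N \<subseteq> carrier M" "\<zero>\<^bsub>M\<^esub> \<in> N" "\<And>x y. x \<in> N \<Longrightarrow> y \<in> N \<Longrightarrow> x \<oplus>\<^bsub>M\<^esub> y \<in> N"
    "\<And>a x. a \<in> carrier R \<Longrightarrow> x \<in> N \<Longrightarrow> a \<odot>\<^bsub>M\<^esub> x \<in> N"
    using N.subset N.one_closed N.m_closed by auto
  show "x \<ominus>\<^bsub>M\<^esub> y \<in> N" if "x \<in> N" "y \<in> N" for x y
    using that 1 smult_l_minus[of \<one> y] 1(4)[of "\<ominus> \<one>" y] by (auto simp: a_minus_def subset_iff)
qed

lemma submodule_carrier: "submodule (carrier M) R M"
  by (rule subset_submodule) auto

lemma submodule_zero: "submodule {\<zero>\<^bsub>M\<^esub>} R M"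
  by (rule subset_submodule) auto

lemma submodule_Inter:
  assumes "\<And>i. i \<in> I \<Longrightarrow> submodule (A i) R M"
  shows "submodule {x \<in> carrier M. \<forall>i\<in>I. x \<in> A i} R M"
  by (rule subset_submodule) (use submodule_closed[OF assms] in auto)

lemma submodule_vimage:
  assumes "left_module R N" "f \<in> mod_hom R M N" "submodule B R N"
  shows "submodule {x \<in> carrier M. f x \<in> B} R M"
proof -
  interpret N: left_module R N by fact
  show ?thesis
    by (rule subset_submodule)
      (use assms N.submodule_closed[OF assms(3)] in
        \<open>auto simp: mod_hom_add mod_hom_smult mod_hom_zero[OF left_module_axioms assms(1,2)]\<close>)
qed

lemma submodule_image:
  assumes "left_module R N" "f \<in> mod_hom R M N" "submodule A R M"
  shows "submodule (f ` A) R N"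
proof -
  interpret N: left_module R N by fact
  note A = submodule_closed[OF assms(3)]
  show ?thesis
  proof (rule N.subset_submodule)
    show "f ` A \<subseteq> carrier N" using A(1) mod_hom_closed[OF assms(2)] by auto
    show "\<zero>\<^bsub>N\<^esub> \<in> f ` A" using A(2) mod_hom_zero[OF left_module_axioms assms(1,2)] by (metis imageI)
    fix x y assume "x \<in> f ` A" "y \<in> f ` A"
    then obtain x' y' where "x = f x'" "y = f y'" "x' \<in> A" "y' \<in> A" by blast
    then show "x \<oplus>\<^bsub>N\<^esub> y \<in> f ` A"
      using A(1,3) mod_hom_add[OF assms(2), of x' y'] by (metis imageI subsetD)
  next
    fix a x assume "a \<in> carrier R" "x \<in> f ` A"
    then obtain x' where "x = f x'" "x' \<in> A" by blast
    then show "a \<odot>\<^bsub>N\<^esub> x \<in> f ` A"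
      using A(1) A(4)[OF \<open>a \<in> carrier R\<close>, of x'] mod_hom_smult[OF assms(2) \<open>a \<in> carrier R\<close>, of x'] by (metis imageI subsetD)
  qed
qed

text \<open>The one-generator enlargement against which Zorn-maximal submodules are tested: graphs
  of partial extensions, and complements.\<close>

lemma submodule_adjoin:
  assumes "submodule N R M" "b \<in> carrier M"
  shows "submodule {x \<oplus>\<^bsub>M\<^esub> r \<odot>\<^bsub>M\<^esub> b | x r. x \<in> N \<and> r \<in> carrier R} R M" (is "submodule ?N R M")
    and "N \<subseteq> {x \<oplus>\<^bsub>M\<^esub> r \<odot>\<^bsub>M\<^esub> b | x r. x \<in> N \<and> r \<in> carrier R}"
    and "b \<in> {x \<oplus>\<^bsub>M\<^esub> r \<odot>\<^bsub>M\<^esub> b | x r. x \<in> N \<and> r \<in> carrier R}"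
proof -
  note N = submodule_closed[OF assms(1)]
  have I: "z \<in> ?N" if "x \<in> N" "r \<in> carrier R" "z = x \<oplus>\<^bsub>M\<^esub> r \<odot>\<^bsub>M\<^esub> b" for x r z using that by blast
  show "N \<subseteq> ?N"
  proof
    fix x assume "x \<in> N" then show "x \<in> ?N" by (rule I[OF _ R.zero_closed]) (use N(1) \<open>x \<in> N\<close> assms(2) in auto)
  qed
  show "b \<in> ?N" by (rule I[OF N(2) R.one_closed]) (use assms(2) in auto)
  show "submodule ?N R M"
  proof (rule subset_submodule)
    show "?N \<subseteq> carrier M" using N(1) assms(2) by auto
    show "\<zero>\<^bsub>M\<^esub> \<in> ?N" using \<open>N \<subseteq> ?N\<close> N(2) by blast
    fix x y assume "x \<in> ?N" "y \<in> ?N"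
    then obtain x' r y' s where *: "x' \<in> N" "r \<in> carrier R" "x = x' \<oplus>\<^bsub>M\<^esub> r \<odot>\<^bsub>M\<^esub> b"
      "y' \<in> N" "s \<in> carrier R" "y = y' \<oplus>\<^bsub>M\<^esub> s \<odot>\<^bsub>M\<^esub> b" by blast
    have c: "x' \<in> carrier M" "y' \<in> carrier M" using * N(1) by auto
    show "x \<oplus>\<^bsub>M\<^esub> y \<in> ?N"
      by (rule I[OF N(3)[OF *(1,4)] R.a_closed[OF *(2,5)]]) (use * c assms(2) in \<open>simp add: smult_l_distr M.a_ac\<close>)
  next
    fix a x assume a: "a \<in> carrier R" and "x \<in> ?N"
    then obtain x' r where *: "x' \<in> N" "r \<in> carrier R" "x = x' \<oplus>\<^bsub>M\<^esub> r \<odot>\<^bsub>M\<^esub> b" by blast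
    have c: "x' \<in> carrier M" using * N(1) by auto
    show "a \<odot>\<^bsub>M\<^esub> x \<in> ?N"
      by (rule I[OF N(4)[OF a *(1)] R.m_closed[OF a *(2)]]) (use * c a assms(2) in \<open>simp add: smult_r_distr smult_assoc1\<close>)
  qed
qed

text \<open>A condition imposed on each element separately survives unions of chains, so Zorn's
  lemma applies. Single-valuedness of a graph, essentiality over a submodule and trivial
  intersection with a submodule can all be put in this form.\<close>

lemma submodule_maximal:
  assumes "submodule N0 R M" "\<forall>x\<in>N0. Q x"
  shows "\<exists>N. submodule N R M \<and> N0 \<subseteq> N \<and> (\<forall>x\<in>N. Q x) \<and>
    (\<forall>N'. submodule N' R M \<and> N \<subseteq> N' \<and> (\<forall>x\<in>N'. Q x) \<longrightarrow> N' = N)"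
proof -
  define good where "good N \<longleftrightarrow> submodule N R M \<and> N0 \<subseteq> N \<and> (\<forall>x\<in>N. Q x)" for N
  have chain: "good (\<Union>C)" if C: "C \<in> chains {N. good N}" "C \<noteq> {}" for C
  proof -
    have G: "submodule N R M" "N0 \<subseteq> N" "\<forall>x\<in>N. Q x" if "N \<in> C" for N
      using C(1) that by (auto simp: chains_def good_def)
    obtain N1 where N1: "N1 \<in> C" using C(2) by blast
    have "submodule (\<Union>C) R M"
    proof (rule subset_submodule)
      show "\<Union>C \<subseteq> carrier M" using submodule_closed(1)[OF G(1)] by blast
      show "\<zero>\<^bsub>M\<^esub> \<in> \<Union>C" using submodule_closed(2)[OF G(1)[OF N1]] N1 by blast
      fix x y assume "x \<in> \<Union>C" "y \<in> \<Union>C"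
      then obtain A B where "A \<in> C" "x \<in> A" "B \<in> C" "y \<in> B" by blast
      moreover from this have "A \<subseteq> B \<or> B \<subseteq> A" using chainsD[OF C(1)] by blast
      ultimately obtain D where "D \<in> C" "x \<in> D" "y \<in> D" by blast
      then show "x \<oplus>\<^bsub>M\<^esub> y \<in> \<Union>C" using submodule_closed(3)[OF G(1)] by blast
    next
      fix a x assume "a \<in> carrier R" "x \<in> \<Union>C"
      then show "a \<odot>\<^bsub>M\<^esub> x \<in> \<Union>C" using submodule_closed(4)[OF G(1)] by blast
    qed
    then show ?thesis unfolding good_def using G(2)[OF N1] N1 G(3) by blast
  qed
  have "good N0" using assms by (simp add: good_def)
  have "\<forall>C\<in>chains {N. good N}. \<exists>U\<in>{N. good N}. \<forall>X\<in>C. X \<subseteq> U"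
  proof
    fix C assume "C \<in> chains {N. good N}"
    then show "\<exists>U\<in>{N. good N}. \<forall>X\<in>C. X \<subseteq> U"
      using chain[of C] \<open>good N0\<close> by (cases "C = {}") blast+
  qed
  from Zorn_Lemma2[OF this] obtain N where N: "good N" "\<And>N'. good N' \<Longrightarrow> N \<subseteq> N' \<Longrightarrow> N' = N"
    by blast
  then show ?thesis unfolding good_def by (intro exI[of _ N]) blast
qed

end

lemma (in left_module) smult_r_minus:
  assumes "a \<in> carrier R" "x \<in> carrier M" "y \<in> carrier M"
  shows "a \<odot>\<^bsub>M\<^esub> (x \<ominus>\<^bsub>M\<^esub> y) = a \<odot>\<^bsub>M\<^esub> x \<ominus>\<^bsub>M\<^esub> a \<odot>\<^bsub>M\<^esub> y"
proof -
  have "a \<odot>\<^bsub>M\<^esub> (\<ominus>\<^bsub>M\<^esub> y) \<oplus>\<^bsub>M\<^esub> a \<odot>\<^bsub>M\<^esub> y = \<zero>\<^bsub>M\<^esub>"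
    using smult_r_distr[OF assms(1), of "\<ominus>\<^bsub>M\<^esub> y" y] assms by (simp add: M.l_neg)
  then have "a \<odot>\<^bsub>M\<^esub> (\<ominus>\<^bsub>M\<^esub> y) = \<ominus>\<^bsub>M\<^esub> (a \<odot>\<^bsub>M\<^esub> y)"
    using assms by (metis M.a_inv_closed M.minus_equality M.minus_minus smult_closed)
  then show ?thesis using assms by (simp add: a_minus_def smult_r_distr)
qed

lemma (in abelian_group) minus_zero_iff [simp]:
  assumes "x \<in> carrier G" "y \<in> carrier G"
  shows "x \<ominus> y = \<zero> \<longleftrightarrow> x = y"
  using assms minus_equality[of x "\<ominus> y"] by (auto simp: a_minus_def r_neg)

lemma (in abelian_group) add_minus_add:
  assumes "x \<in> carrier G" "y \<in> carrier G" "x' \<in> carrier G" "y' \<in> carrier G"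
  shows "(x \<oplus> x') \<ominus> (y \<oplus> y') = (x \<ominus> y) \<oplus> (x' \<ominus> y')"
  using assms by (simp add: a_minus_def minus_add a_ac)

lemma mod_hom_diff:
  assumes M: "left_module R M" and N: "left_module R N" and f: "f \<in> mod_hom R M N" and g: "g \<in> mod_hom R M N"
  shows "(\<lambda>x\<in>carrier M. f x \<ominus>\<^bsub>N\<^esub> g x) \<in> mod_hom R M N"
proof -
  interpret M: left_module R M by fact
  interpret N: left_module R N by fact
  show ?thesis
    by (rule M.mod_hom_restrictI)
      (use mod_hom_closed[OF f] mod_hom_closed[OF g] in
        \<open>simp_all add: mod_hom_add[OF f] mod_hom_add[OF g] mod_hom_smult[OF f] mod_hom_smult[OF g]
          N.M.add_minus_add N.smult_r_minus\<close>)
qed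

text \<open>Unlike \<open>power_module\<close>, this allows factors on different types, as required
  for graphs in \<open>B\<close> times \<open>E\<close> and for pairs of a scalar and a module
  element.\<close>

definition prod_module ::
    "('r, 'm, 'a) module_scheme \<Rightarrow> ('r, 'n, 'b) module_scheme \<Rightarrow> ('r, 'm \<times> 'n) module"
  where "prod_module M N =
    \<lparr>carrier = carrier M \<times> carrier N, mult = undefined, one = undefined,
     zero = (\<zero>\<^bsub>M\<^esub>, \<zero>\<^bsub>N\<^esub>), add = (\<lambda>x y. (fst x \<oplus>\<^bsub>M\<^esub> fst y, snd x \<oplus>\<^bsub>N\<^esub> snd y)),
     smult = (\<lambda>a x. (a \<odot>\<^bsub>M\<^esub> fst x, a \<odot>\<^bsub>N\<^esub> snd x))\<rparr>"

lemma prod_module_simps [simp]: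
  "carrier (prod_module M N) = carrier M \<times> carrier N"
  "\<zero>\<^bsub>prod_module M N\<^esub> = (\<zero>\<^bsub>M\<^esub>, \<zero>\<^bsub>N\<^esub>)"
  "x \<oplus>\<^bsub>prod_module M N\<^esub> y = (fst x \<oplus>\<^bsub>M\<^esub> fst y, snd x \<oplus>\<^bsub>N\<^esub> snd y)"
  "a \<odot>\<^bsub>prod_module M N\<^esub> x = (a \<odot>\<^bsub>M\<^esub> fst x, a \<odot>\<^bsub>N\<^esub> snd x)"
  by (simp_all add: prod_module_def)

lemma left_module_prod:
  assumes "left_module R M" "left_module R N"
  shows "left_module R (prod_module M N)"
proof -
  interpret M: left_module R M by fact
  interpret N: left_module R N by fact
  have "abelian_group (prod_module M N)"
  proof (rule abelian_groupI)
    fix x assume "x \<in> carrier (prod_module M N)"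
    then show "\<exists>y\<in>carrier (prod_module M N). y \<oplus>\<^bsub>prod_module M N\<^esub> x = \<zero>\<^bsub>prod_module M N\<^esub>"
      by (intro bexI[of _ "(\<ominus>\<^bsub>M\<^esub> fst x, \<ominus>\<^bsub>N\<^esub> snd x)"]) (auto simp: M.M.l_neg N.M.l_neg)
  qed (auto simp: M.M.a_ac N.M.a_ac)
  then show ?thesis
    by (intro left_module.intro left_module_axioms.intro M.R.ring_axioms)
      (auto simp: M.smult_l_distr M.smult_r_distr M.smult_assoc1 N.smult_l_distr N.smult_r_distr N.smult_assoc1)
qed

section \<open>Baer's criterion\<close>

text \<open>Partial extensions are treated as graphs inside \<open>prod_module B E\<close>. A
  maximal one is defined everywhere: for a missing \<open>b\<close>, the hypothesis applied to the
  scalars that carry \<open>b\<close> into the domain provides a value \<open>e\<close> to assign to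
  \<open>b\<close>.\<close>

lemma injective_moduleI_Baer:
  fixes R :: "('r, 'a) ring_scheme" (structure) and E :: "('r, 'e, 'b) module_scheme"
  assumes E: "left_module R E"
    and baer: "\<And>I \<phi>. submodule I R (regular_module R) \<Longrightarrow> \<phi> \<in> mod_hom R (regular_module R\<lparr>carrier := I\<rparr>) E \<Longrightarrow>
      \<exists>e\<in>carrier E. \<forall>r\<in>I. \<phi> r = r \<odot>\<^bsub>E\<^esub> e"
  shows "injective_module R E"
  unfolding injective_module_def
proof (intro conjI allI impI, fact, elim conjE)
  fix A B :: "('r, 'r) module" and f g
  assume A: "left_module R A" and B: "left_module R B" and f: "f \<in> mod_hom R A B" "inj_on f (carrier A)"
    and g: "g \<in> mod_hom R A E"
  interpret A: left_module R A by fact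
  interpret B: left_module R B by fact
  interpret E: left_module R E by fact
  let ?P = "prod_module B E"
  interpret P: left_module R ?P by (rule left_module_prod[OF B E])
  interpret RR: left_module R "regular_module R" by (rule A.R.left_module_regular_module)
  define G0 where "G0 = (\<lambda>x\<in>carrier A. (f x, g x)) ` carrier A"
  have "(\<lambda>x\<in>carrier A. (f x, g x)) \<in> mod_hom R A ?P"
    by (rule A.mod_hom_restrictI)
      (use f(1) g in \<open>auto simp: mod_hom_closed mod_hom_add mod_hom_smult\<close>)
  from A.submodule_image[OF P.left_module_axioms this A.submodule_carrier]
  have G0: "submodule G0 R ?P" by (simp add: G0_def)
  \<comment> \<open>A submodule of the product is the graph of a partial homomorphism exactly when
    its only element over zero is zero. This turns single-valuedness, a condition on pairs of
    elements, into one on single elements.\<close>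
  define Q where "Q z \<longleftrightarrow> fst z = \<zero>\<^bsub>B\<^esub> \<longrightarrow> snd z = \<zero>\<^bsub>E\<^esub>" for z 
  have QG0: "\<forall>z\<in>G0. Q z"
  proof
    fix z assume z: "z \<in> G0"
    obtain x where x: "x \<in> carrier A" "z = (f x, g x)" using z by (auto simp: G0_def)
    have "x = \<zero>\<^bsub>A\<^esub>" if "f x = \<zero>\<^bsub>B\<^esub>"
      using inj_onD[OF f(2), of x "\<zero>\<^bsub>A\<^esub>"] that x(1) mod_hom_zero[OF A B f(1)] by simp
    then show "Q z" using x mod_hom_zero[OF A E g] by (auto simp: Q_def)
  qed
  from P.submodule_maximal[where Q = Q, OF G0 QG0] obtain G where
    G: "submodule G R ?P" "G0 \<subseteq> G" "\<forall>z\<in>G. Q z"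
    and max: "\<forall>G'. submodule G' R ?P \<and> G \<subseteq> G' \<and> (\<forall>z\<in>G'. Q z) \<longrightarrow> G' = G"
    by (elim exE conjE) (rule that)
  note Gc = P.submodule_closed[OF G(1)]
  have Gc': "x \<in> carrier B" "y \<in> carrier E" if "(x, y) \<in> G" for x y using Gc(1) that by auto
  have Gadd: "(x \<oplus>\<^bsub>B\<^esub> x', y \<oplus>\<^bsub>E\<^esub> y') \<in> G" if "(x,y) \<in> G" "(x',y') \<in> G" for x y x' y'
    using Gc(3)[OF that] by simp
  have Gsm: "(a \<odot>\<^bsub>B\<^esub> x, a \<odot>\<^bsub>E\<^esub> y) \<in> G" if "a \<in> carrier R" "(x,y) \<in> G" for a x y
    using Gc(4)[OF that] by simp
  have Gsv: "y = y'" if "(x,y) \<in> G" "(x,y') \<in> G" for x y y'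
  proof -
    have "(x \<oplus>\<^bsub>B\<^esub> (\<ominus> \<one>) \<odot>\<^bsub>B\<^esub> x, y \<oplus>\<^bsub>E\<^esub> (\<ominus> \<one>) \<odot>\<^bsub>E\<^esub> y') \<in> G"
      by (intro Gadd Gsm that) auto
    from bspec[OF G(3) this] have "y \<oplus>\<^bsub>E\<^esub> \<ominus>\<^bsub>E\<^esub> y' = \<zero>\<^bsub>E\<^esub>"
      using Gc'[OF that(1)] Gc'[OF that(2)] by (simp add: Q_def B.smult_l_minus E.smult_l_minus B.M.r_neg)
    then show ?thesis
      using E.M.minus_equality[of y "\<ominus>\<^bsub>E\<^esub> y'"] Gc'(2)[OF that(1)] Gc'(2)[OF that(2)] by simp
  qed
  have Gbase: "(f x, g x) \<in> G" if "x \<in> carrier A" for x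
    using G(2) that by (auto simp: G0_def)
  have total: "\<exists>y. (b, y) \<in> G" if b: "b \<in> carrier B" for b
  proof -
    define I where "I = {r \<in> carrier R. \<exists>y. (r \<odot>\<^bsub>B\<^esub> b, y) \<in> G}"
    define \<phi> where "\<phi> = (\<lambda>r\<in>I. THE y. (r \<odot>\<^bsub>B\<^esub> b, y) \<in> G)"
    have \<phi>_eq: "\<phi> r = y" if "r \<in> carrier R" "(r \<odot>\<^bsub>B\<^esub> b, y) \<in> G" for r y
      using that Gsv theI[of "\<lambda>y. (r \<odot>\<^bsub>B\<^esub> b, y) \<in> G"] unfolding I_def \<phi>_def by auto
    have \<phi>: "(r \<odot>\<^bsub>B\<^esub> b, \<phi> r) \<in> G" if "r \<in> I" for r
      using that \<phi>_eq by (auto simp: I_def)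
    have Iadd: "((r \<oplus> s) \<odot>\<^bsub>B\<^esub> b, \<phi> r \<oplus>\<^bsub>E\<^esub> \<phi> s) \<in> G" if "r \<in> I" "s \<in> I" for r s
      using Gadd[OF \<phi>[OF that(1)] \<phi>[OF that(2)]] that b by (simp add: I_def B.smult_l_distr)
    have Ism: "((a \<otimes> r) \<odot>\<^bsub>B\<^esub> b, a \<odot>\<^bsub>E\<^esub> \<phi> r) \<in> G" if "a \<in> carrier R" "r \<in> I" for a r
      using Gsm[OF that(1) \<phi>[OF that(2)]] that b by (simp add: I_def B.smult_assoc1)
    have I: "submodule I R (regular_module R)"
      by (rule RR.subset_submodule)
        (use Gc(2) Iadd Ism b in \<open>auto simp: I_def regular_module_def, blast+\<close>)
    have "\<phi> \<in> mod_hom R (regular_module R\<lparr>carrier := I\<rparr>) E"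
      unfolding mod_hom_def
    proof (intro CollectI conjI ballI)
      show "\<phi> \<in> carrier (regular_module R\<lparr>carrier := I\<rparr>) \<rightarrow>\<^sub>E carrier E"
        using Gc'(2)[OF \<phi>] by (auto simp: \<phi>_def)
    qed (use \<phi>_eq[OF _ Iadd] \<phi>_eq[OF _ Ism] in \<open>auto simp: regular_module_def I_def\<close>)
    from baer[OF I this] obtain e where e: "e \<in> carrier E" "\<And>r. r \<in> I \<Longrightarrow> \<phi> r = r \<odot>\<^bsub>E\<^esub> e"
      by blast
    let ?G' = "{z \<oplus>\<^bsub>?P\<^esub> r \<odot>\<^bsub>?P\<^esub> (b, e) | z r. z \<in> G \<and> r \<in> carrier R}"
    have be: "(b, e) \<in> carrier ?P" using b e by simp
    note adj = P.submodule_adjoin[OF G(1) be]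
    have "\<forall>z\<in>?G'. Q z"
    proof
      fix z assume "z \<in> ?G'"
      then obtain x y r where *: "(x, y) \<in> G" "r \<in> carrier R" "z = (x \<oplus>\<^bsub>B\<^esub> r \<odot>\<^bsub>B\<^esub> b, y \<oplus>\<^bsub>E\<^esub> r \<odot>\<^bsub>E\<^esub> e)"
        by auto
      note c = Gc'[OF *(1)]
      have "y \<oplus>\<^bsub>E\<^esub> r \<odot>\<^bsub>E\<^esub> e = \<zero>\<^bsub>E\<^esub>" if "x \<oplus>\<^bsub>B\<^esub> r \<odot>\<^bsub>B\<^esub> b = \<zero>\<^bsub>B\<^esub>"
      proof -
        \<comment> \<open>An element of the enlarged graph lying over zero has \<open>x\<close>
          equal to \<open>\<ominus> r\<close> times \<open>b\<close>, so \<open>\<ominus> r\<close>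
          lies in \<open>I\<close> and \<open>y\<close> is forced to be \<open>\<ominus> r\<close>
          times \<open>e\<close>.\<close>
        have "x = (\<ominus> r) \<odot>\<^bsub>B\<^esub> b"
          using that c b *(2) by (simp add: B.smult_l_minus B.M.minus_equality)
        then have G: "((\<ominus> r) \<odot>\<^bsub>B\<^esub> b, y) \<in> G" using *(1) by simp
        moreover from this have "\<ominus> r \<in> I" using *(2) by (auto simp: I_def)
        ultimately have "y = (\<ominus> r) \<odot>\<^bsub>E\<^esub> e" using \<phi>_eq[OF _ G] e(2) *(2) by simp
        then show ?thesis using e(1) *(2) by (simp add: E.smult_l_minus E.M.l_neg)
      qed
      then show "Q z" using *(3) by (simp add: Q_def)
    qed
    with max adj(1,2) have "?G' = G" by (elim allE[of _ ?G']) (rule mp, assumption, intro conjI)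
    with adj(3) show ?thesis by blast
  qed
  define h where "h = (\<lambda>b\<in>carrier B. THE y. (b, y) \<in> G)"
  have h: "h b = y" if "(b, y) \<in> G" for b y
    using that Gsv Gc'(1)[OF that] theI[of "\<lambda>y. (b, y) \<in> G"] unfolding h_def by auto
  have hG: "(b, h b) \<in> G" if "b \<in> carrier B" for b
    using total[OF that] h by auto
  have "h \<in> mod_hom R B E"
    unfolding mod_hom_def
  proof (intro CollectI conjI ballI)
    show "h \<in> carrier B \<rightarrow>\<^sub>E carrier E" using Gc'(2)[OF hG] by (auto simp: h_def)
  qed (auto intro!: h Gadd Gsm hG)
  moreover have "\<forall>x\<in>carrier A. h (f x) = g x" using Gbase h by blast
  ultimately show "\<exists>h\<in>mod_hom R B E. \<forall>x\<in>carrier A. h (f x) = g x" by blast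
qed

text \<open>A lift into \<open>W\<close> followed by \<open>r\<close> is a lift into
  \<open>E\<close>. In the end this moves injectivity from a module of tuples to a copy of its
  summand on the type that \<open>QF3\<close> prescribes.\<close>

lemma injective_module_retract:
  fixes R :: "('r, 'a) ring_scheme" and E :: "('r, 'e, 'b) module_scheme"
  assumes W: "injective_module R W" and E: "left_module R E"
    and s: "s \<in> mod_hom R E W" and r: "r \<in> mod_hom R W E"
    and rs: "\<And>x. x \<in> carrier E \<Longrightarrow> r (s x) = x"
  shows "injective_module R E"
  unfolding injective_module_def
proof (intro conjI allI impI, fact, elim conjE)
  fix A B :: "('r, 'r) module" and f g
  assume A: "left_module R A" and B: "left_module R B" and f: "f \<in> mod_hom R A B" "inj_on f (carrier A)"
    and g: "g \<in> mod_hom R A E"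
  obtain h where h: "h \<in> mod_hom R B W" "\<And>x. x \<in> carrier A \<Longrightarrow> h (f x) = compose (carrier A) s g x"
    using injective_module_lift[OF W A B f mod_hom_compose[OF g s A]] by blast
  show "\<exists>h\<in>mod_hom R B E. \<forall>x\<in>carrier A. h (f x) = g x"
    using mod_hom_compose[OF h(1) r B] h(2) rs mod_hom_closed[OF f(1)] mod_hom_closed[OF g]
    by (intro bexI[of _ "compose (carrier B) r h"]) (auto simp: compose_def)
qed

section \<open>Artinian modules\<close>

definition artinian_module :: "('r, 'a) ring_scheme \<Rightarrow> ('r, 'm, 'b) module_scheme \<Rightarrow> bool"
  where "artinian_module R M \<longleftrightarrow>
    (\<forall>N :: nat \<Rightarrow> 'm set. (\<forall>n. submodule (N n) R M \<and> N (Suc n) \<subseteq> N n) \<longrightarrow> (\<exists>k. \<forall>n\<ge>k. N n = N k))"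

lemma artinian_moduleD:
  assumes "artinian_module R M" "\<And>n. submodule (N n) R M" "\<And>n. N (Suc n) \<subseteq> N n"
  shows "\<exists>k. \<forall>n\<ge>k. N n = N k"
  using assms unfolding artinian_module_def by blast

lemma artinian_minimal:
  assumes art: "artinian_module R M" and sub: "\<And>N. N \<in> \<S> \<Longrightarrow> submodule N R M" and "\<S> \<noteq> {}"
  shows "\<exists>N\<in>\<S>. \<forall>N'\<in>\<S>. N' \<subseteq> N \<longrightarrow> N' = N"
proof (rule ccontr)
  assume "\<not> ?thesis"
  then have neg: "\<forall>N\<in>\<S>. \<exists>N'\<in>\<S>. N' \<subset> N" by blast
  obtain N0 where "N0 \<in> \<S>" using assms(3) by blast
  then have "\<exists>N. \<forall>n. N n \<in> \<S> \<and> N (Suc n) \<subset> N n"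
    using neg by (intro dependent_nat_choice) auto
  then obtain N where N: "\<And>n. N n \<in> \<S>" "\<And>n. N (Suc n) \<subset> N n" by blast
  have "\<exists>k. \<forall>n\<ge>k. N n = N k" by (rule artinian_moduleD[OF art]) (use N sub in blast)+
  then obtain k where "\<forall>n\<ge>k. N n = N k" by blast
  then show False using N(2)[of k] by (metis le_Suc_eq order_refl psubset_eq)
qed

text \<open>A finite intersection that is minimal among the finite ones is unchanged by one more
  member, hence lies in all of them. It is applied to equations indexed by a left ideal, to all
  pairs \<open>(L, \<phi>)\<close>, and to kernels of maps into summands.\<close>

lemma (in left_module) artinian_finite_Inter:
  assumes art: "artinian_module R M" and A: "\<forall>i\<in>I. submodule (A i) R M"
  shows "\<exists>J. finite J \<and> J \<subseteq> I \<and> (\<forall>x\<in>carrier M. (\<forall>j\<in>J. x \<in> A j) \<longrightarrow> (\<forall>i\<in>I. x \<in> A i))"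
proof -
  define C where "C J = {x \<in> carrier M. \<forall>j\<in>J. x \<in> A j}" for J
  let ?S = "C ` {J. finite J \<and> J \<subseteq> I}"
  have "\<exists>N\<in>?S. \<forall>N'\<in>?S. N' \<subseteq> N \<longrightarrow> N' = N"
  proof (rule artinian_minimal[OF art])
    fix N assume "N \<in> ?S"
    then obtain J where "J \<subseteq> I" "N = C J" by blast
    then show "submodule N R M" unfolding C_def using A by (auto intro!: submodule_Inter)
  qed auto
  then obtain J where J: "finite J" "J \<subseteq> I" and min: "\<And>J'. finite J' \<Longrightarrow> J' \<subseteq> I \<Longrightarrow> C J' \<subseteq> C J \<Longrightarrow> C J' = C J"
    by auto
  show ?thesis
  proof (intro exI[of _ J] conjI ballI impI J)
    fix x i assume x: "x \<in> carrier M" "\<forall>j\<in>J. x \<in> A j" and i: "i \<in> I"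
    have "C (insert i J) = C J" by (rule min) (use J i in \<open>auto simp: C_def\<close>)
    moreover have "x \<in> C J" using x by (simp add: C_def)
    ultimately have "x \<in> C (insert i J)" by simp
    then show "x \<in> A i" by (simp add: C_def)
  qed
qed

lemma artinian_surjective_image:
  assumes M: "left_module R M" and N: "left_module R N" and art: "artinian_module R M"
    and f: "f \<in> mod_hom R M N" "f ` carrier M = carrier N"
  shows "artinian_module R N"
  unfolding artinian_module_def
proof (intro allI impI)
  interpret M: left_module R M by fact
  interpret N: left_module R N by fact
  fix P assume P: "\<forall>n. submodule (P n) R N \<and> P (Suc n) \<subseteq> P n"
  let ?Q = "\<lambda>n. {x \<in> carrier M. f x \<in> P n}"
  have "\<exists>k. \<forall>n\<ge>k. ?Q n = ?Q k"
    by (rule artinian_moduleD[OF art]) (use P M.submodule_vimage[OF N f(1)] in auto)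
  moreover have "P n = f ` ?Q n" for n
  proof
    show "P n \<subseteq> f ` ?Q n"
    proof
      fix y assume y: "y \<in> P n"
      then have "y \<in> f ` carrier M" using N.submodule_closed(1)[OF conjunct1[OF spec[OF P]]] f(2) by blast
      then show "y \<in> f ` ?Q n" using y by blast
    qed
  qed blast
  ultimately show "\<exists>k. \<forall>n\<ge>k. P n = P k" by (metis (no_types, lifting))
qed

text \<open>The intersections with the first factor and the projections to the second both become
  stationary. From then on no member can shrink: two elements with equal second coordinate differ by
  an element of the first factor.\<close>

lemma artinian_prod:
  assumes M: "left_module R M" and N: "left_module R N" and "artinian_module R M" "artinian_module R N"
  shows "artinian_module R (prod_module M N)"
  unfolding artinian_module_def
proof (intro allI impI)
  interpret M: left_module R M by fact
  interpret N: left_module R N by fact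
  let ?P = "prod_module M N"
  interpret P: left_module R ?P by (rule left_module_prod[OF M N])
  fix P assume P: "\<forall>n. submodule (P n) R ?P \<and> P (Suc n) \<subseteq> P n"
  note c = P.submodule_closed[OF conjunct1[OF spec[OF P]]]
  define A where "A n = {x \<in> carrier M. (x, \<zero>\<^bsub>N\<^esub>) \<in> P n}" for n
  define B where "B n = snd ` P n" for n
  have i: "(\<lambda>x\<in>carrier M. (x, \<zero>\<^bsub>N\<^esub>)) \<in> mod_hom R M ?P" by (rule M.mod_hom_restrictI) auto
  have s: "restrict snd (carrier ?P) \<in> mod_hom R ?P N" by (rule P.mod_hom_restrictI) auto
  have "\<exists>k. \<forall>n\<ge>k. A n = A k"
  proof (rule artinian_moduleD[OF assms(3)])
    show "submodule (A n) R M" for n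
    proof -
      have "A n = {x \<in> carrier M. (\<lambda>x\<in>carrier M. (x, \<zero>\<^bsub>N\<^esub>)) x \<in> P n}" by (auto simp: A_def)
      then show ?thesis using M.submodule_vimage[OF P.left_module_axioms i] P by simp
    qed
    show "A (Suc n) \<subseteq> A n" for n using conjunct2[OF spec[OF P, of n]] unfolding A_def by blast
  qed
  moreover have "\<exists>k. \<forall>n\<ge>k. B n = B k"
  proof (rule artinian_moduleD[OF assms(4)])
    show "submodule (B n) R N" for n
    proof -
      have "B n = restrict snd (carrier ?P) ` P n"
        unfolding B_def using c(1)[of n] by (intro image_cong) auto
      then show ?thesis using P.submodule_image[OF N s] P by simp
    qed
    show "B (Suc n) \<subseteq> B n" for n using P unfolding B_def by (intro image_mono) simp
  qed
  ultimately obtain k l where k: "\<forall>n\<ge>k. A n = A k" and l: "\<forall>n\<ge>l. B n = B l" by blast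
  have dec: "P n \<subseteq> P m" if "m \<le> n" for m n 
    using conjunct2[OF spec[OF P]] by (rule lift_Suc_antimono_le[OF _ that])
  show "\<exists>k. \<forall>n\<ge>k. P n = P k"
  proof (intro exI[of _ "max k l"] allI impI equalityI)
    fix n assume n: "max k l \<le> n"
    show "P n \<subseteq> P (max k l)" by (rule dec[OF n])
    show "P (max k l) \<subseteq> P n"
    proof
      fix z assume z: "z \<in> P (max k l)"
      have "B n = B (max k l)" using l n by (metis max.bounded_iff max.cobounded2)
      then have "snd z \<in> B n" using z by (auto simp: B_def)
      then obtain z' where z': "z' \<in> P n" "snd z' = snd z" by (auto simp: B_def)
      have cc: "z \<in> carrier ?P" "z' \<in> carrier ?P" using z z' c(1) by blast+
      have "z \<ominus>\<^bsub>?P\<^esub> z' \<in> P (max k l)" using z z' dec[OF n] c(5) by blast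
      moreover have "z \<ominus>\<^bsub>?P\<^esub> z' = (fst z \<ominus>\<^bsub>M\<^esub> fst z', \<zero>\<^bsub>N\<^esub>)"
      proof -
        have "\<ominus>\<^bsub>?P\<^esub> z' = (\<ominus>\<^bsub>M\<^esub> fst z', \<ominus>\<^bsub>N\<^esub> snd z')"
          by (rule P.M.minus_equality) (use cc in \<open>auto simp: M.M.l_neg N.M.l_neg\<close>)
        then show ?thesis using cc z'(2) by (auto simp: a_minus_def N.M.r_neg)
      qed
      ultimately have "fst z \<ominus>\<^bsub>M\<^esub> fst z' \<in> A (max k l)" using cc by (auto simp: A_def)
      moreover have "A n = A (max k l)" using k n by (metis max.bounded_iff max.cobounded1)
      ultimately have "(fst z \<ominus>\<^bsub>M\<^esub> fst z', \<zero>\<^bsub>N\<^esub>) \<in> P n" by (auto simp: A_def)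
      from c(3)[OF z'(1) this]
      show "z \<in> P n" using cc z'(2) by (auto simp: a_minus_def M.M.a_ac M.M.r_neg M.M.r_neg1 M.M.r_neg2)
    qed
  qed
qed

lemma artinian_power:
  assumes M: "left_module R M" and art: "artinian_module R M" and "finite I"
  shows "artinian_module R (power_module M I)"
  using \<open>finite I\<close>
proof induction
  case empty
  interpret P: left_module R "power_module M {}" by (rule left_module.left_module_power[OF M])
  have "N = {\<lambda>_. undefined}" if "submodule N R (power_module M {})" for N
    using P.submodule_closed(1,2)[OF that] by (auto simp: power_module_def)
  then show ?case unfolding artinian_module_def by metis
next
  case (insert i I)
  interpret M: left_module R M by fact
  let ?P = "prod_module M (power_module M I)"
  have PI: "left_module R (power_module M I)" "left_module R (power_module M (insert i I))"
    by (rule M.left_module_power)+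
  interpret P: left_module R ?P by (rule left_module_prod[OF M PI(1)])
  let ?f = "\<lambda>z\<in>carrier ?P. (snd z)(i := fst z)"
  show ?case
  proof (rule artinian_surjective_image[OF P.left_module_axioms PI(2) artinian_prod[OF M PI(1) art insert.IH]])
    show "?f \<in> mod_hom R ?P (power_module M (insert i I))"
      by (rule P.mod_hom_restrictI)
        (use insert.hyps in \<open>auto simp: power_module_def fun_eq_iff restrict_def PiE_def Pi_def extensional_def\<close>)
    show "?f ` carrier ?P = carrier (power_module M (insert i I))"
      using insert.hyps by (simp add: power_module_def PiE_insert_eq image_def)
  qed
qed

lemma (in left_module) smult_finsum:
  assumes "finite S" "a \<in> carrier R" "f \<in> S \<rightarrow> carrier M"
  shows "a \<odot>\<^bsub>M\<^esub> (\<Oplus>\<^bsub>M\<^esub>s\<in>S. f s) = (\<Oplus>\<^bsub>M\<^esub>s\<in>S. a \<odot>\<^bsub>M\<^esub> f s)"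
  using assms
proof (induction S)
  case (insert s S)
  then have "f s \<in> carrier M" "f \<in> S \<rightarrow> carrier M" by auto
  with insert show ?case
    by (simp add: M.finsum_insert M.finsum_closed smult_r_distr Pi_iff)
qed simp

text \<open>The generators themselves index a finite power of \<open>R\<close> that maps onto
  \<open>M\<close>, and the chain condition passes to finite powers and to quotients.\<close>

lemma (in left_module) artinian_fin_gen:
  assumes art: "artinian_module R (regular_module R)" and "fin_gen_module R M"
  shows "artinian_module R M"
proof -
  obtain S where S: "finite S" "S \<subseteq> carrier M"
    "\<And>x. x \<in> carrier M \<Longrightarrow> \<exists>c\<in>S \<rightarrow> carrier R. x = (\<Oplus>\<^bsub>M\<^esub>s\<in>S. c s \<odot>\<^bsub>M\<^esub> s)"
    using assms(2) unfolding fin_gen_module_def by blast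
  interpret RR: left_module R "regular_module R" by (rule R.left_module_regular_module)
  let ?P = "power_module (regular_module R) S"
  interpret P: left_module R ?P by (rule RR.left_module_power)
  let ?f = "\<lambda>c\<in>carrier ?P. \<Oplus>\<^bsub>M\<^esub>s\<in>S. c s \<odot>\<^bsub>M\<^esub> s"
  have cl: "(\<lambda>s. c s \<odot>\<^bsub>M\<^esub> s) \<in> S \<rightarrow> carrier M" if "c \<in> carrier ?P" for c
    using that S(2) by (auto simp: power_module_def regular_module_def)
  have carr: "c s \<in> carrier R" if "c \<in> carrier ?P" "s \<in> S" for c s
    using that by (auto simp: power_module_def regular_module_def)
  have hom: "?f \<in> mod_hom R ?P M"
  proof (rule P.mod_hom_restrictI)
    fix c d assume cd: "c \<in> carrier ?P" "d \<in> carrier ?P"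
    have "(\<Oplus>\<^bsub>M\<^esub>s\<in>S. (c \<oplus>\<^bsub>?P\<^esub> d) s \<odot>\<^bsub>M\<^esub> s) = (\<Oplus>\<^bsub>M\<^esub>s\<in>S. c s \<odot>\<^bsub>M\<^esub> s \<oplus>\<^bsub>M\<^esub> d s \<odot>\<^bsub>M\<^esub> s)"
      by (rule M.finsum_cong')
        (use cl[OF cd(1)] cl[OF cd(2)] carr cd S(2) in \<open>auto simp: power_module_def regular_module_def smult_l_distr Pi_iff\<close>)
    then show "(\<Oplus>\<^bsub>M\<^esub>s\<in>S. (c \<oplus>\<^bsub>?P\<^esub> d) s \<odot>\<^bsub>M\<^esub> s) = (\<Oplus>\<^bsub>M\<^esub>s\<in>S. c s \<odot>\<^bsub>M\<^esub> s) \<oplus>\<^bsub>M\<^esub> (\<Oplus>\<^bsub>M\<^esub>s\<in>S. d s \<odot>\<^bsub>M\<^esub> s)"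
      using M.finsum_addf[OF cl[OF cd(1)] cl[OF cd(2)]] by simp
  next
    fix a c assume a: "a \<in> carrier R" and c: "c \<in> carrier ?P"
    have "(\<Oplus>\<^bsub>M\<^esub>s\<in>S. (a \<odot>\<^bsub>?P\<^esub> c) s \<odot>\<^bsub>M\<^esub> s) = (\<Oplus>\<^bsub>M\<^esub>s\<in>S. a \<odot>\<^bsub>M\<^esub> (c s \<odot>\<^bsub>M\<^esub> s))"
      by (rule M.finsum_cong')
        (use cl[OF c] carr c a S(2) in \<open>auto simp: power_module_def regular_module_def smult_assoc1 Pi_iff subset_iff\<close>)
    then show "(\<Oplus>\<^bsub>M\<^esub>s\<in>S. (a \<odot>\<^bsub>?P\<^esub> c) s \<odot>\<^bsub>M\<^esub> s) = a \<odot>\<^bsub>M\<^esub> (\<Oplus>\<^bsub>M\<^esub>s\<in>S. c s \<odot>\<^bsub>M\<^esub> s)"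
      using smult_finsum[OF S(1) a cl[OF c]] by simp
  qed (use cl in \<open>auto intro: M.finsum_closed\<close>)
  have "?f ` carrier ?P = carrier M"
  proof
    show "?f ` carrier ?P \<subseteq> carrier M" using mod_hom_closed[OF hom] by blast
    show "carrier M \<subseteq> ?f ` carrier ?P"
    proof
      fix x assume "x \<in> carrier M"
      then obtain c where c: "c \<in> S \<rightarrow> carrier R" "x = (\<Oplus>\<^bsub>M\<^esub>s\<in>S. c s \<odot>\<^bsub>M\<^esub> s)" using S(3) by blast
      have "restrict c S \<in> carrier ?P" using c(1) by (auto simp: power_module_def regular_module_def)
      moreover have "(\<Oplus>\<^bsub>M\<^esub>s\<in>S. restrict c S s \<odot>\<^bsub>M\<^esub> s) = x"
        unfolding c(2) by (rule M.finsum_cong') (use c(1) S(2) in \<open>auto simp: Pi_iff subset_iff\<close>)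
      ultimately show "x \<in> ?f ` carrier ?P" by (intro image_eqI[of _ _ "restrict c S"]) auto
    qed
  qed
  then show ?thesis
    using artinian_surjective_image[OF P.left_module_axioms left_module_axioms artinian_power[OF RR.left_module_axioms art S(1)] hom]
    by blast
qed

section \<open>Chain conditions over an artin algebra\<close>

lemma artinian_restrict_scalars:
  assumes "artinian_module K A" "\<And>N. submodule N T M \<Longrightarrow> submodule N K A"
  shows "artinian_module T M"
  using assms unfolding artinian_module_def by blast

lemma artinian_cring_module:
  fixes K (structure)
  assumes "artinian_cring K"
  shows "artinian_module K (regular_module K)"
proof -
  interpret cring K using assms by (simp add: artinian_cring_def)
  interpret RR: left_module K "regular_module K" by (rule left_module_regular_module)
  have "ideal I K" if "submodule I K (regular_module K)" for I
  proof (rule idealI[OF ring_axioms])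
    show "subgroup I (add_monoid K)"
      using that by (simp add: submodule_def subgroup_def m_inv_def regular_module_def)
    have I: "x \<otimes> a \<in> I" if "a \<in> I" "x \<in> carrier K" for a x
      using RR.submodule_closed(4)[OF \<open>submodule I K (regular_module K)\<close> that(2,1)] by (simp add: regular_module_def)
    show "x \<otimes> a \<in> I" if "a \<in> I" "x \<in> carrier K" for a x using I that .
    show "a \<otimes> x \<in> I" if "a \<in> I" "x \<in> carrier K" for a x
      using I[OF that] that RR.submodule_closed(1)[OF \<open>submodule I K (regular_module K)\<close>]
      by (auto simp: regular_module_def m_comm subset_iff)
  qed
  then show ?thesis using assms unfolding artinian_cring_def artinian_module_def by blast
qed

text \<open>\<open>t\<close> stands for the structure map of the algebra, which sends
  \<open>k\<close> to \<open>k\<close> times the unit; through it one-sided ideals become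
  \<open>K\<close>-submodules.\<close>

lemma submodule_restrict_scalars:
  assumes A: "left_module K A" and M: "left_module T M"
    and eq: "carrier M = carrier A" "add M = add A" "zero M = zero A"
    and t: "\<And>k. k \<in> carrier K \<Longrightarrow> t k \<in> carrier T"
      "\<And>k x. k \<in> carrier K \<Longrightarrow> x \<in> carrier A \<Longrightarrow> t k \<odot>\<^bsub>M\<^esub> x = k \<odot>\<^bsub>A\<^esub> x"
    and N: "submodule N T M"
  shows "submodule N K A"
proof -
  interpret A: left_module K A by fact
  interpret M: left_module T M by fact
  note N = M.submodule_closed[OF N]
  show ?thesis
  proof (rule A.subset_submodule)
    show "k \<odot>\<^bsub>A\<^esub> x \<in> N" if "k \<in> carrier K" "x \<in> N" for k x
      using N(4)[OF t(1)[OF that(1)] that(2)] t(2)[OF that(1), of x] N(1) that(2) eq(1) by auto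
  qed (use N(1-3) eq in auto)
qed

text \<open>All three follow from the chain condition of \<open>A\<close> over \<open>K\<close>. The
  double opposite is listed because \<open>op_ring (op_ring A)\<close> is a different record from
  \<open>A\<close>; it is the opposite of the scalar ring when right \<open>A\<close>-modules are
  viewed as left modules over \<open>op_ring A\<close>.\<close>

lemma artin_algebra_artinian:
  assumes "artin_algebra K A"
  shows "artinian_module A (regular_module A)"
    "artinian_module (op_ring A) (regular_module (op_ring A))"
    "artinian_module (op_ring (op_ring A)) (regular_module (op_ring (op_ring A)))"
proof -
  interpret KA: Module.module K A using assms by (simp add: artin_algebra_def)
  interpret A: ring A using assms by (simp add: artin_algebra_def)
  interpret A': ring "op_ring A" by (rule A.ring_op)
  interpret A'': ring "op_ring (op_ring A)" by (rule A'.ring_op)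
  have lm: "left_module K A"
    by (intro left_module.intro left_module_axioms.intro KA.R.ring_axioms KA.M.abelian_group_axioms)
      (auto simp: KA.smult_l_distr KA.smult_r_distr KA.smult_assoc1)
  interpret K: left_module K A by (rule lm)
  have compat: "(k \<odot>\<^bsub>A\<^esub> x) \<otimes>\<^bsub>A\<^esub> y = k \<odot>\<^bsub>A\<^esub> (x \<otimes>\<^bsub>A\<^esub> y)" "x \<otimes>\<^bsub>A\<^esub> (k \<odot>\<^bsub>A\<^esub> y) = k \<odot>\<^bsub>A\<^esub> (x \<otimes>\<^bsub>A\<^esub> y)"
    if "k \<in> carrier K" "x \<in> carrier A" "y \<in> carrier A" for k x y
    using assms that by (auto simp: artin_algebra_def)
  have art: "artinian_module K A"
    by (rule K.artinian_fin_gen) (use assms artinian_cring_module in \<open>auto simp: artin_algebra_def\<close>)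
  note restrict = artinian_restrict_scalars[OF art submodule_restrict_scalars[OF lm, where t = "\<lambda>k. k \<odot>\<^bsub>A\<^esub> \<one>\<^bsub>A\<^esub>"]]
  show "artinian_module A (regular_module A)"
    by (rule restrict[OF A.left_module_regular_module]) (auto simp: regular_module_def compat)
  show "artinian_module (op_ring A) (regular_module (op_ring A))"
    by (rule restrict[OF A'.left_module_regular_module]) (auto simp: op_ring_def regular_module_def compat)
  show "artinian_module (op_ring (op_ring A)) (regular_module (op_ring (op_ring A)))"
    by (rule restrict[OF A''.left_module_regular_module]) (auto simp: op_ring_def regular_module_def compat)
qed

text \<open>The chains of left and of right ideals generated by the powers of \<open>a\<close>
  become stationary, which gives \<open>a^n = c a^(2n) = a^(2n) b\<close>. Then
  \<open>c a^n = c a^(2n) b = a^n b\<close>, and the square of this element is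
  \<open>(c a^n) (a^n b) = c a^(2n) b = a^n b\<close> again.\<close>

lemma (in ring) ex_idempotent_mult:
  assumes art: "artinian_module R (regular_module R)" and art_op: "artinian_module (op_ring R) (regular_module (op_ring R))"
    and a: "a \<in> carrier R"
  shows "\<exists>n>0. \<exists>c\<in>carrier R. (c \<otimes> a [^] n) \<otimes> (c \<otimes> a [^] n) = c \<otimes> a [^] n \<and> (c \<otimes> a [^] n) \<otimes> a [^] n = a [^] (n::nat)"
proof -
  interpret RR: left_module R "regular_module R" by (rule left_module_regular_module)
  interpret O: ring "op_ring R" by (rule ring_op)
  interpret OO: left_module "op_ring R" "regular_module (op_ring R)" by (rule O.left_module_regular_module)
  have pow: "a [^] n \<in> carrier R" for n :: nat using a by simp
  have "\<exists>k::nat. \<forall>n\<ge>k. {x \<otimes> a [^] n | x. x \<in> carrier R} = {x \<otimes> a [^] k | x. x \<in> carrier R}"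
  proof (rule artinian_moduleD[OF art, where N = "\<lambda>n. {x \<otimes> a [^] n | x. x \<in> carrier R}"])
    fix n :: nat
    show "submodule {x \<otimes> a [^] n | x. x \<in> carrier R} R (regular_module R)"
    proof (rule RR.subset_submodule)
      show "\<zero>\<^bsub>regular_module R\<^esub> \<in> {x \<otimes> a [^] n | x. x \<in> carrier R}"
        using pow[of n] by (auto simp: regular_module_def intro!: exI[of _ \<zero>])
      fix x y assume "x \<in> {x \<otimes> a [^] n | x. x \<in> carrier R}" "y \<in> {x \<otimes> a [^] n | x. x \<in> carrier R}"
      then obtain x' y' where "x = x' \<otimes> a [^] n" "y = y' \<otimes> a [^] n" "x' \<in> carrier R" "y' \<in> carrier R" by blast
      then show "x \<oplus>\<^bsub>regular_module R\<^esub> y \<in> {x \<otimes> a [^] n | x. x \<in> carrier R}"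
        using pow[of n] by (auto simp: regular_module_def l_distr intro!: exI[of _ "x' \<oplus> y'"])
    next
      fix b x assume "b \<in> carrier R" "x \<in> {x \<otimes> a [^] n | x. x \<in> carrier R}"
      then obtain x' where "x = x' \<otimes> a [^] n" "x' \<in> carrier R" by blast
      then show "b \<odot>\<^bsub>regular_module R\<^esub> x \<in> {x \<otimes> a [^] n | x. x \<in> carrier R}"
        using pow[of n] \<open>b \<in> carrier R\<close> by (auto simp: regular_module_def m_assoc intro!: exI[of _ "b \<otimes> x'"])
    qed (use pow in \<open>auto simp: regular_module_def\<close>)
    show "{x \<otimes> a [^] Suc n | x. x \<in> carrier R} \<subseteq> {x \<otimes> a [^] n | x. x \<in> carrier R}"
    proof clarify
      fix x assume "x \<in> carrier R"
      then show "\<exists>y. x \<otimes> a [^] Suc n = y \<otimes> a [^] n \<and> y \<in> carrier R"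
        using a nat_pow_Suc2[OF a, of n] by (intro exI[of _ "x \<otimes> a"]) (simp add: m_assoc del: nat_pow_Suc)
    qed
  qed
  then obtain k :: nat where k: "\<And>n. n \<ge> k \<Longrightarrow> {x \<otimes> a [^] n | x. x \<in> carrier R} = {x \<otimes> a [^] k | x. x \<in> carrier R}" by blast
  have "\<exists>k::nat. \<forall>n\<ge>k. {a [^] n \<otimes> x | x. x \<in> carrier R} = {a [^] k \<otimes> x | x. x \<in> carrier R}"
  proof (rule artinian_moduleD[OF art_op, where N = "\<lambda>n. {a [^] n \<otimes> x | x. x \<in> carrier R}"])
    fix n :: nat
    show "submodule {a [^] n \<otimes> x | x. x \<in> carrier R} (op_ring R) (regular_module (op_ring R))"
    proof (rule OO.subset_submodule)
      show "\<zero>\<^bsub>regular_module (op_ring R)\<^esub> \<in> {a [^] n \<otimes> x | x. x \<in> carrier R}"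
        using pow[of n] by (auto simp: regular_module_def op_ring_def intro!: exI[of _ \<zero>])
      fix x y assume "x \<in> {a [^] n \<otimes> x | x. x \<in> carrier R}" "y \<in> {a [^] n \<otimes> x | x. x \<in> carrier R}"
      then obtain x' y' where "x = a [^] n \<otimes> x'" "y = a [^] n \<otimes> y'" "x' \<in> carrier R" "y' \<in> carrier R" by blast
      then show "x \<oplus>\<^bsub>regular_module (op_ring R)\<^esub> y \<in> {a [^] n \<otimes> x | x. x \<in> carrier R}"
        using pow[of n] by (auto simp: regular_module_def op_ring_def r_distr intro!: exI[of _ "x' \<oplus> y'"])
    next
      fix b x assume b: "b \<in> carrier (op_ring R)" "x \<in> {a [^] n \<otimes> x | x. x \<in> carrier R}"
      then obtain x' where "x = a [^] n \<otimes> x'" "x' \<in> carrier R" by blast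
      then show "b \<odot>\<^bsub>regular_module (op_ring R)\<^esub> x \<in> {a [^] n \<otimes> x | x. x \<in> carrier R}"
        using pow[of n] b(1) by (auto simp: regular_module_def op_ring_def m_assoc intro!: exI[of _ "x' \<otimes> b"])
    qed (use pow in \<open>auto simp: regular_module_def op_ring_def\<close>)
    show "{a [^] Suc n \<otimes> x | x. x \<in> carrier R} \<subseteq> {a [^] n \<otimes> x | x. x \<in> carrier R}"
    proof clarify
      fix x assume "x \<in> carrier R"
      then show "\<exists>y. a [^] Suc n \<otimes> x = a [^] n \<otimes> y \<and> y \<in> carrier R"
        using a by (intro exI[of _ "a \<otimes> x"]) (simp add: m_assoc)
    qed
  qed
  then obtain l :: nat where l: "\<And>n. n \<ge> l \<Longrightarrow> {a [^] n \<otimes> x | x. x \<in> carrier R} = {a [^] l \<otimes> x | x. x \<in> carrier R}" by blast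
  \<comment> \<open>The successor makes the exponent positive, so that the power stays in any ideal
    containing \<open>a\<close>.\<close>
  define n where "n = Suc (max k l)"
  let ?\<alpha> = "a [^] n"
  have kl: "k \<le> n" "l \<le> n" "k \<le> n + n" "l \<le> n + n" by (auto simp: n_def)
  have "{x \<otimes> a [^] n | x. x \<in> carrier R} = {x \<otimes> a [^] (n + n) | x. x \<in> carrier R}"
    using k[OF kl(1)] k[OF kl(3)] by simp
  moreover have "?\<alpha> \<in> {x \<otimes> a [^] n | x. x \<in> carrier R}" using pow[of n] by (auto intro!: exI[of _ \<one>])
  ultimately obtain c where c: "c \<in> carrier R" "?\<alpha> = c \<otimes> a [^] (n + n)" by blast
  have "{a [^] n \<otimes> x | x. x \<in> carrier R} = {a [^] (n + n) \<otimes> x | x. x \<in> carrier R}"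
    using l[OF kl(2)] l[OF kl(4)] by simp
  moreover have "?\<alpha> \<in> {a [^] n \<otimes> x | x. x \<in> carrier R}" using pow[of n] by (auto intro!: exI[of _ \<one>])
  ultimately obtain b where b: "b \<in> carrier R" "?\<alpha> = a [^] (n + n) \<otimes> b" by blast
  have c': "(c \<otimes> ?\<alpha>) \<otimes> ?\<alpha> = ?\<alpha>" 
    using c(1) pow[of n] by (simp only: m_assoc nat_pow_mult[OF a] c(2)[symmetric])
  have b': "?\<alpha> \<otimes> (?\<alpha> \<otimes> b) = ?\<alpha>" 
    using b(1) pow[of n] by (simp only: m_assoc[symmetric] nat_pow_mult[OF a] b(2)[symmetric])
  have "c \<otimes> ?\<alpha> = c \<otimes> (?\<alpha> \<otimes> (?\<alpha> \<otimes> b))" by (simp only: b')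
  also have "\<dots> = ((c \<otimes> ?\<alpha>) \<otimes> ?\<alpha>) \<otimes> b" using c(1) b(1) pow[of n] by (simp add: m_assoc)
  finally have e: "c \<otimes> ?\<alpha> = ?\<alpha> \<otimes> b" by (simp only: c')
  have "(c \<otimes> ?\<alpha>) \<otimes> (c \<otimes> ?\<alpha>) = (c \<otimes> ?\<alpha>) \<otimes> (?\<alpha> \<otimes> b)" by (simp only: e)
  also have "\<dots> = ((c \<otimes> ?\<alpha>) \<otimes> ?\<alpha>) \<otimes> b" using c(1) b(1) pow[of n] by (simp add: m_assoc)
  also have "\<dots> = ?\<alpha> \<otimes> b" by (simp only: c')
  also have "\<dots> = c \<otimes> ?\<alpha>" by (rule e[symmetric])
  finally show ?thesis using c(1) c' by (intro exI[of _ n]) (auto simp: n_def)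
qed

section \<open>Injective envelopes inside an injective module\<close>

lemma cogeneratesI:
  assumes X: "left_module R X" and M: "left_module R M"
    and sep: "\<And>x. x \<in> carrier X \<Longrightarrow> x \<noteq> \<zero>\<^bsub>X\<^esub> \<Longrightarrow> \<exists>h\<in>mod_hom R X M. h x \<noteq> \<zero>\<^bsub>M\<^esub>"
  shows "cogenerates R M X"
  unfolding cogenerates_def
proof (intro exI conjI)
  interpret X: left_module R X by fact
  interpret M: left_module R M by fact
  let ?I = "mod_hom R X M"
  let ?f = "\<lambda>x\<in>carrier X. \<lambda>h\<in>?I. h x"
  show "?f \<in> mod_hom R X (power_module M ?I)"
    by (rule X.mod_hom_restrictI)
      (auto simp: power_module_def fun_eq_iff restrict_def mod_hom_closed mod_hom_add mod_hom_smult)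
  show "inj_on ?f (carrier X)"
  proof (rule inj_onI, rule ccontr)
    fix x y assume xy: "x \<in> carrier X" "y \<in> carrier X" "?f x = ?f y" "x \<noteq> y"
    have "x \<ominus>\<^bsub>X\<^esub> y \<noteq> \<zero>\<^bsub>X\<^esub>" using xy by simp
    then obtain h where h: "h \<in> ?I" "h (x \<ominus>\<^bsub>X\<^esub> y) \<noteq> \<zero>\<^bsub>M\<^esub>" using sep[of "x \<ominus>\<^bsub>X\<^esub> y"] xy by auto
    have "h x = h y" using fun_cong[OF xy(3), of h] h(1) xy(1,2) by simp
    then show False
      using h(2) mod_hom_minus[OF X M h(1) xy(1,2)] mod_hom_closed[OF h(1) xy(2)] by simp
  qed
qed

text \<open>Each coordinate of an embedding of \<open>E\<close> into a power of \<open>M\<close> is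
  a homomorphism from \<open>E\<close> to \<open>M\<close>, and some coordinate is nonzero at
  \<open>j u\<close>. Such maps lead back to \<open>M\<close>, where the balance condition can act
  on them.\<close>

lemma QF3_separating:
  fixes R :: "('r, 'a) ring_scheme" and M :: "('r, 'm, 'b) module_scheme"
  assumes M: "left_module R M" and "QF3 R M"
  shows "\<exists>(E :: ('r, 'r \<Rightarrow> nat \<Rightarrow> 'm) module) j. injective_module R E \<and> j \<in> mod_hom R M E \<and>
    (\<forall>u\<in>carrier M. u \<noteq> \<zero>\<^bsub>M\<^esub> \<longrightarrow> (\<exists>p\<in>mod_hom R E M. p (j u) \<noteq> \<zero>\<^bsub>M\<^esub>))"
proof -
  obtain E :: "('r, 'r \<Rightarrow> nat \<Rightarrow> 'm) module" and j and I :: "(('r \<Rightarrow> nat \<Rightarrow> 'm) \<Rightarrow> 'm) set" and f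
    where E: "injective_module R E" and j: "j \<in> mod_hom R M E" "inj_on j (carrier M)"
      and f: "f \<in> mod_hom R E (power_module M I)" "inj_on f (carrier E)"
    using assms(2) unfolding QF3_def injective_envelope_def cogenerates_def
    by (elim exE conjE) (rule that)
  interpret M: left_module R M by fact
  interpret E: left_module R E using E by (simp add: injective_module_def)
  have P: "left_module R (power_module M I)" by (rule M.left_module_power)
  show ?thesis
  proof (intro exI[of _ E] exI[of _ j] conjI E j(1) ballI impI)
    fix u assume u: "u \<in> carrier M" "u \<noteq> \<zero>\<^bsub>M\<^esub>"
    note ju = mod_hom_closed[OF j(1) u(1)]
    have "j u \<noteq> \<zero>\<^bsub>E\<^esub>"
      using inj_onD[OF j(2), of u "\<zero>\<^bsub>M\<^esub>"] u mod_hom_zero[OF M E.left_module_axioms j(1)] by auto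
    then have ne: "f (j u) \<noteq> \<zero>\<^bsub>power_module M I\<^esub>"
      using inj_onD[OF f(2), of "j u" "\<zero>\<^bsub>E\<^esub>"] ju mod_hom_zero[OF E.left_module_axioms P f(1)] by auto
    have c: "f x \<in> I \<rightarrow>\<^sub>E carrier M" if "x \<in> carrier E" for x
      using mod_hom_closed[OF f(1) that] by (simp add: power_module_def)
    obtain i where i: "i \<in> I" "f (j u) i \<noteq> \<zero>\<^bsub>M\<^esub>"
      using ne c[OF ju] by (auto simp: power_module_def fun_eq_iff PiE_def extensional_def) metis
    have "(\<lambda>x\<in>carrier E. f x i) \<in> mod_hom R E M"
      by (rule E.mod_hom_restrictI)
        (use c i(1) in \<open>auto simp: mod_hom_add[OF f(1)] mod_hom_smult[OF f(1)] power_module_def\<close>)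
    then show "\<exists>p\<in>mod_hom R E M. p (j u) \<noteq> \<zero>\<^bsub>M\<^esub>" using i(2) ju by (intro bexI) auto
  qed
qed

text \<open>The vanishing condition lets \<open>\<psi>\<close> descend to the image of
  \<open>K\<close> under \<open>f\<close>, and injectivity extends the result from there to all of
  \<open>N\<close>. It serves to eliminate one equation at a time from a linear system.\<close>

lemma injective_module_factor:
  fixes S :: "('s, 'a) ring_scheme" and E :: "('s, 'e, 'b) module_scheme"
  assumes E: "injective_module S E" and Q: "left_module S Q" and N: "left_module S N"
    and f: "f \<in> mod_hom S Q N" and \<psi>: "\<psi> \<in> mod_hom S Q E" and K: "submodule K S Q"
    and van: "\<And>z. z \<in> K \<Longrightarrow> f z = \<zero>\<^bsub>N\<^esub> \<Longrightarrow> \<psi> z = \<zero>\<^bsub>E\<^esub>"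
  shows "\<exists>\<theta>\<in>mod_hom S N E. \<forall>z\<in>K. \<theta> (f z) = \<psi> z"
proof -
  interpret Q: left_module S Q by fact
  interpret N: left_module S N by fact
  interpret E: left_module S E using E by (simp add: injective_module_def)
  note K' = Q.submodule_closed[OF K]
  let ?A = "N\<lparr>carrier := f ` K\<rparr>"
  have A: "left_module S ?A" by (rule N.submodule_left_module[OF Q.submodule_image[OF N f K]])
  interpret A: left_module S ?A by (rule A)
  have Kc: "z \<in> carrier Q" if "z \<in> K" for z using that K'(1) by blast
  have wd: "\<psi> z = \<psi> z'" if "z \<in> K" "z' \<in> K" "f z = f z'" for z z'
  proof -
    have "f (z \<ominus>\<^bsub>Q\<^esub> z') = \<zero>\<^bsub>N\<^esub>"
      using mod_hom_minus[OF Q N f Kc Kc, OF that(1,2)] that(3) mod_hom_closed[OF f Kc[OF that(2)]] by simp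
    then have "\<psi> z \<ominus>\<^bsub>E\<^esub> \<psi> z' = \<zero>\<^bsub>E\<^esub>"
      using van[OF K'(5)[OF that(1,2)]] mod_hom_minus[OF Q E.left_module_axioms \<psi> Kc Kc, OF that(1,2)] by simp
    then show ?thesis using mod_hom_closed[OF \<psi> Kc] that by simp
  qed
  define g where "g = (\<lambda>x\<in>carrier ?A. \<psi> (SOME z. z \<in> K \<and> f z = x))"
  have g: "g (f z) = \<psi> z" if "z \<in> K" for z
  proof -
    have "(SOME z'. z' \<in> K \<and> f z' = f z) \<in> K \<and> f (SOME z'. z' \<in> K \<and> f z' = f z) = f z"
      by (rule someI[of _ z]) (use that in simp)
    then have "\<psi> (SOME z'. z' \<in> K \<and> f z' = f z) = \<psi> z" using wd[OF _ that] by blast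
    then show ?thesis using that by (simp add: g_def)
  qed
  have "restrict g (carrier ?A) \<in> mod_hom S ?A E"
  proof (rule A.mod_hom_restrictI)
    show "g x \<in> carrier E" if "x \<in> carrier ?A" for x
      using that g mod_hom_closed[OF \<psi> Kc] by auto
    fix x y assume "x \<in> carrier ?A" "y \<in> carrier ?A"
    then obtain z z' where z: "z \<in> K" "x = f z" "z' \<in> K" "y = f z'" by auto
    then have "x \<oplus>\<^bsub>?A\<^esub> y = f (z \<oplus>\<^bsub>Q\<^esub> z')" using mod_hom_add[OF f Kc Kc] by simp
    then show "g (x \<oplus>\<^bsub>?A\<^esub> y) = g x \<oplus>\<^bsub>E\<^esub> g y"
      using z g K'(3) mod_hom_add[OF \<psi> Kc Kc] by simp
  next
    fix a x assume a: "a \<in> carrier S" and "x \<in> carrier ?A"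
    then obtain z where z: "z \<in> K" "x = f z" by auto
    then have "a \<odot>\<^bsub>?A\<^esub> x = f (a \<odot>\<^bsub>Q\<^esub> z)" using mod_hom_smult[OF f a Kc] by simp
    then show "g (a \<odot>\<^bsub>?A\<^esub> x) = a \<odot>\<^bsub>E\<^esub> g x"
      using z g K'(4)[OF a] mod_hom_smult[OF \<psi> a Kc] by simp
  qed
  moreover have "restrict g (carrier ?A) = g" by (simp add: g_def)
  ultimately have gh: "g \<in> mod_hom S ?A E" by simp
  have "(\<lambda>x\<in>carrier ?A. x) \<in> mod_hom S ?A N"
    by (rule A.mod_hom_restrictI) (use mod_hom_closed[OF f Kc] in auto)
  from injective_module_lift[OF E A N this _ gh]
  obtain \<theta> where "\<theta> \<in> mod_hom S N E" "\<forall>x\<in>carrier ?A. \<theta> ((\<lambda>x\<in>carrier ?A. x) x) = g x"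
    by (auto simp: inj_on_def)
  then show ?thesis using g by (intro bexI[of _ \<theta>]) auto
qed

text \<open>\<open>Y\<close> is a maximal essential extension of \<open>U\<close> inside
  \<open>W\<close>, and \<open>C\<close> is maximal among the submodules meeting \<open>Y\<close> in
  zero. Injectivity extends the projection of \<open>Y + C\<close> onto \<open>Y\<close> to an
  endomorphism \<open>\<rho>\<close> of \<open>W\<close>. Its image is still essential over
  \<open>U\<close>, so it cannot exceed \<open>Y\<close>.\<close>

lemma injective_envelope_retract:
  assumes W: "injective_module R W" and U: "submodule U R W"
  shows "\<exists>Y \<rho>. submodule Y R W \<and> U \<subseteq> Y \<and> \<rho> \<in> mod_hom R W W \<and> \<rho> ` carrier W = Y \<and> (\<forall>y\<in>Y. \<rho> y = y) \<and>
    (\<forall>y\<in>Y. y \<noteq> \<zero>\<^bsub>W\<^esub> \<longrightarrow> (\<exists>a\<in>carrier R. a \<odot>\<^bsub>W\<^esub> y \<in> U \<and> a \<odot>\<^bsub>W\<^esub> y \<noteq> \<zero>\<^bsub>W\<^esub>))"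
proof -
  interpret W: left_module R W using W by (simp add: injective_module_def)
  define Q where "Q y \<longleftrightarrow> (y \<noteq> \<zero>\<^bsub>W\<^esub> \<longrightarrow> (\<exists>a\<in>carrier R. a \<odot>\<^bsub>W\<^esub> y \<in> U \<and> a \<odot>\<^bsub>W\<^esub> y \<noteq> \<zero>\<^bsub>W\<^esub>))" for y
  have QU: "\<forall>x\<in>U. Q x"
    using W.submodule_closed(1)[OF U] by (auto simp: Q_def intro!: bexI[of _ "\<one>\<^bsub>R\<^esub>"])
  from W.submodule_maximal[where Q = Q, OF U QU] obtain Y where
    Y: "submodule Y R W" "U \<subseteq> Y" "\<forall>y\<in>Y. Q y"
    and Ymax: "\<forall>N'. submodule N' R W \<and> Y \<subseteq> N' \<and> (\<forall>x\<in>N'. Q x) \<longrightarrow> N' = Y"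
    by (elim exE conjE) (rule that)
  note Yc = W.submodule_closed[OF Y(1)]
  have "\<forall>x\<in>{\<zero>\<^bsub>W\<^esub>}. x \<in> Y \<longrightarrow> x = \<zero>\<^bsub>W\<^esub>" by simp
  from W.submodule_maximal[where Q = "\<lambda>x. x \<in> Y \<longrightarrow> x = \<zero>\<^bsub>W\<^esub>", OF W.submodule_zero this] obtain C where
    C: "submodule C R W" "{\<zero>\<^bsub>W\<^esub>} \<subseteq> C" "\<forall>x\<in>C. x \<in> Y \<longrightarrow> x = \<zero>\<^bsub>W\<^esub>"
    and Cmax: "\<forall>N'. submodule N' R W \<and> C \<subseteq> N' \<and> (\<forall>x\<in>N'. x \<in> Y \<longrightarrow> x = \<zero>\<^bsub>W\<^esub>) \<longrightarrow> N' = C"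
    by (elim exE conjE) (rule that)
  note Cc = W.submodule_closed[OF C(1)]
  let ?Y = "W\<lparr>carrier := Y\<rparr>" and ?C = "W\<lparr>carrier := C\<rparr>"
  let ?P = "prod_module ?Y ?C"
  have Pl: "left_module R ?P"
    by (intro left_module_prod W.submodule_left_module Y(1) C(1))
  interpret P: left_module R ?P by (rule Pl)
  have cY: "y \<in> carrier W" if "y \<in> Y" for y using Yc(1) that by blast
  have cC: "y \<in> carrier W" if "y \<in> C" for y using Cc(1) that by blast
  let ?s = "\<lambda>z\<in>carrier ?P. fst z \<oplus>\<^bsub>W\<^esub> snd z"
  have s: "?s \<in> mod_hom R ?P W"
    by (rule P.mod_hom_restrictI) (auto simp: cY cC W.smult_r_distr W.M.a_ac)
  have g: "(\<lambda>z\<in>carrier ?P. fst z) \<in> mod_hom R ?P W"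
    by (rule P.mod_hom_restrictI) (auto simp: cY)
  have inj: "inj_on ?s (carrier ?P)"
  proof (rule inj_onI)
    fix z z' assume z: "z \<in> carrier ?P" "z' \<in> carrier ?P" "?s z = ?s z'"
    have c: "fst z \<in> Y" "fst z' \<in> Y" "snd z \<in> C" "snd z' \<in> C" using z by auto
    have "(fst z \<oplus>\<^bsub>W\<^esub> snd z) \<ominus>\<^bsub>W\<^esub> (fst z' \<oplus>\<^bsub>W\<^esub> snd z') = \<zero>\<^bsub>W\<^esub>" using z c cY cC by simp
    then have "(fst z \<ominus>\<^bsub>W\<^esub> fst z') \<oplus>\<^bsub>W\<^esub> (snd z \<ominus>\<^bsub>W\<^esub> snd z') = \<zero>\<^bsub>W\<^esub>"
      using c cY cC W.M.add_minus_add[of "fst z" "fst z'" "snd z" "snd z'"] by simp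
    then have "snd z' \<ominus>\<^bsub>W\<^esub> snd z = fst z \<ominus>\<^bsub>W\<^esub> fst z'"
      using c cY cC
      by (metis W.M.minus_closed W.M.minus_equality a_minus_def W.M.a_inv_closed W.M.minus_add W.M.minus_minus W.M.a_comm)
    then have "fst z \<ominus>\<^bsub>W\<^esub> fst z' \<in> C" using Cc(5)[OF c(4,3)] by simp
    then have *: "fst z \<ominus>\<^bsub>W\<^esub> fst z' = \<zero>\<^bsub>W\<^esub>" using C(3) Yc(5)[OF c(1,2)] by blast
    then have "snd z' \<ominus>\<^bsub>W\<^esub> snd z = \<zero>\<^bsub>W\<^esub>" using \<open>snd z' \<ominus>\<^bsub>W\<^esub> snd z = fst z \<ominus>\<^bsub>W\<^esub> fst z'\<close> by simp
    with * show "z = z'" using c cY cC by (simp add: prod_eq_iff)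
  qed
  obtain \<rho> where \<rho>: "\<rho> \<in> mod_hom R W W" "\<forall>z\<in>carrier ?P. \<rho> (?s z) = (\<lambda>z\<in>carrier ?P. fst z) z"
    using injective_module_lift[OF W Pl W.left_module_axioms s inj g] by (elim bexE) (rule that)
  have \<rho>': "\<rho> (y \<oplus>\<^bsub>W\<^esub> c) = y" if "y \<in> Y" "c \<in> C" for y c
    using bspec[OF \<rho>(2), of "(y, c)"] that by simp
  have \<rho>Y: "\<rho> y = y" if "y \<in> Y" for y using \<rho>'[OF that Cc(2)] cY[OF that] by simp
  have \<rho>C: "\<rho> c = \<zero>\<^bsub>W\<^esub>" if "c \<in> C" for c using \<rho>'[OF Yc(2) that] cC[OF that] by simp
  have sub: "submodule (\<rho> ` carrier W) R W"
    by (rule W.submodule_image[OF W.left_module_axioms \<rho>(1) W.submodule_carrier])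
  have YW: "Y \<subseteq> \<rho> ` carrier W"
  proof
    fix y assume "y \<in> Y" then show "y \<in> \<rho> ` carrier W" using \<rho>Y[of y] cY[of y] by (metis imageI)
  qed
  have "\<forall>v\<in>\<rho> ` carrier W. Q v"
  proof
    fix v assume "v \<in> \<rho> ` carrier W"
    then obtain w where w: "w \<in> carrier W" "v = \<rho> w" by blast
    have "\<exists>a\<in>carrier R. a \<odot>\<^bsub>W\<^esub> v \<in> U \<and> a \<odot>\<^bsub>W\<^esub> v \<noteq> \<zero>\<^bsub>W\<^esub>" if v: "v \<noteq> \<zero>\<^bsub>W\<^esub>"
    proof -
      let ?C' = "{x \<oplus>\<^bsub>W\<^esub> r \<odot>\<^bsub>W\<^esub> w | x r. x \<in> C \<and> r \<in> carrier R}"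
      note adj = W.submodule_adjoin[OF C(1) w(1)]
      \<comment> \<open>Maximality of \<open>C\<close> yields a nonzero \<open>c + r w\<close> in
        \<open>Y\<close>. As \<open>\<rho>\<close> fixes it and kills \<open>c\<close>, it equals
        \<open>r v\<close>; so a multiple of \<open>v\<close> is a nonzero element of
        \<open>Y\<close>, and a further multiple is one of \<open>U\<close>.\<close>
      have "w \<notin> C" using v w(2) \<rho>C by blast
      then have "?C' \<noteq> C" using adj(3) by blast
      then have "\<not> (\<forall>x\<in>?C'. x \<in> Y \<longrightarrow> x = \<zero>\<^bsub>W\<^esub>)" using spec[OF Cmax, of ?C'] adj(1,2) by argo
      then obtain c r where c: "c \<in> C" "r \<in> carrier R" "c \<oplus>\<^bsub>W\<^esub> r \<odot>\<^bsub>W\<^esub> w \<in> Y" "c \<oplus>\<^bsub>W\<^esub> r \<odot>\<^bsub>W\<^esub> w \<noteq> \<zero>\<^bsub>W\<^esub>"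
        by blast
      have "c \<oplus>\<^bsub>W\<^esub> r \<odot>\<^bsub>W\<^esub> w = \<rho> (c \<oplus>\<^bsub>W\<^esub> r \<odot>\<^bsub>W\<^esub> w)" using \<rho>Y[OF c(3)] by simp
      also have "\<dots> = r \<odot>\<^bsub>W\<^esub> v"
        using c(1,2) cC w \<rho>C mod_hom_closed[OF \<rho>(1) w(1)] by (simp add: mod_hom_add[OF \<rho>(1)] mod_hom_smult[OF \<rho>(1)])
      finally have rv: "r \<odot>\<^bsub>W\<^esub> v \<in> Y" "r \<odot>\<^bsub>W\<^esub> v \<noteq> \<zero>\<^bsub>W\<^esub>" using c(3,4) by simp_all
      then obtain b where b: "b \<in> carrier R" "b \<odot>\<^bsub>W\<^esub> (r \<odot>\<^bsub>W\<^esub> v) \<in> U" "b \<odot>\<^bsub>W\<^esub> (r \<odot>\<^bsub>W\<^esub> v) \<noteq> \<zero>\<^bsub>W\<^esub>"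
        using bspec[OF Y(3) rv(1)] by (auto simp: Q_def)
      then show ?thesis
        using c(2) w mod_hom_closed[OF \<rho>(1) w(1)]
        by (intro bexI[of _ "b \<otimes>\<^bsub>R\<^esub> r"]) (auto simp: W.smult_assoc1)
    qed
    then show "Q v" by (simp add: Q_def)
  qed
  then have "\<rho> ` carrier W = Y" using spec[OF Ymax, of "\<rho> ` carrier W"] sub YW by argo
  moreover have "\<forall>y\<in>Y. \<rho> y = y" using \<rho>Y by blast
  ultimately show ?thesis
    using Y(3) unfolding Q_def by (intro exI[of _ Y] exI[of _ \<rho>] conjI Y(1,2) \<rho>(1))
qed

section \<open>Balanced pairs of module structures\<close>

text \<open>Both actions are written on the left of one abelian group, so that exchanging the sides
  of a bimodule is just a second interpretation. \<open>endomorphism\<close> and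
  \<open>faithful\<close> are one half of the balance condition: \<open>R\<close> maps onto the
  \<open>S\<close>-endomorphisms of \<open>N\<close>, with zero kernel.\<close>

locale balanced_pair = M: left_module R M + N: left_module S N
  for R :: "('r, 'a) ring_scheme" and M :: "('r, 'u, 'c) module_scheme"
    and S :: "('s, 'b) ring_scheme" and N :: "('s, 'u, 'd) module_scheme" +
  assumes carrier_eq: "carrier N = carrier M" and add_eq: "add N = add M" and zero_eq: "zero N = zero M"
    and commute: "\<And>a s u. a \<in> carrier R \<Longrightarrow> s \<in> carrier S \<Longrightarrow> u \<in> carrier M \<Longrightarrow>
      a \<odot>\<^bsub>M\<^esub> (s \<odot>\<^bsub>N\<^esub> u) = s \<odot>\<^bsub>N\<^esub> (a \<odot>\<^bsub>M\<^esub> u)"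
    and endomorphism: "\<And>f. f \<in> mod_hom S N N \<Longrightarrow> \<exists>a\<in>carrier R. \<forall>u\<in>carrier M. f u = a \<odot>\<^bsub>M\<^esub> u"
    and faithful: "\<And>a. a \<in> carrier R \<Longrightarrow> \<forall>u\<in>carrier M. a \<odot>\<^bsub>M\<^esub> u = \<zero>\<^bsub>M\<^esub> \<Longrightarrow> a = \<zero>\<^bsub>R\<^esub>"
    and artinian_M: "artinian_module R M"
    and artinian_N: "artinian_module S N"
    and artinian_S: "artinian_module S (regular_module S)"
    and artinian_op_S: "artinian_module (op_ring S) (regular_module (op_ring S))"
begin

section \<open>The second action on the common carrier\<close>

lemma N_closed: "s \<in> carrier S \<Longrightarrow> u \<in> carrier M \<Longrightarrow> s \<odot>\<^bsub>N\<^esub> u \<in> carrier M"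
  using N.smult_closed by (simp add: carrier_eq)

lemma N_r_distr:
  "s \<in> carrier S \<Longrightarrow> u \<in> carrier M \<Longrightarrow> v \<in> carrier M \<Longrightarrow> s \<odot>\<^bsub>N\<^esub> (u \<oplus>\<^bsub>M\<^esub> v) = s \<odot>\<^bsub>N\<^esub> u \<oplus>\<^bsub>M\<^esub> s \<odot>\<^bsub>N\<^esub> v"
  using N.smult_r_distr[of s u v] by (simp add: carrier_eq add_eq)

lemma N_l_distr:
  "s \<in> carrier S \<Longrightarrow> t \<in> carrier S \<Longrightarrow> u \<in> carrier M \<Longrightarrow> (s \<oplus>\<^bsub>S\<^esub> t) \<odot>\<^bsub>N\<^esub> u = s \<odot>\<^bsub>N\<^esub> u \<oplus>\<^bsub>M\<^esub> t \<odot>\<^bsub>N\<^esub> u"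
  using N.smult_l_distr[of s t u] by (simp add: carrier_eq add_eq)

lemma N_assoc:
  "s \<in> carrier S \<Longrightarrow> t \<in> carrier S \<Longrightarrow> u \<in> carrier M \<Longrightarrow> (s \<otimes>\<^bsub>S\<^esub> t) \<odot>\<^bsub>N\<^esub> u = s \<odot>\<^bsub>N\<^esub> (t \<odot>\<^bsub>N\<^esub> u)"
  using N.smult_assoc1[of s t u] by (simp add: carrier_eq)

lemma N_one: "u \<in> carrier M \<Longrightarrow> \<one>\<^bsub>S\<^esub> \<odot>\<^bsub>N\<^esub> u = u"
  using N.smult_one[of u] by (simp add: carrier_eq)

lemma N_l_null: "u \<in> carrier M \<Longrightarrow> \<zero>\<^bsub>S\<^esub> \<odot>\<^bsub>N\<^esub> u = \<zero>\<^bsub>M\<^esub>"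
  using N.smult_l_null[of u] by (simp add: carrier_eq zero_eq)

lemma N_r_null: "s \<in> carrier S \<Longrightarrow> s \<odot>\<^bsub>N\<^esub> \<zero>\<^bsub>M\<^esub> = \<zero>\<^bsub>M\<^esub>"
  using N.smult_r_null[of s] by (simp add: zero_eq)

lemma minus_eq: "u \<in> carrier M \<Longrightarrow> v \<in> carrier M \<Longrightarrow> u \<ominus>\<^bsub>N\<^esub> v = u \<ominus>\<^bsub>M\<^esub> v"
proof -
  assume u: "u \<in> carrier M" "v \<in> carrier M"
  have "\<ominus>\<^bsub>N\<^esub> v = \<ominus>\<^bsub>M\<^esub> v"
    by (rule N.M.minus_equality) (use u in \<open>simp_all add: carrier_eq add_eq zero_eq M.M.l_neg\<close>)
  then show ?thesis by (simp add: a_minus_def add_eq)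
qed

lemmas N_simps = N_closed N_r_distr N_l_distr N_assoc N_one N_l_null N_r_null

lemma zero_minus_zero: "\<zero>\<^bsub>M\<^esub> \<ominus>\<^bsub>M\<^esub> \<zero>\<^bsub>M\<^esub> = \<zero>\<^bsub>M\<^esub>"
  by simp

section \<open>Extending homomorphisms from left ideals\<close>

abbreviation left_ideal_hom :: "'r set \<Rightarrow> ('r \<Rightarrow> 'u) \<Rightarrow> bool"
  where "left_ideal_hom L \<phi> \<equiv> submodule L R (regular_module R) \<and> \<phi> \<in> mod_hom R (regular_module R\<lparr>carrier := L\<rparr>) M"

lemma left_ideal_homD:
  assumes "left_ideal_hom L \<phi>"
  shows "L \<subseteq> carrier R" "\<zero>\<^bsub>R\<^esub> \<in> L" "\<And>l l'. l \<in> L \<Longrightarrow> l' \<in> L \<Longrightarrow> l \<oplus>\<^bsub>R\<^esub> l' \<in> L"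
    "\<And>a l. a \<in> carrier R \<Longrightarrow> l \<in> L \<Longrightarrow> a \<otimes>\<^bsub>R\<^esub> l \<in> L"
    "\<And>l. l \<in> L \<Longrightarrow> \<phi> l \<in> carrier M"
    "\<And>l l'. l \<in> L \<Longrightarrow> l' \<in> L \<Longrightarrow> \<phi> (l \<oplus>\<^bsub>R\<^esub> l') = \<phi> l \<oplus>\<^bsub>M\<^esub> \<phi> l'"
    "\<And>a l. a \<in> carrier R \<Longrightarrow> l \<in> L \<Longrightarrow> \<phi> (a \<otimes>\<^bsub>R\<^esub> l) = a \<odot>\<^bsub>M\<^esub> \<phi> l"
    "\<phi> \<zero>\<^bsub>R\<^esub> = \<zero>\<^bsub>M\<^esub>"
proof -
  interpret RR: left_module R "regular_module R" by (rule M.R.left_module_regular_module)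
  have L: "submodule L R (regular_module R)" and \<phi>: "\<phi> \<in> mod_hom R (regular_module R\<lparr>carrier := L\<rparr>) M"
    using assms by auto
  note c = RR.submodule_closed[OF L]
  show "L \<subseteq> carrier R" "\<zero>\<^bsub>R\<^esub> \<in> L" "\<And>l l'. l \<in> L \<Longrightarrow> l' \<in> L \<Longrightarrow> l \<oplus>\<^bsub>R\<^esub> l' \<in> L"
    "\<And>a l. a \<in> carrier R \<Longrightarrow> l \<in> L \<Longrightarrow> a \<otimes>\<^bsub>R\<^esub> l \<in> L"
    using c(1-4) by (auto simp: regular_module_def)
  show "\<And>l. l \<in> L \<Longrightarrow> \<phi> l \<in> carrier M" using mod_hom_closed[OF \<phi>] by simp
  show "\<And>l l'. l \<in> L \<Longrightarrow> l' \<in> L \<Longrightarrow> \<phi> (l \<oplus>\<^bsub>R\<^esub> l') = \<phi> l \<oplus>\<^bsub>M\<^esub> \<phi> l'"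
    using mod_hom_add[OF \<phi>] by (simp add: regular_module_def)
  show "\<And>a l. a \<in> carrier R \<Longrightarrow> l \<in> L \<Longrightarrow> \<phi> (a \<otimes>\<^bsub>R\<^esub> l) = a \<odot>\<^bsub>M\<^esub> \<phi> l"
    using mod_hom_smult[OF \<phi>] by (simp add: regular_module_def)
  show "\<phi> \<zero>\<^bsub>R\<^esub> = \<zero>\<^bsub>M\<^esub>"
    using mod_hom_zero[OF RR.submodule_left_module[OF L] M.left_module_axioms \<phi>] by (simp add: regular_module_def)
qed

lemma left_ideal_homI:
  assumes "submodule L R (regular_module R)" "\<And>l. l \<in> L \<Longrightarrow> \<phi> l \<in> carrier M"
    "\<And>l l'. l \<in> L \<Longrightarrow> l' \<in> L \<Longrightarrow> \<phi> (l \<oplus>\<^bsub>R\<^esub> l') = \<phi> l \<oplus>\<^bsub>M\<^esub> \<phi> l'"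
    "\<And>a l. a \<in> carrier R \<Longrightarrow> l \<in> L \<Longrightarrow> \<phi> (a \<otimes>\<^bsub>R\<^esub> l) = a \<odot>\<^bsub>M\<^esub> \<phi> l"
  shows "left_ideal_hom L (restrict \<phi> L)"
proof -
  interpret RR: left_module R "regular_module R" by (rule M.R.left_module_regular_module)
  interpret L: left_module R "regular_module R\<lparr>carrier := L\<rparr>" by (rule RR.submodule_left_module[OF assms(1)])
  have "restrict \<phi> (carrier (regular_module R\<lparr>carrier := L\<rparr>)) \<in> mod_hom R (regular_module R\<lparr>carrier := L\<rparr>) M"
    by (rule L.mod_hom_restrictI) (use assms in \<open>simp_all add: regular_module_def\<close>)
  then show ?thesis using assms(1) by simp
qed

text \<open>A homomorphism from \<open>R\<close> to \<open>M\<close> is determined by its value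
  \<open>w\<close> at the unit and sends \<open>l\<close> to \<open>l w\<close>; hence this says
  that \<open>\<gamma> \<phi>\<close> extends from \<open>L\<close> to \<open>R\<close>.\<close>

definition extends :: "'r set \<Rightarrow> ('r \<Rightarrow> 'u) \<Rightarrow> 's \<Rightarrow> bool"
  where "extends L \<phi> \<gamma> \<longleftrightarrow> (\<exists>w\<in>carrier M. \<forall>l\<in>L. \<gamma> \<odot>\<^bsub>N\<^esub> \<phi> l = l \<odot>\<^bsub>M\<^esub> w)"

text \<open>
  The pairs \<open>(\<gamma>, w)\<close> with \<open>\<gamma> \<phi> l = l w\<close> for all \<open>l \<in> L\<close> form the solution module of a system of
  equations, which is equivalent to a finite one by the descending chain condition. If \<open>\<gamma> u = 0\<close>
  for all solutions, then injectivity of \<open>E\<close> makes \<open>j (\<gamma> u)\<close> a combination of the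
  left-hand sides of finitely many equations. After composition with \<open>p\<close> the coefficients lie in \<open>R\<close>,
  so the combination is a single equation, given by some \<open>l \<in> L\<close>; here \<open>w\<close> forces \<open>l = 0\<close>.
\<close>

lemma extends_separating:
  fixes E :: "('s, 'e, 'f) module_scheme"
  assumes E: "injective_module S E" and j: "j \<in> mod_hom S N E"
    and sep: "\<And>u. u \<in> carrier N \<Longrightarrow> u \<noteq> \<zero>\<^bsub>N\<^esub> \<Longrightarrow> \<exists>p\<in>mod_hom S E N. p (j u) \<noteq> \<zero>\<^bsub>N\<^esub>"
    and \<phi>: "left_ideal_hom L \<phi>" and u: "u \<in> carrier M" "u \<noteq> \<zero>\<^bsub>M\<^esub>"
  shows "\<exists>\<gamma>\<in>carrier S. extends L \<phi> \<gamma> \<and> \<gamma> \<odot>\<^bsub>N\<^esub> u \<noteq> \<zero>\<^bsub>M\<^esub>"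
proof (rule ccontr)
  assume contra: "\<not> ?thesis"
  interpret E: left_module S E using E by (simp add: injective_module_def)
  interpret SS: left_module S "regular_module S" by (rule N.R.left_module_regular_module)
  note L = left_ideal_homD[OF \<phi>]
  let ?Q = "prod_module (regular_module S) N"
  interpret Q: left_module S ?Q by (rule left_module_prod[OF SS.left_module_axioms N.left_module_axioms])
  have Qc: "fst z \<in> carrier S" "snd z \<in> carrier M" if "z \<in> carrier ?Q" for z
    using that by (auto simp: regular_module_def carrier_eq)
  have Lc: "l \<in> carrier R" if "l \<in> L" for l using L(1) that by blast
  \<comment> \<open>One equation for each \<open>l\<close>, as a map in the unknowns
    \<open>(\<gamma>, w)\<close>. It is \<open>S\<close>-linear in \<open>w\<close> because the two
    actions commute.\<close>
  define f where "f l = (\<lambda>z\<in>carrier ?Q. fst z \<odot>\<^bsub>N\<^esub> \<phi> l \<ominus>\<^bsub>N\<^esub> l \<odot>\<^bsub>M\<^esub> snd z)" for l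
  have f: "f l \<in> mod_hom S ?Q N" if l: "l \<in> L" for l
  proof -
    have 1: "(\<lambda>z\<in>carrier ?Q. fst z \<odot>\<^bsub>N\<^esub> \<phi> l) \<in> mod_hom S ?Q N"
      by (rule Q.mod_hom_restrictI)
        (use L(5)[OF l] Qc in \<open>simp_all add: regular_module_def carrier_eq add_eq N_simps\<close>)
    have 2: "(\<lambda>z\<in>carrier ?Q. l \<odot>\<^bsub>M\<^esub> snd z) \<in> mod_hom S ?Q N"
      by (rule Q.mod_hom_restrictI)
        (use Lc[OF l] Qc in \<open>simp_all add: carrier_eq add_eq M.smult_r_distr commute mem_Times_iff\<close>)
    have "f l = (\<lambda>z\<in>carrier ?Q. (\<lambda>z\<in>carrier ?Q. fst z \<odot>\<^bsub>N\<^esub> \<phi> l) z \<ominus>\<^bsub>N\<^esub> (\<lambda>z\<in>carrier ?Q. l \<odot>\<^bsub>M\<^esub> snd z) z)"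
      unfolding f_def by (rule restrict_ext) simp
    then show ?thesis using mod_hom_diff[OF Q.left_module_axioms N.left_module_axioms 1 2] by simp
  qed
  have f_eq: "f l z = fst z \<odot>\<^bsub>N\<^esub> \<phi> l \<ominus>\<^bsub>M\<^esub> l \<odot>\<^bsub>M\<^esub> snd z" if "l \<in> L" "z \<in> carrier ?Q" for l z
    using that Qc[OF that(2)] L(5)[OF that(1)] Lc[OF that(1)] by (simp add: f_def minus_eq N_simps)
  have ker: "\<forall>l\<in>L. submodule {z \<in> carrier ?Q. f l z \<in> {\<zero>\<^bsub>N\<^esub>}} S ?Q"
    using Q.submodule_vimage[OF N.left_module_axioms f N.submodule_zero] by blast
  have artQ: "artinian_module S ?Q"
    by (rule artinian_prod[OF SS.left_module_axioms N.left_module_axioms artinian_S artinian_N])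
  from Q.artinian_finite_Inter[where A = "\<lambda>l. {z \<in> carrier ?Q. f l z \<in> {\<zero>\<^bsub>N\<^esub>}}", OF artQ ker]
  obtain F where F: "finite F" "F \<subseteq> L"
    and F': "\<forall>z\<in>carrier ?Q. (\<forall>l\<in>F. z \<in> {z \<in> carrier ?Q. f l z \<in> {\<zero>\<^bsub>N\<^esub>}}) \<longrightarrow>
      (\<forall>l\<in>L. z \<in> {z \<in> carrier ?Q. f l z \<in> {\<zero>\<^bsub>N\<^esub>}})"
    by (elim exE conjE) (rule that)
  \<comment> \<open>The claim is made for every \<open>\<psi>\<close> because the induction changes
    it: the equation \<open>l0\<close> is removed by subtracting from \<open>\<psi>\<close> a
    composite of \<open>f l0\<close> with some \<open>\<theta>\<close> that agrees with
    \<open>\<psi>\<close> on the solutions of the remaining equations.\<close>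
  have lift: "\<exists>l\<in>L. \<forall>z\<in>carrier ?Q. p (\<psi> z) = f l z"
    if p: "p \<in> mod_hom S E N" and "finite F" "F \<subseteq> L" "\<psi> \<in> mod_hom S ?Q E"
      "\<And>z. z \<in> carrier ?Q \<Longrightarrow> \<forall>l\<in>F. f l z = \<zero>\<^bsub>N\<^esub> \<Longrightarrow> \<psi> z = \<zero>\<^bsub>E\<^esub>" for p F \<psi>
    using that(2-)
  proof (induction F arbitrary: \<psi>)
    case empty
    have "p (\<psi> z) = f \<zero>\<^bsub>R\<^esub> z" if "z \<in> carrier ?Q" for z
      using empty(3)[OF that] mod_hom_zero[OF E.left_module_axioms N.left_module_axioms p] Qc[OF that]
      by (simp add: f_eq[OF L(2) that] L(8) N_simps zero_eq zero_minus_zero)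
    then show ?case using L(2) by blast
  next
    case (insert l0 F)
    then have l0: "l0 \<in> L" by simp
    let ?K = "{z \<in> carrier ?Q. \<forall>l\<in>F. z \<in> {z \<in> carrier ?Q. f l z \<in> {\<zero>\<^bsub>N\<^esub>}}}"
    have K: "submodule ?K S ?Q" by (rule Q.submodule_Inter) (use insert.prems(1) ker in auto)
    have "\<exists>\<theta>\<in>mod_hom S N E. \<forall>z\<in>?K. \<theta> (f l0 z) = \<psi> z"
      by (rule injective_module_factor[OF E Q.left_module_axioms N.left_module_axioms f[OF l0] insert.prems(2) K])
        (rule insert.prems(3), auto)
    then obtain \<theta> where \<theta>: "\<theta> \<in> mod_hom S N E" "\<And>z. z \<in> ?K \<Longrightarrow> \<theta> (f l0 z) = \<psi> z" by blast
    let ?g = "compose (carrier ?Q) \<theta> (f l0)"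
    let ?\<psi>' = "\<lambda>z\<in>carrier ?Q. \<psi> z \<ominus>\<^bsub>E\<^esub> ?g z"
    note g = mod_hom_compose[OF f[OF l0] \<theta>(1) Q.left_module_axioms]
    have "\<exists>l\<in>L. \<forall>z\<in>carrier ?Q. p (?\<psi>' z) = f l z"
    proof (rule insert.IH)
      show "F \<subseteq> L" using insert.prems(1) by simp
      show "?\<psi>' \<in> mod_hom S ?Q E"
        by (rule mod_hom_diff[OF Q.left_module_axioms E.left_module_axioms insert.prems(2) g])
      fix z assume z: "z \<in> carrier ?Q" "\<forall>l\<in>F. f l z = \<zero>\<^bsub>N\<^esub>"
      then have "z \<in> ?K" by simp
      from \<theta>(2)[OF this] show "?\<psi>' z = \<zero>\<^bsub>E\<^esub>"
        using z(1) mod_hom_closed[OF insert.prems(2) z(1)] by (simp add: compose_def)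
    qed
    then obtain l where l: "l \<in> L" "\<And>z. z \<in> carrier ?Q \<Longrightarrow> p (?\<psi>' z) = f l z" by blast
    \<comment> \<open>The balance condition enters here: \<open>p\<close> after
      \<open>\<theta>\<close> is an \<open>S\<close>-endomorphism of \<open>N\<close>, hence
      multiplication by some \<open>a\<close> in \<open>R\<close>. Since \<open>f\<close> is
      \<open>R\<close>-linear in its index, the removed equation is absorbed as
      \<open>l + a l0\<close>.\<close>
    obtain a where a: "a \<in> carrier R" "\<And>v. v \<in> carrier M \<Longrightarrow> compose (carrier N) p \<theta> v = a \<odot>\<^bsub>M\<^esub> v"
      using endomorphism[OF mod_hom_compose[OF \<theta>(1) p N.left_module_axioms]] by blast
    have "p (\<psi> z) = f (l \<oplus>\<^bsub>R\<^esub> a \<otimes>\<^bsub>R\<^esub> l0) z" if z: "z \<in> carrier ?Q" for z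
    proof -
      have c: "\<psi> z \<in> carrier E" "f l0 z \<in> carrier N" "\<theta> (f l0 z) \<in> carrier E" "f l z \<in> carrier N"
        using mod_hom_closed[OF insert.prems(2) z] mod_hom_closed[OF f[OF l0] z] mod_hom_closed[OF \<theta>(1)]
          mod_hom_closed[OF f[OF l(1)] z] by auto
      have "\<psi> z = (\<psi> z \<ominus>\<^bsub>E\<^esub> \<theta> (f l0 z)) \<oplus>\<^bsub>E\<^esub> \<theta> (f l0 z)"
        using c by (simp add: a_minus_def E.M.a_assoc E.M.l_neg)
      then have "p (\<psi> z) = p (\<psi> z \<ominus>\<^bsub>E\<^esub> \<theta> (f l0 z)) \<oplus>\<^bsub>N\<^esub> p (\<theta> (f l0 z))"
        using mod_hom_add[OF p, of "\<psi> z \<ominus>\<^bsub>E\<^esub> \<theta> (f l0 z)" "\<theta> (f l0 z)"] c by simp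
      also have "p (\<psi> z \<ominus>\<^bsub>E\<^esub> \<theta> (f l0 z)) = f l z" using l(2)[OF z] z by (simp add: compose_def)
      also have "p (\<theta> (f l0 z)) = a \<odot>\<^bsub>M\<^esub> f l0 z" using a(2)[of "f l0 z"] c(2) by (simp add: compose_def carrier_eq)
      also have "f l z \<oplus>\<^bsub>N\<^esub> a \<odot>\<^bsub>M\<^esub> f l0 z = f (l \<oplus>\<^bsub>R\<^esub> a \<otimes>\<^bsub>R\<^esub> l0) z"
        using f_eq[OF l(1) z] f_eq[OF l0 z] f_eq[OF L(3)[OF l(1) L(4)[OF a(1) l0]] z] L(5)[OF l(1)] L(5)[OF l0]
          Lc[OF l(1)] Lc[OF l0] a(1) Qc[OF z]
        by (simp add: add_eq L(6)[OF l(1) L(4)[OF a(1) l0]] L(7)[OF a(1) l0] N_simps M.smult_r_minus commute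
            M.smult_l_distr M.smult_assoc1 M.M.add_minus_add)
      finally show ?thesis .
    qed
    then show ?case using L(3)[OF l(1) L(4)[OF a(1) l0]] by blast
  qed
  have uN: "u \<in> carrier N" using u(1) by (simp add: carrier_eq)
  let ?\<psi> = "\<lambda>z\<in>carrier ?Q. j (fst z \<odot>\<^bsub>N\<^esub> u)"
  have \<psi>: "?\<psi> \<in> mod_hom S ?Q E"
    by (rule Q.mod_hom_restrictI)
      (use Qc uN in \<open>simp_all add: regular_module_def mod_hom_closed[OF j] N.smult_l_distr N.smult_assoc1
        mod_hom_add[OF j] mod_hom_smult[OF j] mem_Times_iff\<close>)
  have van: "?\<psi> z = \<zero>\<^bsub>E\<^esub>" if z: "z \<in> carrier ?Q" "\<forall>l\<in>F. f l z = \<zero>\<^bsub>N\<^esub>" for z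
  proof -
    have "f l z = \<zero>\<^bsub>N\<^esub>" if "l \<in> L" for l using bspec[OF F' z(1)] z that by simp
    then have "fst z \<odot>\<^bsub>N\<^esub> \<phi> l = l \<odot>\<^bsub>M\<^esub> snd z" if "l \<in> L" for l
      using f_eq[OF that z(1), symmetric] Qc[OF z(1)] L(5)[OF that] Lc[OF that] that by (simp add: zero_eq N_simps)
    then have "extends L \<phi> (fst z)" using Qc[OF z(1)] unfolding extends_def by blast
    then have "fst z \<odot>\<^bsub>N\<^esub> u = \<zero>\<^bsub>N\<^esub>" using contra Qc[OF z(1)] by (auto simp: zero_eq)
    then show ?thesis using z(1) mod_hom_zero[OF N.left_module_axioms E.left_module_axioms j] by simp
  qed
  obtain p where p: "p \<in> mod_hom S E N" "p (j u) \<noteq> \<zero>\<^bsub>N\<^esub>"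
    using sep[OF uN] u(2) by (auto simp: zero_eq)
  obtain l where l: "l \<in> L" "\<And>z. z \<in> carrier ?Q \<Longrightarrow> p (?\<psi> z) = f l z"
    using lift[OF p(1) F \<psi> van] by blast
  \<comment> \<open>The left-hand side does not involve \<open>w\<close>. With
    \<open>\<gamma> = 0\<close> it follows that \<open>l\<close> annihilates \<open>M\<close>, so
    \<open>l = 0\<close> by faithfulness; with \<open>\<gamma> = 1\<close> and \<open>w = 0\<close>
    this contradicts that \<open>p (j u)\<close> is nonzero.\<close>
  have eq: "p (j (\<gamma> \<odot>\<^bsub>N\<^esub> u)) = \<gamma> \<odot>\<^bsub>N\<^esub> \<phi> l \<ominus>\<^bsub>M\<^esub> l \<odot>\<^bsub>M\<^esub> w" if "\<gamma> \<in> carrier S" "w \<in> carrier M" for \<gamma> w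
  proof -
    have z: "(\<gamma>, w) \<in> carrier ?Q" using that by (simp add: regular_module_def carrier_eq)
    show ?thesis using l(2)[OF z] f_eq[OF l(1) z] z by simp
  qed
  have "l \<odot>\<^bsub>M\<^esub> w = \<zero>\<^bsub>M\<^esub>" if w: "w \<in> carrier M" for w
  proof -
    have "\<zero>\<^bsub>M\<^esub> \<ominus>\<^bsub>M\<^esub> l \<odot>\<^bsub>M\<^esub> w = \<zero>\<^bsub>M\<^esub>"
      using eq[OF N.R.zero_closed w, symmetric] u(1) L(5)[OF l(1)]
        mod_hom_zero[OF N.left_module_axioms E.left_module_axioms j]
        mod_hom_zero[OF E.left_module_axioms N.left_module_axioms p(1)]
      by (simp add: N_simps zero_eq)
    then show ?thesis using Lc[OF l(1)] w M.M.minus_zero_iff[of "\<zero>\<^bsub>M\<^esub>" "l \<odot>\<^bsub>M\<^esub> w"] by simp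
  qed
  then have "l = \<zero>\<^bsub>R\<^esub>" using faithful Lc[OF l(1)] by blast
  then have "p (j u) = \<zero>\<^bsub>M\<^esub>"
    using eq[OF N.R.one_closed M.M.zero_closed] u(1) L(8) by (simp add: N_simps zero_minus_zero)
  then show False using p(2) by (simp add: zero_eq)
qed

lemma extends_mult:
  assumes "left_ideal_hom L \<phi>" "extends L \<phi> \<gamma>" "\<gamma> \<in> carrier S" "g \<in> carrier S"
  shows "extends L \<phi> (g \<otimes>\<^bsub>S\<^esub> \<gamma>)"
proof -
  note L = left_ideal_homD[OF assms(1)]
  obtain w where w: "w \<in> carrier M" "\<And>l. l \<in> L \<Longrightarrow> \<gamma> \<odot>\<^bsub>N\<^esub> \<phi> l = l \<odot>\<^bsub>M\<^esub> w"
    using assms(2) unfolding extends_def by blast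
  have "(g \<otimes>\<^bsub>S\<^esub> \<gamma>) \<odot>\<^bsub>N\<^esub> \<phi> l = l \<odot>\<^bsub>M\<^esub> (g \<odot>\<^bsub>N\<^esub> w)" if "l \<in> L" for l
    using assms(3,4) w that L(1) L(5)[OF that] by (simp add: N_assoc commute subset_iff)
  then show ?thesis using N_closed[OF assms(4) w(1)] unfolding extends_def by blast
qed

lemma extends_add:
  assumes "left_ideal_hom L \<phi>" "extends L \<phi> \<gamma>" "extends L \<phi> \<delta>" "\<gamma> \<in> carrier S" "\<delta> \<in> carrier S"
  shows "extends L \<phi> (\<gamma> \<oplus>\<^bsub>S\<^esub> \<delta>)"
proof -
  note L = left_ideal_homD[OF assms(1)]
  obtain w where w: "w \<in> carrier M" "\<And>l. l \<in> L \<Longrightarrow> \<gamma> \<odot>\<^bsub>N\<^esub> \<phi> l = l \<odot>\<^bsub>M\<^esub> w"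
    using assms(2) unfolding extends_def by blast
  obtain v where v: "v \<in> carrier M" "\<And>l. l \<in> L \<Longrightarrow> \<delta> \<odot>\<^bsub>N\<^esub> \<phi> l = l \<odot>\<^bsub>M\<^esub> v"
    using assms(3) unfolding extends_def by blast
  have "(\<gamma> \<oplus>\<^bsub>S\<^esub> \<delta>) \<odot>\<^bsub>N\<^esub> \<phi> l = l \<odot>\<^bsub>M\<^esub> (w \<oplus>\<^bsub>M\<^esub> v)" if "l \<in> L" for l
    using assms(4,5) w v that L(1) L(5)[OF that] by (simp add: N_l_distr M.smult_r_distr subset_iff)
  then show ?thesis using w(1) v(1) unfolding extends_def by blast
qed

lemma extends_zero:
  assumes "left_ideal_hom L \<phi>"
  shows "extends L \<phi> \<zero>\<^bsub>S\<^esub>"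
  using left_ideal_homD(1,5)[OF assms] unfolding extends_def
  by (intro bexI[of _ "\<zero>\<^bsub>M\<^esub>"]) (auto simp: N_simps)

lemma left_ideal_hom_twist:
  assumes "left_ideal_hom L \<phi>" "g \<in> carrier S"
  shows "left_ideal_hom L (\<lambda>l\<in>L. g \<odot>\<^bsub>N\<^esub> \<phi> l)"
proof -
  note L = left_ideal_homD[OF assms(1)]
  show ?thesis
    by (rule left_ideal_homI) (use assms L(5-7) in \<open>simp_all add: N_simps commute\<close>)
qed

text \<open>A scalar in front of \<open>\<phi>\<close> can be counted with \<open>\<gamma>\<close>.
  This makes the extending elements closed under multiplication on the right, and it lets a product
  of scalars deal with several homomorphisms in succession.\<close>

lemma extends_twist:
  assumes "left_ideal_hom L \<phi>" "g \<in> carrier S" "\<gamma> \<in> carrier S"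
  shows "extends L (\<lambda>l\<in>L. g \<odot>\<^bsub>N\<^esub> \<phi> l) \<gamma> \<longleftrightarrow> extends L \<phi> (\<gamma> \<otimes>\<^bsub>S\<^esub> g)"
  using assms left_ideal_homD(5)[OF assms(1)] by (auto simp: extends_def N_assoc)

section \<open>The two-sided ideal of extending elements\<close>

definition ext_ideal :: "'s set"
  where "ext_ideal = {\<gamma> \<in> carrier S. \<forall>L \<phi>. left_ideal_hom L \<phi> \<longrightarrow> extends L \<phi> \<gamma>}"

lemma ext_ideal_closed:
  "ext_ideal \<subseteq> carrier S" "\<zero>\<^bsub>S\<^esub> \<in> ext_ideal"
  "\<gamma> \<in> ext_ideal \<Longrightarrow> \<delta> \<in> ext_ideal \<Longrightarrow> \<gamma> \<oplus>\<^bsub>S\<^esub> \<delta> \<in> ext_ideal"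
  "\<gamma> \<in> ext_ideal \<Longrightarrow> g \<in> carrier S \<Longrightarrow> g \<otimes>\<^bsub>S\<^esub> \<gamma> \<in> ext_ideal"
  "\<gamma> \<in> ext_ideal \<Longrightarrow> g \<in> carrier S \<Longrightarrow> \<gamma> \<otimes>\<^bsub>S\<^esub> g \<in> ext_ideal"
proof -
  show "ext_ideal \<subseteq> carrier S" by (auto simp: ext_ideal_def)
  show "\<zero>\<^bsub>S\<^esub> \<in> ext_ideal" unfolding ext_ideal_def using extends_zero by blast
  show "\<gamma> \<oplus>\<^bsub>S\<^esub> \<delta> \<in> ext_ideal" if "\<gamma> \<in> ext_ideal" "\<delta> \<in> ext_ideal"
    using that extends_add unfolding ext_ideal_def by blast
  show "g \<otimes>\<^bsub>S\<^esub> \<gamma> \<in> ext_ideal" if "\<gamma> \<in> ext_ideal" "g \<in> carrier S"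
    using that extends_mult unfolding ext_ideal_def by blast
  show "\<gamma> \<otimes>\<^bsub>S\<^esub> g \<in> ext_ideal" if "\<gamma> \<in> ext_ideal" "g \<in> carrier S"
    using that extends_twist left_ideal_hom_twist unfolding ext_ideal_def by blast
qed

text \<open>One element has to serve all pairs \<open>(L, \<phi>)\<close>, while \<open>sep\<close>
  provides one for each. The chain condition on left ideals of \<open>S\<close> leaves finitely many
  pairs, and their elements are combined by multiplication.\<close>

lemma ext_ideal_faithful:
  assumes sep: "\<And>L \<phi> u. left_ideal_hom L \<phi> \<Longrightarrow> u \<in> carrier M \<Longrightarrow> u \<noteq> \<zero>\<^bsub>M\<^esub> \<Longrightarrow>
      \<exists>\<gamma>\<in>carrier S. extends L \<phi> \<gamma> \<and> \<gamma> \<odot>\<^bsub>N\<^esub> u \<noteq> \<zero>\<^bsub>M\<^esub>"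
    and u: "u \<in> carrier M" "u \<noteq> \<zero>\<^bsub>M\<^esub>"
  shows "\<exists>\<gamma>\<in>ext_ideal. \<gamma> \<odot>\<^bsub>N\<^esub> u \<noteq> \<zero>\<^bsub>M\<^esub>"
proof -
  interpret SS: left_module S "regular_module S" by (rule N.R.left_module_regular_module)
  define I where "I = {(L, \<phi>). left_ideal_hom L \<phi>}"
  define A where "A = (\<lambda>(L, \<phi>). {\<gamma> \<in> carrier S. extends L \<phi> \<gamma>})"
  have A: "\<forall>i\<in>I. submodule (A i) S (regular_module S)"
  proof
    fix i assume "i \<in> I"
    then obtain L \<phi> where i: "i = (L, \<phi>)" "left_ideal_hom L \<phi>" by (auto simp: I_def)
    show "submodule (A i) S (regular_module S)"
      by (rule SS.subset_submodule)
        (use extends_zero[OF i(2)] extends_add[OF i(2)] extends_mult[OF i(2)] in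
          \<open>auto simp: A_def i(1) regular_module_def\<close>)
  qed
  from SS.artinian_finite_Inter[where A = A, OF artinian_S A] obtain J where J: "finite J" "J \<subseteq> I"
    and J': "\<forall>x\<in>carrier (regular_module S). (\<forall>j\<in>J. x \<in> A j) \<longrightarrow> (\<forall>i\<in>I. x \<in> A i)"
    by (elim exE conjE) (rule that)
  have "\<exists>\<gamma>\<in>carrier S. (\<forall>i\<in>J. \<gamma> \<in> A i) \<and> \<gamma> \<odot>\<^bsub>N\<^esub> u \<noteq> \<zero>\<^bsub>M\<^esub>"
    using J
  proof induction
    case empty
    show ?case using u by (intro bexI[of _ "\<one>\<^bsub>S\<^esub>"]) (auto simp: N_one)
  next
    case (insert i J)
    then obtain \<gamma> where \<gamma>: "\<gamma> \<in> carrier S" "\<forall>i\<in>J. \<gamma> \<in> A i" "\<gamma> \<odot>\<^bsub>N\<^esub> u \<noteq> \<zero>\<^bsub>M\<^esub>" by auto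
    obtain L \<phi> where i: "i = (L, \<phi>)" "left_ideal_hom L \<phi>" using insert.prems by (auto simp: I_def)
    \<comment> \<open>\<open>sep\<close> is applied to the twisted homomorphism and to
      \<open>\<gamma> u\<close>. Then \<open>\<delta> \<gamma>\<close> extends the new
      \<open>\<phi>\<close>, keeps the earlier conditions because these define left ideals, and does
      not annihilate \<open>u\<close>.\<close>
    obtain \<delta> where \<delta>: "\<delta> \<in> carrier S" "extends L (\<lambda>l\<in>L. \<gamma> \<odot>\<^bsub>N\<^esub> \<phi> l) \<delta>" "\<delta> \<odot>\<^bsub>N\<^esub> (\<gamma> \<odot>\<^bsub>N\<^esub> u) \<noteq> \<zero>\<^bsub>M\<^esub>"
      using sep[OF left_ideal_hom_twist[OF i(2) \<gamma>(1)] N_closed[OF \<gamma>(1) u(1)] \<gamma>(3)] by blast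
    show ?case
    proof (intro bexI[of _ "\<delta> \<otimes>\<^bsub>S\<^esub> \<gamma>"] conjI ballI)
      fix k assume "k \<in> insert i J"
      then show "\<delta> \<otimes>\<^bsub>S\<^esub> \<gamma> \<in> A k"
      proof
        assume "k = i"
        then show ?thesis using \<delta>(1,2) \<gamma>(1) extends_twist[OF i(2) \<gamma>(1) \<delta>(1)] by (simp add: A_def i(1))
      next
        assume k: "k \<in> J"
        then have "submodule (A k) S (regular_module S)" "\<gamma> \<in> A k" using A insert.prems \<gamma>(2) by auto
        then show ?thesis using SS.submodule_closed(4)[of "A k" \<delta> \<gamma>] \<delta>(1) by (simp add: regular_module_def)
      qed
    qed (use \<delta> \<gamma>(1) u in \<open>auto simp: N_assoc\<close>)
  qed
  then obtain \<gamma> where \<gamma>: "\<gamma> \<in> carrier S" "\<forall>i\<in>J. \<gamma> \<in> A i" "\<gamma> \<odot>\<^bsub>N\<^esub> u \<noteq> \<zero>\<^bsub>M\<^esub>" by blast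
  have "\<forall>i\<in>I. \<gamma> \<in> A i" using bspec[OF J', of \<gamma>] \<gamma>(1,2) by (simp add: regular_module_def)
  then have "\<gamma> \<in> ext_ideal" using \<gamma>(1) by (auto simp: ext_ideal_def I_def A_def)
  then show ?thesis using \<gamma>(3) by blast
qed

text \<open>
  A simple submodule \<open>V\<close> of \<open>S u\<close> is not annihilated by the extension ideal, so \<open>z = a z\<close> for some
  \<open>z \<in> V\<close> and some \<open>a\<close> in the ideal; since \<open>a\<close> is strongly \<open>\<pi>\<close>-regular, a multiple of a power of \<open>a\<close> is an
  idempotent \<open>e\<close> with \<open>e z = z\<close>.
\<close>

lemma ext_ideal_idempotent:
  assumes faith: "\<And>u. u \<in> carrier M \<Longrightarrow> u \<noteq> \<zero>\<^bsub>M\<^esub> \<Longrightarrow> \<exists>\<gamma>\<in>ext_ideal. \<gamma> \<odot>\<^bsub>N\<^esub> u \<noteq> \<zero>\<^bsub>M\<^esub>"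
    and u: "u \<in> carrier M" "u \<noteq> \<zero>\<^bsub>M\<^esub>"
  shows "\<exists>g\<in>carrier S. \<exists>e\<in>ext_ideal. e \<otimes>\<^bsub>S\<^esub> e = e \<and> e \<odot>\<^bsub>N\<^esub> (g \<odot>\<^bsub>N\<^esub> u) \<noteq> \<zero>\<^bsub>M\<^esub>"
proof -
  \<comment> \<open>Stated for an arbitrary left ideal \<open>T\<close>, since it is needed for the
    whole ring and for \<open>ext_ideal\<close>.\<close>
  have orbit: "submodule ((\<lambda>g. g \<odot>\<^bsub>N\<^esub> z) ` T) S N"
    if T: "T \<subseteq> carrier S" "\<zero>\<^bsub>S\<^esub> \<in> T" "\<And>x y. x \<in> T \<Longrightarrow> y \<in> T \<Longrightarrow> x \<oplus>\<^bsub>S\<^esub> y \<in> T"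
      "\<And>a x. a \<in> carrier S \<Longrightarrow> x \<in> T \<Longrightarrow> a \<otimes>\<^bsub>S\<^esub> x \<in> T" and z: "z \<in> carrier M" for T z
  proof (rule N.subset_submodule)
    show "(\<lambda>g. g \<odot>\<^bsub>N\<^esub> z) ` T \<subseteq> carrier N" using T(1) N_closed[OF _ z] by (auto simp: carrier_eq)
    show "\<zero>\<^bsub>N\<^esub> \<in> (\<lambda>g. g \<odot>\<^bsub>N\<^esub> z) ` T" using T(2) N_l_null[OF z] by (metis imageI zero_eq)
    fix x y assume "x \<in> (\<lambda>g. g \<odot>\<^bsub>N\<^esub> z) ` T" "y \<in> (\<lambda>g. g \<odot>\<^bsub>N\<^esub> z) ` T"
    then obtain g h where gh: "g \<in> T" "h \<in> T" "x = g \<odot>\<^bsub>N\<^esub> z" "y = h \<odot>\<^bsub>N\<^esub> z" by blast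
    then have "x \<oplus>\<^bsub>N\<^esub> y = (g \<oplus>\<^bsub>S\<^esub> h) \<odot>\<^bsub>N\<^esub> z" using T(1) z by (simp add: N_l_distr add_eq subset_iff)
    then show "x \<oplus>\<^bsub>N\<^esub> y \<in> (\<lambda>g. g \<odot>\<^bsub>N\<^esub> z) ` T" using T(3)[OF gh(1,2)] by blast
  next
    fix a x assume a: "a \<in> carrier S" "x \<in> (\<lambda>g. g \<odot>\<^bsub>N\<^esub> z) ` T"
    then obtain g where g: "g \<in> T" "x = g \<odot>\<^bsub>N\<^esub> z" by blast
    then have "a \<odot>\<^bsub>N\<^esub> x = (a \<otimes>\<^bsub>S\<^esub> g) \<odot>\<^bsub>N\<^esub> z" using T(1) z a(1) by (simp add: N_assoc subset_iff)
    then show "a \<odot>\<^bsub>N\<^esub> x \<in> (\<lambda>g. g \<odot>\<^bsub>N\<^esub> z) ` T" using T(4)[OF a(1) g(1)] by blast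
  qed
  let ?\<S> = "{V. submodule V S N \<and> V \<subseteq> (\<lambda>g. g \<odot>\<^bsub>N\<^esub> u) ` carrier S \<and> V \<noteq> {\<zero>\<^bsub>M\<^esub>}}"
  have "u \<in> (\<lambda>g. g \<odot>\<^bsub>N\<^esub> u) ` carrier S" using N_one[OF u(1)] by (metis N.R.one_closed imageI)
  then have "(\<lambda>g. g \<odot>\<^bsub>N\<^esub> u) ` carrier S \<in> ?\<S>" using orbit[OF _ _ _ _ u(1), of "carrier S"] u(2) by auto
  then have "\<exists>V\<in>?\<S>. \<forall>V'\<in>?\<S>. V' \<subseteq> V \<longrightarrow> V' = V" by (intro artinian_minimal[OF artinian_N]) auto
  then obtain V where "V \<in> ?\<S>" and min: "\<forall>V'\<in>?\<S>. V' \<subseteq> V \<longrightarrow> V' = V"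
    by (elim bexE) (rule that)
  then have V: "submodule V S N" "V \<subseteq> (\<lambda>g. g \<odot>\<^bsub>N\<^esub> u) ` carrier S" "V \<noteq> {\<zero>\<^bsub>M\<^esub>}" by simp_all
  note Vc = N.submodule_closed[OF V(1)]
  obtain z where z: "z \<in> V" "z \<noteq> \<zero>\<^bsub>M\<^esub>" using V(3) Vc(2) by (auto simp: zero_eq)
  have zM: "z \<in> carrier M" using Vc(1) z(1) by (auto simp: carrier_eq)
  let ?Iz = "(\<lambda>\<gamma>. \<gamma> \<odot>\<^bsub>N\<^esub> z) ` ext_ideal"
  have Iz: "submodule ?Iz S N" "?Iz \<subseteq> V" "?Iz \<noteq> {\<zero>\<^bsub>M\<^esub>}"
  proof -
    show "submodule ?Iz S N" by (rule orbit[OF ext_ideal_closed(1-4) zM])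
    show "?Iz \<subseteq> V" using Vc(4)[OF _ z(1)] ext_ideal_closed(1) by blast
    show "?Iz \<noteq> {\<zero>\<^bsub>M\<^esub>}" using faith[OF zM z(2)] by blast
  qed
  then have "?Iz \<in> ?\<S>" using V(2) by blast
  then have "?Iz = V" using min Iz(2) by blast
  then obtain a where a: "a \<in> ext_ideal" "a \<odot>\<^bsub>N\<^esub> z = z" using z(1) by (metis imageE)
  have aS: "a \<in> carrier S" using a(1) ext_ideal_closed(1) by blast
  obtain n c where n: "n > 0" and c: "c \<in> carrier S"
    and e: "(c \<otimes>\<^bsub>S\<^esub> a [^]\<^bsub>S\<^esub> n) \<otimes>\<^bsub>S\<^esub> (c \<otimes>\<^bsub>S\<^esub> a [^]\<^bsub>S\<^esub> n) = c \<otimes>\<^bsub>S\<^esub> a [^]\<^bsub>S\<^esub> n"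
      "(c \<otimes>\<^bsub>S\<^esub> a [^]\<^bsub>S\<^esub> n) \<otimes>\<^bsub>S\<^esub> a [^]\<^bsub>S\<^esub> n = a [^]\<^bsub>S\<^esub> (n::nat)"
    using N.R.ex_idempotent_mult[OF artinian_S artinian_op_S aS] by blast
  have pz: "a [^]\<^bsub>S\<^esub> k \<odot>\<^bsub>N\<^esub> z = z" for k :: nat
    by (induction k) (use aS zM a(2) in \<open>simp_all add: N_one N_assoc\<close>)
  let ?e = "c \<otimes>\<^bsub>S\<^esub> a [^]\<^bsub>S\<^esub> n"
  \<comment> \<open>Positivity of the exponent matters: the zeroth power is the unit, which need not
    lie in the ideal.\<close>
  obtain m where m: "n = Suc m" using n gr0_implies_Suc by blast
  have "a [^]\<^bsub>S\<^esub> n \<in> ext_ideal" using ext_ideal_closed(4)[OF a(1)] aS by (simp add: m)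
  then have eI: "?e \<in> ext_ideal" using ext_ideal_closed(4) c by blast
  have "?e \<odot>\<^bsub>N\<^esub> z = ?e \<odot>\<^bsub>N\<^esub> (a [^]\<^bsub>S\<^esub> n \<odot>\<^bsub>N\<^esub> z)" by (simp only: pz)
  also have "\<dots> = (?e \<otimes>\<^bsub>S\<^esub> a [^]\<^bsub>S\<^esub> n) \<odot>\<^bsub>N\<^esub> z" using c aS zM by (simp add: N_assoc N_closed)
  also have "\<dots> = z" by (simp only: e(2) pz)
  finally have ez: "?e \<odot>\<^bsub>N\<^esub> z = z" .
  obtain g where "g \<in> carrier S" "z = g \<odot>\<^bsub>N\<^esub> u" using V(2) z(1) by blast
  then show ?thesis using eI e(1) ez z(2) by metis
qed

text \<open>\<open>W\<close> is the product of the summands \<open>e i M\<close>. Membership in the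
  ideal only extends \<open>e i\<close> times a homomorphism, but on the summand \<open>e i\<close>
  acts as the identity, so there the homomorphism itself extends and Baer's criterion can be checked
  in each coordinate.\<close>

lemma injective_module_idempotents:
  fixes I :: "'i set" and e :: "'i \<Rightarrow> 's"
  assumes e: "\<And>i. i \<in> I \<Longrightarrow> e i \<in> ext_ideal" "\<And>i. i \<in> I \<Longrightarrow> e i \<otimes>\<^bsub>S\<^esub> e i = e i"
  defines "W \<equiv> {x \<in> I \<rightarrow>\<^sub>E carrier M. \<forall>i\<in>I. e i \<odot>\<^bsub>N\<^esub> x i = x i}"
  shows "injective_module R (power_module M I\<lparr>carrier := W\<rparr>)"
proof -
  let ?P = "power_module M I" and ?W = "power_module M I\<lparr>carrier := W\<rparr>"
  interpret P: left_module R ?P by (rule M.left_module_power)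
  have eS: "e i \<in> carrier S" if "i \<in> I" for i using e(1)[OF that] ext_ideal_closed(1) by blast
  have WD: "x i \<in> carrier M" "e i \<odot>\<^bsub>N\<^esub> x i = x i" if "x \<in> W" "i \<in> I" for x i
    using that by (auto simp: W_def)
  have WI: "x \<in> W" if "x \<in> extensional I" "\<And>i. i \<in> I \<Longrightarrow> x i \<in> carrier M" "\<And>i. i \<in> I \<Longrightarrow> e i \<odot>\<^bsub>N\<^esub> x i = x i" for x
    using that by (auto simp: W_def PiE_iff)
  have W: "submodule W R ?P"
  proof (rule P.subset_submodule)
    show "W \<subseteq> carrier ?P" by (auto simp: W_def power_module_def)
  qed (auto intro!: WI simp: power_module_def eS N_simps WD commute[symmetric])
  have Wl: "left_module R ?W" by (rule P.submodule_left_module[OF W])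
  interpret W: left_module R ?W by (rule Wl)
  show ?thesis
  proof (rule injective_moduleI_Baer[OF Wl])
    fix L \<phi> assume L: "submodule L R (regular_module R)" and \<phi>: "\<phi> \<in> mod_hom R (regular_module R\<lparr>carrier := L\<rparr>) ?W"
    have \<phi>W: "\<phi> l \<in> W" if "l \<in> L" for l using mod_hom_closed[OF \<phi>] that by simp
    have hom: "left_ideal_hom L (\<lambda>l\<in>L. \<phi> l i)" if "i \<in> I" for i
    proof (rule left_ideal_homI[OF L])
      show "\<phi> l i \<in> carrier M" if "l \<in> L" for l using \<phi>W[OF that] \<open>i \<in> I\<close> by (auto simp: W_def)
      show "\<phi> (l \<oplus>\<^bsub>R\<^esub> l') i = \<phi> l i \<oplus>\<^bsub>M\<^esub> \<phi> l' i" if "l \<in> L" "l' \<in> L" for l l'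
        using mod_hom_add[OF \<phi>, of l l'] that \<open>i \<in> I\<close> by (simp add: regular_module_def power_module_def)
      show "\<phi> (a \<otimes>\<^bsub>R\<^esub> l) i = a \<odot>\<^bsub>M\<^esub> \<phi> l i" if "a \<in> carrier R" "l \<in> L" for a l
        using mod_hom_smult[OF \<phi>, of a l] that \<open>i \<in> I\<close> by (simp add: regular_module_def power_module_def)
    qed
    have "\<exists>w\<in>carrier M. \<forall>l\<in>L. e i \<odot>\<^bsub>N\<^esub> \<phi> l i = l \<odot>\<^bsub>M\<^esub> w" if i: "i \<in> I" for i
    proof -
      have "extends L (\<lambda>l\<in>L. \<phi> l i) (e i)" using e(1)[OF i] hom[OF i] unfolding ext_ideal_def by blast
      then show ?thesis unfolding extends_def by simp
    qed
    then obtain w where w: "\<And>i. i \<in> I \<Longrightarrow> w i \<in> carrier M"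
      "\<And>i l. i \<in> I \<Longrightarrow> l \<in> L \<Longrightarrow> e i \<odot>\<^bsub>N\<^esub> \<phi> l i = l \<odot>\<^bsub>M\<^esub> w i" by metis
    \<comment> \<open>\<open>w i\<close> itself need not be fixed by \<open>e i\<close>.
      Multiplication by \<open>e i\<close> moves it into the summand, and it still represents
      \<open>\<phi>\<close> because the actions commute and \<open>e i\<close> fixes the values of
      \<open>\<phi>\<close>.\<close>
    let ?w = "\<lambda>i\<in>I. e i \<odot>\<^bsub>N\<^esub> w i"
    have "?w \<in> W" using w(1) eS e(2) by (auto simp: W_def N_closed N_assoc[symmetric])
    moreover have "\<phi> l = l \<odot>\<^bsub>?W\<^esub> ?w" if l: "l \<in> L" for l
    proof (rule extensionalityI[of _ I])
      show "\<phi> l \<in> extensional I" using \<phi>W[OF l] by (simp add: W_def PiE_def)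
      show "l \<odot>\<^bsub>?W\<^esub> ?w \<in> extensional I" by (simp add: power_module_def)
      fix i assume i: "i \<in> I"
      note hD = left_ideal_homD[OF hom[OF i]]
      have c: "\<phi> l i \<in> carrier M" "l \<in> carrier R" using hD(5)[OF l] hD(1) l by auto
      have ei: "e i \<odot>\<^bsub>N\<^esub> \<phi> l i = \<phi> l i" using \<phi>W[OF l] i by (simp add: W_def)
      have "\<phi> l i = e i \<odot>\<^bsub>N\<^esub> (e i \<odot>\<^bsub>N\<^esub> \<phi> l i)" by (simp only: ei)
      also have "\<dots> = e i \<odot>\<^bsub>N\<^esub> (l \<odot>\<^bsub>M\<^esub> w i)" by (simp only: w(2)[OF i l])
      also have "\<dots> = l \<odot>\<^bsub>M\<^esub> (e i \<odot>\<^bsub>N\<^esub> w i)" using c(2) eS[OF i] w(1)[OF i] by (simp add: commute)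
      finally show "\<phi> l i = (l \<odot>\<^bsub>?W\<^esub> ?w) i" using i by (simp add: power_module_def)
    qed
    ultimately show "\<exists>v\<in>carrier ?W. \<forall>r\<in>L. \<phi> r = r \<odot>\<^bsub>?W\<^esub> v" by (intro bexI[of _ ?w]) auto
  qed
qed

text \<open>The maps sending \<open>u\<close> to \<open>e (g u)\<close> are \<open>R\<close>-linear
  with values in injective summands \<open>e M\<close>, and by hypothesis their kernels meet in
  zero. The chain condition on \<open>M\<close> keeps finitely many of them, which embed
  \<open>M\<close> in an injective module of tuples. The coordinates of the tuples are also the
  homomorphisms through which \<open>M\<close> cogenerates the envelope.\<close>

lemma QF3_of_idempotents:
  assumes idem: "\<And>u. u \<in> carrier M \<Longrightarrow> u \<noteq> \<zero>\<^bsub>M\<^esub> \<Longrightarrow>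
      \<exists>g\<in>carrier S. \<exists>e\<in>ext_ideal. e \<otimes>\<^bsub>S\<^esub> e = e \<and> e \<odot>\<^bsub>N\<^esub> (g \<odot>\<^bsub>N\<^esub> u) \<noteq> \<zero>\<^bsub>M\<^esub>"
  shows "QF3 R M"
proof -
  define T where "T = {(g, e). g \<in> carrier S \<and> e \<in> ext_ideal \<and> e \<otimes>\<^bsub>S\<^esub> e = e}"
  define A where "A = (\<lambda>(g, e). {u \<in> carrier M. e \<odot>\<^bsub>N\<^esub> (g \<odot>\<^bsub>N\<^esub> u) = \<zero>\<^bsub>M\<^esub>})"
  have A: "\<forall>t\<in>T. submodule (A t) R M"
  proof
    fix t assume "t \<in> T"
    then obtain g e where t: "t = (g, e)" "g \<in> carrier S" "e \<in> carrier S" using ext_ideal_closed(1) by (auto simp: T_def)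
    show "submodule (A t) R M"
      by (rule M.subset_submodule) (use t in \<open>auto simp: A_def N_simps commute[symmetric]\<close>)
  qed
  from M.artinian_finite_Inter[where A = A, OF artinian_M A] obtain J where J: "finite J" "J \<subseteq> T"
    and J': "\<forall>u\<in>carrier M. (\<forall>t\<in>J. u \<in> A t) \<longrightarrow> (\<forall>t\<in>T. u \<in> A t)"
    by (elim exE conjE) (rule that)
  \<comment> \<open>Numbering the pairs makes the tuples functions on the natural numbers, in
    accordance with the type of the envelope in \<open>QF3\<close>.\<close>
  obtain h where h: "bij_betw h {..<card J} J"
    using ex_bij_betw_nat_finite[OF J(1)] by (auto simp: atLeast0LessThan)
  let ?I = "{..<card J}"
  define g where "g i = fst (h i)" for i
  define e where "e i = snd (h i)" for i
  have hT: "h i \<in> T" if "i \<in> ?I" for i using bij_betwE[OF h] that J(2) by blast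
  have ge: "g i \<in> carrier S" "e i \<in> ext_ideal" "e i \<otimes>\<^bsub>S\<^esub> e i = e i" "e i \<in> carrier S" if "i \<in> ?I" for i
    using hT[OF that] ext_ideal_closed(1) by (auto simp: T_def g_def e_def)
  define W where "W = {x \<in> ?I \<rightarrow>\<^sub>E carrier M. \<forall>i\<in>?I. e i \<odot>\<^bsub>N\<^esub> x i = x i}"
  let ?W = "power_module M ?I\<lparr>carrier := W\<rparr>"
  have inj: "injective_module R ?W"
    unfolding W_def by (rule injective_module_idempotents) (use ge in auto)
  interpret W: left_module R ?W using inj by (simp add: injective_module_def)
  define \<iota> where "\<iota> = (\<lambda>u\<in>carrier M. \<lambda>i\<in>?I. e i \<odot>\<^bsub>N\<^esub> (g i \<odot>\<^bsub>N\<^esub> u))"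
  have \<iota>: "\<iota> \<in> mod_hom R M ?W"
    unfolding \<iota>_def
  proof (rule M.mod_hom_restrictI)
    have "e i \<odot>\<^bsub>N\<^esub> (e i \<odot>\<^bsub>N\<^esub> x) = e i \<odot>\<^bsub>N\<^esub> x" if "i \<in> ?I" "x \<in> carrier M" for i x
      using ge[OF that(1)] that(2) N_assoc[of "e i" "e i" x] by simp
    then show "(\<lambda>i\<in>?I. e i \<odot>\<^bsub>N\<^esub> (g i \<odot>\<^bsub>N\<^esub> u)) \<in> carrier ?W" if "u \<in> carrier M" for u
      using that ge by (auto simp: W_def N_closed)
  qed (use ge in \<open>auto simp: power_module_def fun_eq_iff N_simps commute\<close>)
  have \<iota>_inj: "inj_on \<iota> (carrier M)"
  proof (rule inj_onI, rule ccontr)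
    fix u v assume uv: "u \<in> carrier M" "v \<in> carrier M" "\<iota> u = \<iota> v" "u \<noteq> v"
    let ?d = "u \<ominus>\<^bsub>M\<^esub> v"
    have d: "?d \<in> carrier M" "?d \<noteq> \<zero>\<^bsub>M\<^esub>" using uv by auto
    have "\<iota> ?d = \<iota> v \<ominus>\<^bsub>?W\<^esub> \<iota> v"
      using mod_hom_minus[OF M.left_module_axioms W.left_module_axioms \<iota> uv(1,2)] by (simp only: uv(3))
    also have "\<dots> = \<zero>\<^bsub>?W\<^esub>"
      by (rule iffD2[OF W.M.minus_zero_iff]) (rule mod_hom_closed[OF \<iota> uv(2)] refl)+
    finally have d0: "\<iota> ?d = \<zero>\<^bsub>?W\<^esub>" .
    have z: "e i \<odot>\<^bsub>N\<^esub> (g i \<odot>\<^bsub>N\<^esub> ?d) = \<zero>\<^bsub>M\<^esub>" if "i \<in> ?I" for i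
      using d(1) that fun_cong[OF d0, of i] by (simp add: \<iota>_def power_module_def)
    have "?d \<in> A t" if "t \<in> J" for t
    proof -
      have "t \<in> h ` ?I" using that by (simp only: bij_betw_imp_surj_on[OF h])
      then obtain i where "i \<in> ?I" "t = h i" by blast
      then show ?thesis using z d(1) by (simp add: A_def g_def e_def split_beta)
    qed
    then have "\<forall>t\<in>T. ?d \<in> A t" using bspec[OF J' d(1)] by blast
    then show False using idem[OF d] by (auto simp: T_def A_def)
  qed
  from injective_envelope_retract[OF inj M.submodule_image[OF W.left_module_axioms \<iota> M.submodule_carrier]]
  obtain Y \<rho> where Y: "submodule Y R ?W" "\<iota> ` carrier M \<subseteq> Y" and \<rho>: "\<rho> \<in> mod_hom R ?W ?W" "\<rho> ` carrier ?W = Y"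
    "\<forall>y\<in>Y. \<rho> y = y"
    and ess: "\<forall>y\<in>Y. y \<noteq> \<zero>\<^bsub>?W\<^esub> \<longrightarrow> (\<exists>a\<in>carrier R. a \<odot>\<^bsub>?W\<^esub> y \<in> \<iota> ` carrier M \<and> a \<odot>\<^bsub>?W\<^esub> y \<noteq> \<zero>\<^bsub>?W\<^esub>)"
    by (elim exE conjE) (rule that)
  note Yc = W.submodule_closed[OF Y(1)]
  \<comment> \<open>The elements of \<open>Y\<close> become constant functions because \<open>QF3\<close> prescribes the type of the envelope.\<close>
  define c :: "(nat \<Rightarrow> 'u) \<Rightarrow> 'r \<Rightarrow> nat \<Rightarrow> 'u" where "c x = (\<lambda>_. x)" for x
  \<comment> \<open>Any argument recovers the value of a constant function; \<open>undefined\<close>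
    is one that is always available.\<close>
  define d :: "('r \<Rightarrow> nat \<Rightarrow> 'u) \<Rightarrow> nat \<Rightarrow> 'u" where "d F = F undefined" for F
  have dc: "d (c x) = x" for x by (simp add: c_def d_def)
  define E :: "('r, 'r \<Rightarrow> nat \<Rightarrow> 'u) module" where "E =
    \<lparr>carrier = c ` Y, mult = undefined, one = undefined, zero = c \<zero>\<^bsub>?W\<^esub>,
      add = (\<lambda>F G. c (d F \<oplus>\<^bsub>?W\<^esub> d G)), smult = (\<lambda>a F. c (a \<odot>\<^bsub>?W\<^esub> d F))\<rparr>"
  have E_simps: "carrier E = c ` Y" "\<zero>\<^bsub>E\<^esub> = c \<zero>\<^bsub>?W\<^esub>" "F \<oplus>\<^bsub>E\<^esub> G = c (d F \<oplus>\<^bsub>?W\<^esub> d G)" "a \<odot>\<^bsub>E\<^esub> F = c (a \<odot>\<^bsub>?W\<^esub> d F)" for F G a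
    by (simp_all add: E_def)
  interpret Yl: left_module R "?W\<lparr>carrier := Y\<rparr>" by (rule W.submodule_left_module[OF Y(1)])
  have cY: "y \<in> carrier ?W" if "y \<in> Y" for y using Yc(1) that by blast
  have El: "left_module R E"
  proof -
    have "abelian_group E"
    proof (rule abelian_groupI)
      fix F assume "F \<in> carrier E"
      then obtain y where y: "y \<in> Y" "F = c y" by (auto simp: E_simps)
      have "\<ominus>\<^bsub>?W\<lparr>carrier := Y\<rparr>\<^esub> y \<in> Y" using Yl.M.a_inv_closed[of y] y(1) by simp
      moreover have "\<ominus>\<^bsub>?W\<lparr>carrier := Y\<rparr>\<^esub> y \<oplus>\<^bsub>?W\<^esub> y = \<zero>\<^bsub>?W\<^esub>" using Yl.M.l_neg[of y] y(1) by simp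
      ultimately show "\<exists>G\<in>carrier E. G \<oplus>\<^bsub>E\<^esub> F = \<zero>\<^bsub>E\<^esub>"
        using y(2) by (intro bexI[of _ "c (\<ominus>\<^bsub>?W\<lparr>carrier := Y\<rparr>\<^esub> y)"]) (simp_all only: E_simps dc imageI)
    qed (use Yc(2,3) cY W.M.a_ac W.M.l_zero in \<open>auto simp only: E_simps dc\<close>)
    then show ?thesis
      by (intro left_module.intro left_module_axioms.intro M.R.ring_axioms)
        (use Yc(4) cY W.smult_l_distr W.smult_r_distr W.smult_assoc1 W.smult_one in \<open>auto simp only: E_simps dc\<close>)
  qed
  interpret E: left_module R E by (rule El)
  \<comment> \<open>\<open>d\<close> embeds \<open>E\<close> in the injective module of tuples, and
    \<open>c\<close> after \<open>\<rho>\<close> is a left inverse of it, so \<open>E\<close> is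
    injective as a retract.\<close>
  have s: "restrict d (carrier E) \<in> mod_hom R E ?W"
    by (rule E.mod_hom_restrictI) (use cY in \<open>auto simp only: E_simps dc\<close>)
  have r: "(\<lambda>w\<in>carrier ?W. c (\<rho> w)) \<in> mod_hom R ?W E"
    by (rule W.mod_hom_restrictI)
      (use \<rho>(2) mod_hom_add[OF \<rho>(1)] mod_hom_smult[OF \<rho>(1)] in \<open>auto simp only: E_simps dc\<close>)
  have injE: "injective_module R E"
  proof (rule injective_module_retract[OF inj El s r])
    fix F assume F: "F \<in> carrier E"
    then obtain y where y: "y \<in> Y" "F = c y" by (auto simp only: E_simps)
    have "restrict d (carrier E) F = y" using F by (simp only: restrict_apply' y(2) dc)
    then show "(\<lambda>w\<in>carrier ?W. c (\<rho> w)) (restrict d (carrier E) F) = F"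
      using cY[OF y(1)] bspec[OF \<rho>(3) y(1)] y(2) by (simp only: restrict_apply')
  qed
  let ?j = "\<lambda>u\<in>carrier M. c (\<iota> u)"
  have j: "?j \<in> mod_hom R M E"
    by (rule M.mod_hom_restrictI)
      (use Y(2) mod_hom_add[OF \<iota>] mod_hom_smult[OF \<iota>] in \<open>auto simp only: E_simps dc\<close>)
  have j_inj: "inj_on ?j (carrier M)"
  proof (rule inj_onI)
    fix u v assume "u \<in> carrier M" "v \<in> carrier M" "?j u = ?j v"
    moreover from this have "\<iota> u = \<iota> v" using dc by (metis restrict_apply')
    ultimately show "u = v" using inj_onD[OF \<iota>_inj] by blast
  qed
  have env: "injective_envelope R M ?j E"
    unfolding injective_envelope_def
  proof (intro conjI allI impI injE j j_inj, elim conjE)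
    fix V assume V: "submodule V R E" "V \<inter> ?j ` carrier M = {\<zero>\<^bsub>E\<^esub>}"
    note Vc = E.submodule_closed[OF V(1)]
    show "V = {\<zero>\<^bsub>E\<^esub>}"
    proof (rule ccontr)
      assume "V \<noteq> {\<zero>\<^bsub>E\<^esub>}"
      then obtain F where F: "F \<in> V" "F \<noteq> \<zero>\<^bsub>E\<^esub>" using Vc(2) by blast
      then obtain y where y: "y \<in> Y" "F = c y" using Vc(1) by (auto simp only: E_simps)
      then have "y \<noteq> \<zero>\<^bsub>?W\<^esub>" using F(2) by (auto simp only: E_simps)
      \<comment> \<open>By essentiality in elementwise form a multiple of \<open>F\<close> is a
        nonzero element of the image of \<open>M\<close>; being a multiple of \<open>F\<close>, it
        stays in \<open>V\<close>.\<close>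
      then obtain a u where a: "a \<in> carrier R" "u \<in> carrier M" "a \<odot>\<^bsub>?W\<^esub> y = \<iota> u" "a \<odot>\<^bsub>?W\<^esub> y \<noteq> \<zero>\<^bsub>?W\<^esub>"
        using bspec[OF ess y(1)] by blast
      have "a \<odot>\<^bsub>E\<^esub> F = ?j u" using a(2,3) by (simp only: E_simps y(2) dc restrict_apply')
      then have "?j u \<in> V \<inter> ?j ` carrier M" using Vc(4)[OF a(1) F(1)] a(2) by auto
      then have "?j u = \<zero>\<^bsub>E\<^esub>" using V(2) by blast
      then have "c (\<iota> u) = c \<zero>\<^bsub>?W\<^esub>" using a(2) by (simp only: E_simps restrict_apply')
      then have "\<iota> u = \<zero>\<^bsub>?W\<^esub>" using dc by metis
      then show False using a(3,4) by simp
    qed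
  qed
  have "cogenerates R M E"
  proof (rule cogeneratesI[OF El M.left_module_axioms])
    fix F assume F: "F \<in> carrier E" "F \<noteq> \<zero>\<^bsub>E\<^esub>"
    then obtain y where y: "y \<in> Y" "F = c y" by (auto simp only: E_simps)
    then have "y \<noteq> \<zero>\<^bsub>?W\<^esub>" using F(2) by (auto simp only: E_simps)
    moreover have yI: "x \<in> ?I \<rightarrow>\<^sub>E carrier M" if "x \<in> Y" for x using cY[OF that] by (simp add: W_def)
    ultimately obtain i where i: "i \<in> ?I" "y i \<noteq> \<zero>\<^bsub>M\<^esub>"
      using yI[OF y(1)] by (auto simp: power_module_def fun_eq_iff PiE_def extensional_def) metis
    have "x i \<in> carrier M" if "x \<in> Y" for x using yI[OF that] i(1) by auto
    then have "(\<lambda>F\<in>carrier E. d F i) \<in> mod_hom R E M"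
      by (rule E.mod_hom_restrictI) (use i(1) in \<open>auto simp: E_simps dc power_module_def\<close>)
    then show "\<exists>h\<in>mod_hom R E M. h F \<noteq> \<zero>\<^bsub>M\<^esub>"
      using i(2) F(1) y(2) dc by (intro bexI[of _ "\<lambda>F\<in>carrier E. d F i"]) auto
  qed
  then show ?thesis using env unfolding QF3_def by blast
qed

theorem QF3_transfer:
  assumes "QF3 S N"
  shows "QF3 R M"
proof -
  from QF3_separating[OF N.left_module_axioms assms]
  obtain E :: "('s, 's \<Rightarrow> nat \<Rightarrow> 'u) module" and j where E: "injective_module S E" "j \<in> mod_hom S N E"
    and sep: "\<forall>u\<in>carrier N. u \<noteq> \<zero>\<^bsub>N\<^esub> \<longrightarrow> (\<exists>p\<in>mod_hom S E N. p (j u) \<noteq> \<zero>\<^bsub>N\<^esub>)"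
    by (elim exE conjE) (rule that)
  have 1: "\<exists>\<gamma>\<in>carrier S. extends L \<phi> \<gamma> \<and> \<gamma> \<odot>\<^bsub>N\<^esub> u \<noteq> \<zero>\<^bsub>M\<^esub>"
    if "left_ideal_hom L \<phi>" "u \<in> carrier M" "u \<noteq> \<zero>\<^bsub>M\<^esub>" for L \<phi> u
    by (rule extends_separating[OF E _ that]) (use sep in blast)
  have 2: "\<exists>\<gamma>\<in>ext_ideal. \<gamma> \<odot>\<^bsub>N\<^esub> u \<noteq> \<zero>\<^bsub>M\<^esub>" if "u \<in> carrier M" "u \<noteq> \<zero>\<^bsub>M\<^esub>" for u
    by (rule ext_ideal_faithful[OF 1 that])
  show ?thesis
    by (rule QF3_of_idempotents, rule ext_ideal_idempotent[OF 2])
qed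

end

section \<open>The two sides of a bimodule\<close>

theorem corollary1p5:
  fixes K :: "('k, 'a) ring_scheme" and K' :: "('k2, 'b) ring_scheme"
    and \<Lambda> :: "('k, 'l, 'c) module_scheme" and \<Gamma> :: "('k2, 'g, 'd) module_scheme"
    and U :: "('l, 'g, 'u, 'e) bimodule_scheme"
  assumes "artin_algebra K \<Lambda>"
    and "artin_algebra K' \<Gamma>"
    and "faithfully_balanced_selforthogonal \<Lambda> \<Gamma> U"
  shows "QF3 \<Lambda> U \<longleftrightarrow> QF3 (op_ring \<Gamma>) (right_module U)"
proof -
  let ?G = "op_ring \<Gamma>" and ?N = "right_module U"
  have U: "left_module \<Lambda> U" "left_module ?G ?N"
    and com: "\<And>a g u. a \<in> carrier \<Lambda> \<Longrightarrow> g \<in> carrier \<Gamma> \<Longrightarrow> u \<in> carrier U \<Longrightarrow>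
      (a \<odot>\<^bsub>U\<^esub> u) \<bullet>\<^bsub>U\<^esub> g = a \<odot>\<^bsub>U\<^esub> (u \<bullet>\<^bsub>U\<^esub> g)"
    and fg: "fin_gen_module \<Lambda> U" "fin_gen_module ?G ?N"
    and bij: "bij_betw (\<lambda>a\<in>carrier \<Lambda>. \<lambda>u\<in>carrier U. a \<odot>\<^bsub>U\<^esub> u) (carrier \<Lambda>) (carrier (End_ring ?G ?N))"
      "bij_betw (\<lambda>g\<in>carrier \<Gamma>. \<lambda>u\<in>carrier U. u \<bullet>\<^bsub>U\<^esub> g) (carrier \<Gamma>) (carrier (op_ring (End_ring \<Lambda> U)))"
    using assms(3) unfolding faithfully_balanced_selforthogonal_def is_bimodule_def ring_iso_def by blast+
  \<comment> \<open>Bijectivity onto the endomorphisms splits into two locale assumptions: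
    surjectivity yields \<open>endomorphism\<close> and injectivity yields
    \<open>faithful\<close>.\<close>
  have bij1: "bij_betw (\<lambda>a. \<lambda>u\<in>carrier U. a \<odot>\<^bsub>U\<^esub> u) (carrier \<Lambda>) (mod_hom ?G ?N ?N)"
    using bij(1) by (simp add: End_ring_def)
  have bij2: "bij_betw (\<lambda>g. \<lambda>u\<in>carrier U. u \<bullet>\<^bsub>U\<^esub> g) (carrier \<Gamma>) (mod_hom \<Lambda> U U)"
    using bij(2) by (simp add: End_ring_def op_ring_def)
  interpret L: left_module \<Lambda> U by (rule U)
  interpret G: left_module ?G ?N by (rule U)
  note art = artin_algebra_artinian[OF assms(1)] artin_algebra_artinian[OF assms(2)]
  have artU: "artinian_module \<Lambda> U" "artinian_module ?G ?N"
    by (rule L.artinian_fin_gen[OF art(1) fg(1)], rule G.artinian_fin_gen[OF art(5) fg(2)])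
  have N: "carrier ?N = carrier U" "add ?N = add U" "zero ?N = zero U" "g \<odot>\<^bsub>?N\<^esub> u = u \<bullet>\<^bsub>U\<^esub> g" for g u
    by (simp_all add: right_module_def)
  have G: "carrier ?G = carrier \<Gamma>" "\<zero>\<^bsub>?G\<^esub> = \<zero>\<^bsub>\<Gamma>\<^esub>" by (simp_all add: op_ring_def)
  have endo1: "\<exists>a\<in>carrier \<Lambda>. \<forall>u\<in>carrier U. f u = a \<odot>\<^bsub>U\<^esub> u" if "f \<in> mod_hom ?G ?N ?N" for f
  proof -
    have "f \<in> (\<lambda>a. \<lambda>u\<in>carrier U. a \<odot>\<^bsub>U\<^esub> u) ` carrier \<Lambda>"
      using that by (simp only: bij_betw_imp_surj_on[OF bij1])
    then show ?thesis by auto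
  qed
  have endo2: "\<exists>g\<in>carrier \<Gamma>. \<forall>u\<in>carrier U. f u = u \<bullet>\<^bsub>U\<^esub> g" if "f \<in> mod_hom \<Lambda> U U" for f
  proof -
    have "f \<in> (\<lambda>g. \<lambda>u\<in>carrier U. u \<bullet>\<^bsub>U\<^esub> g) ` carrier \<Gamma>"
      using that by (simp only: bij_betw_imp_surj_on[OF bij2])
    then show ?thesis by auto
  qed
  have faith1: "a = \<zero>\<^bsub>\<Lambda>\<^esub>" if "a \<in> carrier \<Lambda>" "\<forall>u\<in>carrier U. a \<odot>\<^bsub>U\<^esub> u = \<zero>\<^bsub>U\<^esub>" for a
    using that by (intro inj_onD[OF bij_betw_imp_inj_on[OF bij1]]) (auto simp: fun_eq_iff)
  have faith2: "g = \<zero>\<^bsub>?G\<^esub>" if "g \<in> carrier \<Gamma>" "\<forall>u\<in>carrier U. u \<bullet>\<^bsub>U\<^esub> g = \<zero>\<^bsub>U\<^esub>" for g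
    using that G.R.zero_closed G.smult_l_null
    by (intro inj_onD[OF bij_betw_imp_inj_on[OF bij2]]) (auto simp: fun_eq_iff N G)
  \<comment> \<open>This interpretation carries QF-3 from the right module to the left one, the next
    in the other direction. Here the second ring is \<open>op_ring \<Gamma>\<close>, so the chain
    condition on its opposite concerns the double opposite of \<open>\<Gamma>\<close>.\<close>
  interpret LG: balanced_pair \<Lambda> U ?G ?N
    by unfold_locales (use com endo1 faith1 artU art in \<open>simp_all add: N G\<close>)
  interpret GL: balanced_pair ?G ?N \<Lambda> U
    by unfold_locales (use com endo2 faith2 artU art in \<open>simp_all add: N G\<close>)
  show ?thesis using LG.QF3_transfer GL.QF3_transfer by blast
qed

end
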